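(* Let $p(z)=a_0z^n+a_1z^{n-1}+\dots+a_n$ be a real polynomial of degree $n\geqslant 1$ with $a_0>0$. Then $p$ is generalized Hurwitz (of type I) if and only if $$\Delta_{n-1}(p)>0,\ \Delta_{n-3}(p)>0,\ \Delta_{n-5}(p)>0,\ \ldots$$ (all indices $\geqslant 1$ of this parity). In this case the order $k$ of $p$ equals $$k=\mathrm{V}(\Delta_{n}(p),\Delta_{n-2}(p),\ldots,1)\quad\text{if } p(0)\neq0,$$ $$k=\mathrm{V}(\Delta_{n-2}(p),\Delta_{n-4}(p),\ldots,1)+1\quad\text{if } p(0)=0,$$ where the number $\mathrm{V}$ of sign changes is calculated according to the Frobenius rule.
   Context: Put $a_i=0$ for $i<0$ and $i>n$. The Hurwitz determinant $\Delta_j(p)$ ($1\leqslant j\leqslant n$) is the determinant of the $j\times j$ matrix whose $(r,s)$ entry is $a_{2s-r}$, i.e. with first rows $(a_1,a_3,a_5,\dots)$, $(a_0,a_2,a_4,\dots)$, $(0,a_1,a_3,\dots)$, $(0,a_0,a_2,\dots)$, etc.; $\Delta_0(p)=1$. The sequences run down through positive indices of the given parity (to $\Delta_2(p)$ for $n$ even, to $\Delta_1(p)$ for $n$ odd) and end with the number $1$; a sequence with no such indices is just $(1)$. Frobenius rule: in a sequence $D_0,D_1,\dots,D_r$ with $D_0=1$ and $D_r\ne0$, if $D_i\neq0$, $D_{i+1}=\dots=D_{i+j}=0$, $D_{i+j+1}\neq0$, the zero terms are assigned the signs $\operatorname{sign}D_{i+\nu}=(-1)^{\nu(\nu-1)/2}\operatorname{sign}D_i$,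 $\nu=1,\dots,j$; $\mathrm{V}$ is then the number of sign changes between consecutive terms. Here the sequences are read starting from the end $1$ (so $D_0=1$, and $D_1,D_2,\dots$ are the Hurwitz determinants with increasing indices). Generalized Hurwitz polynomials. A real polynomial $p$ of degree $n$ with positive leading coefficient is generalized Hurwitz of type I of order $k$, $0\leqslant k\leqslant[(n+1)/2]$, if: (i) it has exactly $k$ zeroes in the closed right half-plane, all of which are nonnegative real and simple, $0\leqslant\mu_1<\mu_2<\dots<\mu_k$; (ii) $p(-\mu_i)\neq0$ for every positive $\mu_i$; (iii) $p$ has an odd number of zeroes, counting multiplicities, on each interval $(-\mu_k,-\mu_{k-1}),\dots,(-\mu_2,-\mu_1)$; (iv) the number of zeroes of $p$ on $(-\mu_1,0)$ (if any) is even, counting multiplicities; (v) the remaining real zeroes lie on $(-\infty,-\mu_k)$: an odd number of them when $n$ is even and an even number when $n$ is odd, counting multiplicities; (vi) all nonreal zeroes lie in the open left half-plane. For $k=0$ this means that $p$ is Hurwitz stable (all zeroes in the open left half-plane), conditions (ii)-(v) being void. "Generalized Hurwitz" means generalized Hurwitz of type I of some order. *)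

theory Defs
  imports
    "HOL-Computational_Algebra.Computational_Algebra"
    "Jordan_Normal_Form.Determinant"
begin

text \<open>
  The coefficient \<open>a\<^sub>i\<close> in the descending notation
  \<open>p(z) = a\<^sub>0 z\<^sup>n + a\<^sub>1 z\<^sup>n\<^sup>-\<^sup>1 + \<dots> + a\<^sub>n\<close>, extended by \<open>0\<close> to \<open>i < 0\<close> and \<open>i > n\<close>.
\<close>
definition desc_coeff :: "real poly \<Rightarrow> int \<Rightarrow> real" where
  "desc_coeff p i =
     (if 0 \<le> i \<and> i \<le> int (degree p) then coeff p (degree p - nat i) else 0)"

text \<open>
  The \<open>(r, s)\<close> entry is \<open>a\<^bsub>2s-r\<^esub>\<close> for \<open>1 \<le> r, s \<le> j\<close>; matrices of type \<open>mat\<close> are indexed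
  from \<open>0\<close>. For \<open>j = 0\<close> this is the empty determinant \<open>1\<close>.
\<close>
definition hurwitz_det :: "nat \<Rightarrow> real poly \<Rightarrow> real" where
  "hurwitz_det j p =
     det (mat j j (\<lambda>(r, s). desc_coeff p (2 * (int s + 1) - (int r + 1))))"

text \<open>
  The sequence \<open>\<Delta>\<^sub>m, \<Delta>\<^sub>m\<^sub>-\<^sub>2, \<dots>, 1\<close> (the positive indices of the parity of \<open>m\<close>, then the number
  \<open>1\<close>), listed from its end \<open>1\<close>, i.e. with increasing indices.
\<close>
definition hurwitz_seq :: "nat \<Rightarrow> real poly \<Rightarrow> real list" where
  "hurwitz_seq m p =
     1 # map (\<lambda>j. hurwitz_det j p) (filter (\<lambda>j. even j = even m) [1..<Suc m])"

text \<open>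
  Frobenius rule: the sign of the \<open>m\<close>-th term is determined by the last nonzero term \<open>D\<^sub>i\<close> with
  \<open>i \<le> m\<close> and by \<open>\<nu> = m - i\<close>. If the \<open>m\<close>-th term is itself nonzero then \<open>\<nu> = 0\<close> and this is its
  own sign. It is meant for sequences whose first and last terms are nonzero.
\<close>
definition frobenius_sign :: "real list \<Rightarrow> nat \<Rightarrow> real" where
  "frobenius_sign D m =
     (let i = (GREATEST i. i \<le> m \<and> D ! i \<noteq> 0); \<nu> = m - i
      in (-1) ^ (\<nu> * (\<nu> - 1) div 2) * sgn (D ! i))"

definition frobenius_changes :: "real list \<Rightarrow> nat" where
  "frobenius_changes D =
     card {m. Suc m < length D \<and> frobenius_sign D m * frobenius_sign D (Suc m) < 0}"

text \<open>The number of real zeros in a set, counting multiplicities.\<close>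
definition real_zeros_in :: "real poly \<Rightarrow> real set \<Rightarrow> nat" where
  "real_zeros_in p S = size (filter_mset (\<lambda>x. x \<in> S) (proots p))"

text \<open>
  The numbers \<open>\<mu> 1 < \<dots> < \<mu> k\<close> are the zeros in the closed right half-plane.
  For \<open>k = 0\<close> all conditions involving some \<open>\<mu> i\<close> are void and the definition says that \<open>p\<close>, with
  positive leading coefficient, is Hurwitz stable.
\<close>
definition generalized_hurwitz_order :: "real poly \<Rightarrow> nat \<Rightarrow> bool" where
  "generalized_hurwitz_order p k \<longleftrightarrow>
     0 < lead_coeff p \<and> k \<le> (degree p + 1) div 2 \<and>
     (\<exists>\<mu> :: nat \<Rightarrow> real.
        strict_mono_on {1..k} \<mu> \<and> (\<forall>i\<in>{1..k}. 0 \<le> \<mu> i) \<and>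
        {z :: complex. poly (map_poly complex_of_real p) z = 0 \<and> 0 \<le> Re z} =
          (\<lambda>i. complex_of_real (\<mu> i)) ` {1..k} \<and>
        (\<forall>i\<in>{1..k}.
           Polynomial.order (complex_of_real (\<mu> i)) (map_poly complex_of_real p) = 1) \<and>
        (\<forall>i\<in>{1..k}. 0 < \<mu> i \<longrightarrow> poly p (- \<mu> i) \<noteq> 0) \<and>
        (\<forall>i\<in>{1..<k}. odd (real_zeros_in p {- \<mu> (Suc i)<..<- \<mu> i})) \<and>
        (1 \<le> k \<longrightarrow> even (real_zeros_in p {- \<mu> 1<..<0})) \<and>
        (1 \<le> k \<longrightarrow>
           (\<forall>x. poly p x = 0 \<longrightarrow>
              x \<in> \<mu> ` {1..k} \<or> (\<exists>i\<in>{1..<k}. x \<in> {- \<mu> (Suc i)<..<- \<mu> i}) \<or>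
              x \<in> {- \<mu> 1<..<0} \<or> x \<in> {..<- \<mu> k}) \<and>
           (if even (degree p) then odd (real_zeros_in p {..<- \<mu> k})
            else even (real_zeros_in p {..<- \<mu> k}))) \<and>
        (\<forall>z. poly (map_poly complex_of_real p) z = 0 \<and> z \<notin> \<real> \<longrightarrow> Re z < 0))"

definition generalized_hurwitz :: "real poly \<Rightarrow> bool" where
  "generalized_hurwitz p \<longleftrightarrow> (\<exists>k. generalized_hurwitz_order p k)"

end

theory Submission
  imports Defs
begin

text \<open>
Write \<open>p(x) = e(x\<^sup>2) + x o(x\<^sup>2)\<close>. Both sides of the equivalence say that the Bezout kernel
\<open>(e(u) o(v) - o(u) e(v)) / (u - v)\<close> of the even and the odd part is positive definite; the order is,
up to a zero at \<open>0\<close>, the number of negative squares of a second kernel, the one of \<open>u o(u)\<close> and \<open>e(u)\<close>.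

\<^bold>\<open>Determinants.\<close> For even degree put \<open>f = e\<close>, \<open>g = o\<close>. One step of the Euclidean algorithm,
\<open>f = (a + b u) g - h\<close>, adds the square \<open>b g(u) g(v)\<close> to the Bezout kernel of \<open>g\<close> and \<open>h\<close>, so the
kernel is positive definite iff the algorithm never drops more than one degree and all \<open>b\<close> are
positive, i.e. iff \<open>f / g\<close> has a J-fraction with positive \<open>b\<close>. The same step is a row reduction of the
Hurwitz matrix: it lowers the size by two and splits off the square of the leading coefficient of
\<open>g\<close>. Hence positivity of every second determinant also characterises these J-fractions
(\<open>hurwitz_dets_pos_iff_J_fraction\<close>), and the remaining determinants are, up to positive factors, the
continuants of the numbers \<open>a\<close> (\<open>J_fraction_dets_even\<close>). For odd degree \<open>f = e + u o\<close>, \<open>g = o\<close> does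
the same job: this only adds the square \<open>o(u) o(v)\<close> to the kernel and changes each determinant by
one size and one positive factor.

\<^bold>\<open>From zeros to the J-fraction.\<close> The Hermite kernel
\<open>(p(x) p(y) - p(-x) p(-y)) / (x + y)\<close> is twice the sum of the second kernel at \<open>(x\<^sup>2, y\<^sup>2)\<close> and of
\<open>x y\<close> times the Bezout kernel at \<open>(x\<^sup>2, y\<^sup>2)\<close>. It is multiplicative in a twisted sense, so a
factorisation of \<open>p\<close> diagonalises it: every zero in the open left half-plane contributes a positive
square and every positive zero a negative one (\<open>root_form_hermite_rep\<close>). The parity conditions on the
negative zeros of a generalized Hurwitz polynomial amount to \<open>p(-\<mu>) p'(\<mu>) < 0\<close> at each positive zero
\<open>\<mu>\<close> (\<open>root_pair_sign\<close>). They make the second kernel negative definite on the evaluations at the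
points \<open>\<mu>\<^sup>2\<close>, which uses up all negative squares; so the Bezout kernel must be positive definite
(\<open>root_form_imp_bezout_posdef\<close>).

\<^bold>\<open>From the J-fraction to zeros.\<close> Positive \<open>b\<close> give \<open>Im (e(u) cnj (o(u))) \<ge> 0\<close> in the upper half-plane
and \<open>e' o - o' e \<ge> 0\<close> on the real line. The first inequality excludes nonreal zeros of \<open>p\<close> in the
closed right half-plane, the second gives simplicity and the sign condition
(\<open>J_fraction_imp_root_form\<close>).

\<^bold>\<open>The order.\<close> On the polynomials of the J-fraction the second kernel is a tridiagonal form with
diagonal \<open>a\<close> and off-diagonal entries \<open>-1\<close>. Its leading minors are the continuants; two consecutive
ones never vanish, and the neighbours of a zero have opposite signs, so that the Frobenius rule
counts its negative squares (\<open>tridiagonal_diagonalise\<close>). By the law of inertia this number equals the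
number of positive zeros of \<open>p\<close> (\<open>root_form_card\<close>).
\<close>

(* The record selector of modules would hide scalar multiplication of polynomials. *)
hide_const (open) Module.smult

section \<open>Hurwitz determinants of a pair of power series\<close>

definition row_det :: "nat \<Rightarrow> (nat \<Rightarrow> real fps) \<Rightarrow> real" where
  "row_det m R = det (mat m m (\<lambda>(r, s). fps_nth (R r) s))"

text \<open>
The rows of the Hurwitz matrix, read as power series: for \<open>F = a\<^sub>0 + a\<^sub>2 X + \<dots>\<close> and
\<open>G = a\<^sub>1 + a\<^sub>3 X + \<dots>\<close> they are \<open>G, F, X G, X F, X\<^sup>2 G, \<dots>\<close>.
\<close>
definition hurwitz_row :: "real fps \<Rightarrow> real fps \<Rightarrow> nat \<Rightarrow> real fps" where
  "hurwitz_row F G r = fps_X ^ (r div 2) * (if even r then G else F)"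

text \<open>
Replacing rows from the \<open>k\<close>-th on by other series \<open>L\<close> is what appears in the even step below, where
the last row has no partner.
\<close>
definition mixed_det :: "nat \<Rightarrow> nat \<Rightarrow> real fps \<Rightarrow> real fps \<Rightarrow> (nat \<Rightarrow> real fps) \<Rightarrow> real" where
  "mixed_det m k F G L = row_det m (\<lambda>r. if r < k then hurwitz_row F G r else L r)"

lemma row_det_cong: "(\<And>r. r < m \<Longrightarrow> R r = R' r) \<Longrightarrow> row_det m R = row_det m R'"
  unfolding row_det_def by (intro arg_cong[where f = det] eq_matI) auto

lemma row_det_0 [simp]: "row_det 0 R = 1"
  unfolding row_det_def by (simp add: det_def)

text \<open>
Adding to each row a multiple of another one is a multiplication by a unitriangular matrix as soon
as all added rows lie above, or all lie below.
\<close>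
lemma row_det_unitriangular:
  assumes "(\<forall>r<m. c r \<noteq> 0 \<longrightarrow> t r < r) \<or> (\<forall>r<m. c r \<noteq> 0 \<longrightarrow> r < t r \<and> t r < m)"
  shows "row_det m (\<lambda>r. R r + fps_const (c r) * R (t r)) = row_det m R"
proof -
  define C where "C = mat m m (\<lambda>(r, q). (if q = r then 1 else 0) + (if q = t r then c r else 0 :: real))"
  define M where "M = mat m m (\<lambda>(r, s). fps_nth (R r) s)"
  have C: "C \<in> carrier_mat m m" and M: "M \<in> carrier_mat m m"
    by (auto simp: C_def M_def)
  have diag: "prod_list (diag_mat C) = 1"
  proof -
    have "diag_mat C = map (\<lambda>_. 1) [0..<m]"
      using assms unfolding diag_mat_def C_def by (auto intro!: map_cong)
    thus ?thesis by (simp add: map_replicate_const)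
  qed
  have detC: "det C = 1"
    using assms
  proof
    assume a: "\<forall>r<m. c r \<noteq> 0 \<longrightarrow> t r < r"
    have "C $$ (i, j) = 0" if "i < j" "j < m" for i j
    proof -
      have "j = t i \<Longrightarrow> c i = 0" using a that by (meson less_asym order.strict_trans)
      thus ?thesis using that by (auto simp: C_def)
    qed
    hence "det C = prod_list (diag_mat C)"
      by (rule det_lower_triangular[OF _ C])
    with diag show ?thesis by simp
  next
    assume a: "\<forall>r<m. c r \<noteq> 0 \<longrightarrow> r < t r \<and> t r < m"
    have "upper_triangular C"
      unfolding upper_triangular_def using a by (auto simp: C_def)
    from det_upper_triangular[OF this C] diag show ?thesis by simp
  qed
  have eq: "mat m m (\<lambda>(r, s). fps_nth (R r + fps_const (c r) * R (t r)) s) = C * M"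
  proof (rule eq_matI)
    fix r s assume "r < dim_row (C * M)" "s < dim_col (C * M)"
    hence rs: "r < m" "s < m" by (auto simp: C_def M_def)
    have "(C * M) $$ (r, s) = (\<Sum>q = 0..<m. ((if q = r then 1 else 0) + (if q = t r then c r else 0)) * fps_nth (R q) s)"
      using rs by (simp add: C_def M_def scalar_prod_def)
    also have "\<dots> = (\<Sum>q = 0..<m. (if q = r then fps_nth (R q) s else 0))
                  + (\<Sum>q = 0..<m. (if q = t r then c r * fps_nth (R q) s else 0))"
      by (subst sum.distrib[symmetric]) (intro sum.cong, auto simp: algebra_simps)
    also have "\<dots> = fps_nth (R r) s + c r * fps_nth (R (t r)) s"
      using rs assms by (auto simp: sum.delta)
    finally show "mat m m (\<lambda>(r, s). fps_nth (R r + fps_const (c r) * R (t r)) s) $$ (r, s) = (C * M) $$ (r, s)"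
      using rs by simp
  qed (auto simp: C_def M_def)
  have "row_det m (\<lambda>r. R r + fps_const (c r) * R (t r)) = det C * det M"
    unfolding row_det_def eq by (rule det_mult[OF C M])
  thus ?thesis by (simp add: detC row_det_def M_def)
qed

lemma row_det_expand:
  assumes "\<And>r. r < m \<Longrightarrow> R (Suc r) = fps_X * R' r"
  shows "row_det (Suc m) R = fps_nth (R 0) 0 * row_det m R'"
proof -
  define M where "M = mat (Suc m) (Suc m) (\<lambda>(r, s). fps_nth (R r) s)"
  have M: "M \<in> carrier_mat (Suc m) (Suc m)" by (simp add: M_def)
  have z: "M $$ (i, 0) = 0" if "i \<in> {..<Suc m} - {0}" for i
    using that assms[of "i - 1"] by (auto simp: M_def)
  have "det M = (\<Sum>i<Suc m. M $$ (i, 0) * cofactor M i 0)"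
    by (rule laplace_expansion_column[OF M]) simp
  also have "\<dots> = (\<Sum>i\<in>{0}. M $$ (i, 0) * cofactor M i 0)"
    by (rule sum.mono_neutral_right) (use z in auto)
  also have "\<dots> = fps_nth (R 0) 0 * det (mat_delete M 0 0)"
    by (simp add: cofactor_def M_def)
  also have "mat_delete M 0 0 = mat m m (\<lambda>(r, s). fps_nth (R' r) s)"
    by (rule eq_matI) (auto simp: mat_delete_def M_def assms)
  finally show ?thesis by (simp add: row_det_def M_def)
qed

lemma row_det_last_row_linear:
  "row_det (Suc m) (\<lambda>r. if r < m then R r else fps_const c * K + L r) =
   c * row_det (Suc m) (\<lambda>r. if r < m then R r else K) + row_det (Suc m) (\<lambda>r. if r < m then R r else L r)"
proof -
  define M where "M K = mat (Suc m) (Suc m) (\<lambda>(r, s). fps_nth (if r < m then R r else K) s)" for K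
  have M: "M K \<in> carrier_mat (Suc m) (Suc m)" for K by (simp add: M_def)
  have *: "det (M K) = (\<Sum>j<Suc m. fps_nth K j * cofactor (M 0) m j)" for K
  proof -
    have "det (M K) = (\<Sum>j<Suc m. M K $$ (m, j) * cofactor (M K) m j)"
      by (rule laplace_expansion_row[OF M]) simp
    also have "\<dots> = (\<Sum>j<Suc m. fps_nth K j * cofactor (M 0) m j)"
    proof (rule sum.cong)
      fix j assume "j \<in> {..<Suc m}"
      moreover have "mat_delete (M K) m j = mat_delete (M 0) m j"
        by (rule eq_matI) (auto simp: mat_delete_def M_def)
      ultimately show "M K $$ (m, j) * cofactor (M K) m j = fps_nth K j * cofactor (M 0) m j"
        by (simp add: cofactor_def M_def)
    qed simp
    finally show ?thesis .
  qed
  have **: "row_det (Suc m) (\<lambda>r. if r < m then R r else K r) = det (M (K m))" for K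
  proof -
    have "row_det (Suc m) (\<lambda>r. if r < m then R r else K r) = row_det (Suc m) (\<lambda>r. if r < m then R r else K m)"
      by (rule row_det_cong) (auto simp: less_Suc_eq)
    thus ?thesis by (simp add: row_det_def M_def)
  qed
  show ?thesis
    unfolding ** * by (simp add: sum.distrib sum_distrib_left algebra_simps)
qed

lemma mixed_det_shear_F: "mixed_det m k (F + fps_const s * G) G L = mixed_det m k F G L"
proof -
  let ?R = "\<lambda>r. if r < k then hurwitz_row F G r else L r"
  let ?c = "\<lambda>r. if odd r \<and> r < k then s else 0"
  have "row_det m (\<lambda>r. ?R r + fps_const (?c r) * ?R (r - 1)) = row_det m ?R"
    by (rule row_det_unitriangular) (auto elim: oddE)
  moreover have "row_det m (\<lambda>r. ?R r + fps_const (?c r) * ?R (r - 1)) = mixed_det m k (F + fps_const s * G) G L"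
    unfolding mixed_det_def
    by (rule row_det_cong) (auto simp: hurwitz_row_def algebra_simps elim!: oddE)
  ultimately show ?thesis by (simp add: mixed_det_def)
qed

text \<open>
The number of Hurwitz rows has to be even: in the last of an odd number of rows \<open>G\<close> has no \<open>F\<close> below it.
\<close>
lemma mixed_det_shear_G:
  assumes "even k" "k \<le> m"
  shows "mixed_det m k F (G + fps_const s * F) L = mixed_det m k F G L"
proof -
  let ?R = "\<lambda>r. if r < k then hurwitz_row F G r else L r"
  let ?c = "\<lambda>r. if even r \<and> r < k then s else 0"
  have *: "Suc r < k" if "even r" "r < k" for r
    using that assms(1) by (cases "Suc r = k") auto
  have "row_det m (\<lambda>r. ?R r + fps_const (?c r) * ?R (Suc r)) = row_det m ?R"
    by (rule row_det_unitriangular) (use * assms in \<open>auto intro: less_le_trans\<close>)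
  moreover have "row_det m (\<lambda>r. ?R r + fps_const (?c r) * ?R (Suc r)) = mixed_det m k F (G + fps_const s * F) L"
    unfolding mixed_det_def
    by (rule row_det_cong) (auto simp: * hurwitz_row_def algebra_simps)
  ultimately show ?thesis by (simp add: mixed_det_def)
qed

text \<open>
The substitution \<open>(G, F) \<mapsto> (F, - G)\<close> on pairs of rows is a product of three shears.
\<close>
lemma mixed_det_rotate:
  assumes "even k" "k \<le> m"
  shows "mixed_det m k F G L = mixed_det m k (- G) F L"
proof -
  have "mixed_det m k F G L = mixed_det m k F (G + fps_const 1 * F) L"
    by (rule mixed_det_shear_G[OF assms, symmetric])
  also have "\<dots> = mixed_det m k (F + fps_const (-1) * (G + fps_const 1 * F)) (G + fps_const 1 * F) L"
    by (rule mixed_det_shear_F[symmetric])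
  also have "F + fps_const (-1) * (G + fps_const 1 * F) = - G"
    by (simp flip: fps_const_neg)
  also have "mixed_det m k (- G) (G + fps_const 1 * F) L = mixed_det m k (- G) ((G + fps_const 1 * F) + fps_const 1 * (- G)) L"
    by (rule mixed_det_shear_G[OF assms, symmetric])
  also have "(G + fps_const 1 * F) + fps_const 1 * (- G) = F" by simp
  finally show ?thesis .
qed

lemma hurwitz_row_X_Suc: "hurwitz_row (fps_X * F) G (Suc r) = fps_X * hurwitz_row G F r"
  by (auto simp: hurwitz_row_def algebra_simps elim!: oddE evenE)

lemma mixed_det_expand:
  assumes "k \<ge> 1" and "\<And>r. L (Suc r) = fps_X * L' r"
  shows "mixed_det (Suc m) k (fps_const b * G + fps_X * F) G L = fps_nth G 0 * mixed_det m (k - 1) G F L'"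
proof -
  have "mixed_det (Suc m) k (fps_const b * G + fps_X * F) G L = mixed_det (Suc m) k (fps_X * F) G L"
    using mixed_det_shear_F[of "Suc m" k "fps_X * F" b G L] by (simp add: add.commute)
  also have "\<dots> = fps_nth G 0 * mixed_det m (k - 1) G F L'"
    unfolding mixed_det_def using assms
    by (subst row_det_expand[where R' = "\<lambda>r. if r < k - 1 then hurwitz_row G F r else L' r"])
       (auto simp: hurwitz_row_X_Suc, auto simp: hurwitz_row_def)
  finally show ?thesis .
qed

abbreviation fps_det :: "nat \<Rightarrow> real fps \<Rightarrow> real fps \<Rightarrow> real" where
  "fps_det m F G \<equiv> mixed_det m m F G (\<lambda>_. 0)"

text \<open>
The classical Routh step: for \<open>F = b G + X F'\<close> the first column becomes \<open>(G(0), 0, \<dots>, 0)\<close>.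
\<close>
lemma fps_det_expand:
  "fps_det (Suc m) (fps_const b * G + fps_X * F) G = fps_nth G 0 * fps_det m G F"
  using mixed_det_expand[of "Suc m" "\<lambda>_. 0" "\<lambda>_. 0" m b G F] by simp

text \<open>
One Routh step after \<open>F = b G + X (c G - X Y)\<close> leaves the pair \<open>(G, c G - X Y)\<close>. Removing \<open>c G\<close> and
rotating turns it into \<open>(X Y, G)\<close>, which is ready for the next Routh step; this avoids a division by
\<open>c\<close>, which may be \<open>0\<close>.
\<close>
lemma mixed_det_jstep:
  assumes "even k" "k \<le> m"
  shows "mixed_det m k G (fps_const c * G - fps_X * Y) L = mixed_det m k (fps_X * Y) G L"
proof -
  have "mixed_det m k G (fps_const c * G - fps_X * Y) L = mixed_det m k G (- (fps_X * Y)) L"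
    using mixed_det_shear_G[OF assms, of G "- (fps_X * Y)" c L] by (simp add: add.commute)
  also have "\<dots> = mixed_det m k (fps_X * Y) G L"
    using mixed_det_rotate[OF assms, of G "- (fps_X * Y)" L] by simp
  finally show ?thesis .
qed

lemma fps_det_1: "fps_det (Suc 0) F G = fps_nth G 0"
  using fps_det_expand[of 0 0 G 0] row_det_expand[of 0 "\<lambda>r. if r < 1 then hurwitz_row F G r else 0"]
  by (simp add: mixed_det_def hurwitz_row_def)

lemma fps_det_odd_step:
  assumes F: "F = fps_const b * G + fps_X * (fps_const c * G - fps_X * Y)"
  shows "fps_det (2 * j + 3) F G = (fps_nth G 0)\<^sup>2 * fps_det (2 * j + 1) G Y"
proof -
  have "fps_det (2 * j + 3) F G = fps_nth G 0 * fps_det (2 * j + 2) G (fps_const c * G - fps_X * Y)"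
    using fps_det_expand[of "2 * j + 2" b G] by (simp add: F eval_nat_numeral)
  also have "fps_det (2 * j + 2) G (fps_const c * G - fps_X * Y) = fps_det (2 * j + 2) (fps_X * Y) G"
    by (rule mixed_det_jstep) auto
  also have "\<dots> = fps_nth G 0 * fps_det (2 * j + 1) G Y"
    using fps_det_expand[of "2 * j + 1" 0 G Y] by simp
  finally show ?thesis by (simp add: power2_eq_square)
qed

text \<open>
For even size the last row after the first Routh step is an unpaired copy of \<open>X\<^sup>i (c G - X Y)\<close>; its two
summands are separated by linearity in that row.
\<close>
lemma fps_det_even_split:
  assumes F: "F = fps_const b * G + fps_X * (fps_const c * G - fps_X * Y)"
  shows "fps_det (2 * i + 2) F G = (fps_nth G 0)\<^sup>2 * c * fps_det (2 * i) G Y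
           - fps_nth G 0 * mixed_det (2 * i + 1) (2 * i) (fps_X * Y) G (\<lambda>_. fps_X * (fps_X ^ i * Y))"
proof -
  let ?D = "mixed_det (Suc (2 * i)) (2 * i) (fps_X * Y) G"
  have full: "fps_det (Suc (2 * i)) A B = mixed_det (Suc (2 * i)) (2 * i) A B (\<lambda>_. fps_X ^ i * B)" for A B
    unfolding mixed_det_def by (rule row_det_cong) (auto simp: less_Suc_eq hurwitz_row_def)
  have "fps_det (2 * i + 2) F G = fps_nth G 0 * fps_det (Suc (2 * i)) G (fps_const c * G - fps_X * Y)"
    using fps_det_expand[of "Suc (2 * i)" b G] by (simp add: F eval_nat_numeral)
  also have "fps_det (Suc (2 * i)) G (fps_const c * G - fps_X * Y)
      = ?D (\<lambda>_. fps_X ^ i * (fps_const c * G - fps_X * Y))"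
    unfolding full by (rule mixed_det_jstep) auto
  also have "(\<lambda>_. fps_X ^ i * (fps_const c * G - fps_X * Y))
      = (\<lambda>_::nat. fps_const c * (fps_X ^ i * G) + fps_const (-1) * (fps_X * (fps_X ^ i * Y)))"
    by (simp add: algebra_simps flip: fps_const_neg)
  also have "?D (\<lambda>_::nat. fps_const c * (fps_X ^ i * G) + fps_const (-1) * (fps_X * (fps_X ^ i * Y)))
     = c * ?D (\<lambda>_. fps_X ^ i * G) + ?D (\<lambda>_. fps_const (-1) * (fps_X * (fps_X ^ i * Y)))"
    unfolding mixed_det_def by (rule row_det_last_row_linear)
  also have "?D (\<lambda>_. fps_const (-1) * (fps_X * (fps_X ^ i * Y))) = - ?D (\<lambda>_. fps_X * (fps_X ^ i * Y))"
    using row_det_last_row_linear[of "2 * i" "hurwitz_row (fps_X * Y) G" "-1" "fps_X * (fps_X ^ i * Y)" "\<lambda>_. 0"]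
      row_det_last_row_linear[of "2 * i" "hurwitz_row (fps_X * Y) G" "1" "0" "\<lambda>_. 0"]
    unfolding mixed_det_def by (simp only: fps_const_1_eq_1 mult_1_left mult_1_right add_0_right mult_zero_right)
  also have "?D (\<lambda>_. fps_X ^ i * G) = fps_det (Suc (2 * i)) (fps_X * Y) G"
    by (rule full[symmetric])
  also have "\<dots> = fps_nth G 0 * fps_det (2 * i) G Y"
    using fps_det_expand[of "2 * i" 0 G Y] by simp
  finally show ?thesis by (simp add: algebra_simps power2_eq_square)
qed

lemma fps_det_2:
  assumes F: "F = fps_const b * G + fps_X * (fps_const c * G - fps_X * Y)"
  shows "fps_det 2 F G = (fps_nth G 0)\<^sup>2 * c"
proof -
  have "mixed_det (Suc 0) 0 (fps_X * Y) G (\<lambda>_. fps_X * Y) = 0"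
    unfolding mixed_det_def by (subst row_det_expand) auto
  thus ?thesis using fps_det_even_split[OF F, of 0] by (simp add: mixed_det_def eval_nat_numeral)
qed

text \<open>
The unpaired row \<open>X\<^sup>i\<^sup>+\<^sup>1 Y\<close> survives one more division step, and then completes a Hurwitz matrix of
the pair \<open>(Y, Z)\<close>. This is the recursion of continuants.
\<close>
lemma fps_det_even_step:
  assumes F: "F = fps_const b * G + fps_X * (fps_const c * G - fps_X * Y)"
    and G: "G = fps_const b' * Y + fps_X * (fps_const c' * Y - fps_X * Z)"
  shows "fps_det (2 * i + 4) F G =
    (fps_nth G 0)\<^sup>2 * (c * fps_det (2 * i + 2) G Y - (fps_nth Y 0)\<^sup>2 * fps_det (2 * i) Y Z)"
proof -
  let ?Y = "\<lambda>_::nat. fps_X ^ i * Y"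
  have "mixed_det (2 * Suc i + 1) (2 * Suc i) (fps_X * Y) G (\<lambda>_. fps_X * (fps_X ^ Suc i * Y))
     = fps_nth G 0 * mixed_det (2 * i + 2) (2 * i + 1) G Y (\<lambda>_. fps_X * (fps_X ^ i * Y))"
    using mixed_det_expand[of "2 * Suc i" "\<lambda>_. fps_X * (fps_X ^ Suc i * Y)" "\<lambda>_. fps_X * (fps_X ^ i * Y)" "2 * i + 2" 0 G Y]
    by (simp add: algebra_simps)
  also have "mixed_det (2 * i + 2) (2 * i + 1) G Y (\<lambda>_. fps_X * (fps_X ^ i * Y))
     = fps_nth Y 0 * mixed_det (2 * i + 1) (2 * i) Y (fps_const c' * Y - fps_X * Z) ?Y"
    using mixed_det_expand[of "2 * i + 1" "\<lambda>_. fps_X * (fps_X ^ i * Y)" ?Y "2 * i + 1" b' Y "fps_const c' * Y - fps_X * Z"]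
    by (simp flip: G)
  also have "mixed_det (2 * i + 1) (2 * i) Y (fps_const c' * Y - fps_X * Z) ?Y
     = mixed_det (2 * i + 1) (2 * i) (fps_X * Z) Y ?Y"
    by (rule mixed_det_jstep) auto
  also have "\<dots> = fps_det (Suc (2 * i)) (fps_X * Z) Y"
    unfolding mixed_det_def by (simp, rule row_det_cong) (auto simp: less_Suc_eq hurwitz_row_def)
  also have "\<dots> = fps_nth Y 0 * fps_det (2 * i) Y Z"
    using fps_det_expand[of "2 * i" 0 Y Z] by simp
  finally show ?thesis
    using fps_det_even_split[OF F, of "Suc i"] by (simp add: algebra_simps power2_eq_square eval_nat_numeral)
qed

text \<open>
The formal degree \<open>d\<close> may exceed the degree, so that a remainder of small degree keeps its place
in the Hurwitz matrix.
\<close>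
definition rev_fps :: "nat \<Rightarrow> real poly \<Rightarrow> real fps" where
  "rev_fps d f = Abs_fps (\<lambda>i. if i \<le> d then coeff f (d - i) else 0)"

lemma rev_fps_nth_0 [simp]: "fps_nth (rev_fps d f) 0 = coeff f d"
  by (simp add: rev_fps_def)

lemma rev_fps_jstep:
  assumes g: "degree g \<le> d" and h: "\<And>i. i \<ge> d \<Longrightarrow> coeff h i = 0"
  shows "rev_fps (Suc d) ([:c, b:] * g - h) =
     fps_const b * rev_fps d g + fps_X * (fps_const c * rev_fps d g - fps_X * rev_fps (d - 1) h)"
proof (rule fps_ext)
  fix i
  consider "i = 0" | "i = 1" | j where "i = Suc (Suc j)" by (metis One_nat_def not0_implies_Suc)
  thus "fps_nth (rev_fps (Suc d) ([:c, b:] * g - h)) i =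
     fps_nth (fps_const b * rev_fps d g + fps_X * (fps_const c * rev_fps d g - fps_X * rev_fps (d - 1) h)) i"
  proof cases
    case 1 thus ?thesis using g h by (simp add: rev_fps_def coeff_eq_0)
  next
    case 2
    thus ?thesis using h[of d] 
      by (cases d) (auto simp: rev_fps_def)
  next
    case (3 j)
    show ?thesis
    proof (cases "Suc j < d")
      case True
      then obtain e where "d = Suc (Suc (j + e))"
        using less_imp_Suc_add by blast
      thus ?thesis by (simp add: rev_fps_def 3 Suc_diff_le)
    next
      case False
      thus ?thesis using h[of 0]
        by (cases "d = Suc j") (auto simp: rev_fps_def 3 Suc_diff_le coeff_pCons not_less split: nat.splits)
    qed
  qed
qed

lemma hurwitz_det_eq_fps:
  "hurwitz_det m p = fps_det m (Abs_fps (\<lambda>i. desc_coeff p (2 * int i))) (Abs_fps (\<lambda>i. desc_coeff p (2 * int i + 1)))"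
proof -
  have "desc_coeff p (2 * (int s + 1) - (int r + 1)) =
     fps_nth (hurwitz_row (Abs_fps (\<lambda>i. desc_coeff p (2 * int i))) (Abs_fps (\<lambda>i. desc_coeff p (2 * int i + 1))) r) s" for r s
  proof (cases "even r")
    case True
    then obtain k where k: "r = 2 * k" by (auto elim: evenE)
    show ?thesis 
      by (auto simp: hurwitz_row_def k fps_X_power_mult_nth desc_coeff_def of_nat_diff algebra_simps)
  next
    case False
    then obtain k where k: "r = 2 * k + 1" by (auto elim: oddE)
    show ?thesis 
      by (auto simp: hurwitz_row_def k fps_X_power_mult_nth desc_coeff_def of_nat_diff algebra_simps)
  qed
  thus ?thesis unfolding hurwitz_det_def mixed_det_def row_det_def
    by (intro arg_cong[where f = det] eq_matI) auto
qed

section \<open>Sign changes under the Frobenius rule\<close>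

lemma frobenius_sign_nonzero:
  assumes "D ! m \<noteq> 0"
  shows "frobenius_sign D m = sgn (D ! m)"
proof -
  have "(GREATEST i. i \<le> m \<and> D ! i \<noteq> 0) = m"
    by (rule Greatest_equality) (use assms in auto)
  thus ?thesis by (simp add: frobenius_sign_def)
qed

text \<open>
The Frobenius rule looks back only to the last nonzero term, so a nonzero term separates a sequence.
\<close>
lemma frobenius_sign_drop:
  assumes "D ! k \<noteq> 0" "k \<le> length D"
  shows "frobenius_sign D (k + m) = frobenius_sign (drop k D) m"
proof -
  define i where "i = (GREATEST i. i \<le> m \<and> drop k D ! i \<noteq> 0)"
  have ex: "0 \<le> m \<and> drop k D ! 0 \<noteq> 0" using assms by simp
  have i: "i \<le> m \<and> drop k D ! i \<noteq> 0"
    unfolding i_def by (rule GreatestI_nat[where k = 0 and b = m]) (use ex in auto)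
  have max: "j \<le> i" if "j \<le> m \<and> drop k D ! j \<noteq> 0" for j
    unfolding i_def by (rule Greatest_le_nat[where b = m]) (use that in auto)
  have "(GREATEST i. i \<le> k + m \<and> D ! i \<noteq> 0) = k + i"
  proof (rule Greatest_equality)
    show "k + i \<le> k + m \<and> D ! (k + i) \<noteq> 0" using i assms by simp
  next
    fix j assume j: "j \<le> k + m \<and> D ! j \<noteq> 0"
    show "j \<le> k + i"
    proof (cases "j \<ge> k")
      case True
      then obtain j' where "j = k + j'" using le_Suc_ex by blast
      thus ?thesis using j max[of j'] assms by simp
    qed simp
  qed
  thus ?thesis using assms i unfolding frobenius_sign_def Let_def i_def[symmetric] by simp
qed

lemma frobenius_changes_split:
  assumes "D ! k \<noteq> 0" "k < length D"
  shows "frobenius_changes D =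
     card {m. m < k \<and> frobenius_sign D m * frobenius_sign D (Suc m) < 0} + frobenius_changes (drop k D)"
proof -
  let ?c = "\<lambda>D m. frobenius_sign D m * frobenius_sign D (Suc m) < 0"
  let ?A = "{m. m < k \<and> ?c D m}" and ?B = "{m. Suc m < length (drop k D) \<and> ?c (drop k D) m}"
  have tail: "?c D (k + m) \<longleftrightarrow> ?c (drop k D) m" for m
    using frobenius_sign_drop[OF assms(1), of m] frobenius_sign_drop[OF assms(1), of "Suc m"] assms(2) by simp
  have "{m. Suc m < length D \<and> ?c D m} = ?A \<union> (+) k ` ?B"
  proof (rule Set.set_eqI)
    fix m show "m \<in> {m. Suc m < length D \<and> ?c D m} \<longleftrightarrow> m \<in> ?A \<union> (+) k ` ?B"
    proof (cases "m < k")
      case True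
      thus ?thesis using assms(2) by auto
    next
      case False
      then obtain j where "m = k + j" by (metis le_iff_add not_less)
      thus ?thesis using tail[of j] by auto
    qed
  qed
  hence "frobenius_changes D = card (?A \<union> (+) k ` ?B)" by (simp only: frobenius_changes_def)
  also have "\<dots> = card ?A + card ((+) k ` ?B)"
  proof (rule card_Un_disjoint)
    have "finite ?B" by (rule finite_subset[of _ "{..<length D}"]) auto
    thus "finite ((+) k ` ?B)" by blast
  qed auto
  finally show ?thesis by (simp only: card_image[OF inj_on_add] frobenius_changes_def)
qed

lemma frobenius_changes_Cons:
  assumes "b \<noteq> 0" "a \<noteq> 0"
  shows "frobenius_changes (a # b # D) = (if a * b < 0 then 1 else 0) + frobenius_changes (b # D)"
proof -
  let ?s = "frobenius_sign (a # b # D)"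
  have "?s 0 * ?s (Suc 0) = sgn (a * b)"
    using assms by (simp add: frobenius_sign_nonzero sgn_mult)
  hence "{m. m < 1 \<and> ?s m * ?s (Suc m) < 0} = (if a * b < 0 then {0} else {})"
    by auto
  thus ?thesis using frobenius_changes_split[of "a # b # D" 1] assms by simp
qed

text \<open>
The zero gets the sign of \<open>a\<close>, so exactly one change is counted.
\<close>
lemma frobenius_changes_zero:
  assumes "a * c < 0"
  shows "frobenius_changes (a # 0 # c # D) = 1 + frobenius_changes (c # D)"
proof -
  let ?s = "frobenius_sign (a # 0 # c # D)"
  have nz: "a \<noteq> 0" "c \<noteq> 0" using assms by auto
  have "(GREATEST i. i \<le> Suc 0 \<and> (a # 0 # c # D) ! i \<noteq> 0) = 0"
    by (rule Greatest_equality) (use nz in \<open>auto simp: le_Suc_eq\<close>)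
  hence s: "?s 0 = sgn a" "?s (Suc 0) = sgn a" "?s (Suc (Suc 0)) = sgn c"
    using nz by (simp_all add: frobenius_sign_nonzero) (simp add: frobenius_sign_def Let_def)
  have "sgn a * sgn c < 0" "\<not> sgn a * sgn a < 0"
    using assms by (simp flip: sgn_mult, simp add: not_less flip: power2_eq_square)
  hence "m < 2 \<and> ?s m * ?s (Suc m) < 0 \<longleftrightarrow> m = 1" for m
    using s by (auto simp: less_2_cases_iff)
  thus ?thesis using frobenius_changes_split[of "a # 0 # c # D" 2] nz by simp
qed

text \<open>
This allows for positive factors, which may vary from term to term, and for one common sign.
\<close>
lemma frobenius_changes_cong_sgn:
  assumes len: "length D' = length D" and \<sigma>: "\<sigma> * \<sigma> = 1"
    and sgn: "\<And>i. i < length D \<Longrightarrow> sgn (D' ! i) = \<sigma> * sgn (D ! i)" and D0: "D ! 0 \<noteq> 0"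
  shows "frobenius_changes D' = frobenius_changes D"
proof -
  have nz: "D' ! i \<noteq> 0 \<longleftrightarrow> D ! i \<noteq> 0" if "i < length D" for i
    using sgn[OF that] \<sigma> by (metis mult_eq_0_iff mult_zero_left sgn_0_0 zero_neq_one)
  have s: "frobenius_sign D' m = \<sigma> * frobenius_sign D m" if "m < length D" for m
  proof -
    have "(\<lambda>i. i \<le> m \<and> D' ! i \<noteq> 0) = (\<lambda>i. i \<le> m \<and> D ! i \<noteq> 0)"
      using nz that by (intro ext) auto
    moreover have "(GREATEST i. i \<le> m \<and> D ! i \<noteq> 0) \<le> m"
      using GreatestI_nat[of "\<lambda>i. i \<le> m \<and> D ! i \<noteq> 0" 0 m] D0 by auto
    ultimately show ?thesis
      using that sgn by (simp add: frobenius_sign_def Let_def)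
  qed
  have "frobenius_sign D' m * frobenius_sign D' (Suc m) = frobenius_sign D m * frobenius_sign D (Suc m)"
    if "Suc m < length D" for m
  proof -
    have "frobenius_sign D' m * frobenius_sign D' (Suc m)
       = (\<sigma> * \<sigma>) * (frobenius_sign D m * frobenius_sign D (Suc m))"
      using that by (simp add: s)
    thus ?thesis by (simp add: \<sigma>)
  qed
  thus ?thesis unfolding frobenius_changes_def len
    by (intro arg_cong[where f = card]) auto
qed


section \<open>Polynomial kernels and linear functionals\<close>

definition linear_fun :: "(real poly \<Rightarrow> real) \<Rightarrow> bool" where
  "linear_fun l \<longleftrightarrow> (\<forall>a b. l (a + b) = l a + l b) \<and> (\<forall>c a. l (smult c a) = c * l a)"

lemma linear_fun_simps:
  assumes "linear_fun l"
  shows "l (a + b) = l a + l b" "l (smult c a) = c * l a" "l 0 = 0" "l (- a) = - l a" "l (a - b) = l a - l b"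
proof -
  show 1: "l (a + b) = l a + l b" for a b using assms by (simp add: linear_fun_def)
  show 2: "l (smult c a) = c * l a" for c a using assms by (simp add: linear_fun_def)
  show "l 0 = 0" using 2[of 0 0] by simp
  show 3: "l (- a) = - l a" for a using 2[of "-1" a] by simp
  show "l (a - b) = l a - l b" using 1[of a "- b"] 3[of b] by simp
qed

lemma linear_fun_sum_list: "linear_fun l \<Longrightarrow> l (\<Sum>x\<leftarrow>xs. f x) = (\<Sum>x\<leftarrow>xs. l (f x))"
  by (induction xs) (simp_all add: linear_fun_simps)

lemma linear_fun_sum: "linear_fun l \<Longrightarrow> l (\<Sum>x\<in>A. f x) = (\<Sum>x\<in>A. l (f x))"
  by (induction A rule: infinite_finite_induct) (simp_all add: linear_fun_simps)

lemma linear_fun_coeff: "linear_fun (\<lambda>a. coeff a i)"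
  by (simp add: linear_fun_def)

lemma linear_fun_expand:
  assumes "linear_fun l" "\<And>i. i \<ge> d \<Longrightarrow> coeff a i = 0"
  shows "l a = (\<Sum>i<d. coeff a i * l (monom 1 i))"
proof -
  have "a = (\<Sum>i<d. smult (coeff a i) (monom 1 i))"
    by (rule poly_eqI) (use assms(2) in \<open>auto simp: coeff_sum not_less if_distrib[of "(*) _"] cong: if_cong\<close>)
  hence "l a = l (\<Sum>i<d. smult (coeff a i) (monom 1 i))" by simp
  thus ?thesis using assms(1) by (simp add: linear_fun_sum linear_fun_simps)
qed

text \<open>
A list of pairs \<open>(a, b)\<close> stands for the kernel \<open>\<Sum> a(u) b(v)\<close>.
\<close>
type_synonym kernel_rep = "(real poly \<times> real poly) list"

definition kern :: "kernel_rep \<Rightarrow> real \<Rightarrow> real \<Rightarrow> real" where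
  "kern ps u v = (\<Sum>(a, b)\<leftarrow>ps. poly a u * poly b v)"

text \<open>
A kernel is a quadratic form on functionals.
\<close>
definition pairing :: "(real poly \<Rightarrow> real) \<Rightarrow> kernel_rep \<Rightarrow> real" where
  "pairing l ps = (\<Sum>(a, b)\<leftarrow>ps. l a * l b)"

lemma kern_simps [simp]:
  "kern [] u v = 0" "kern ((a, b) # ps) u v = poly a u * poly b v + kern ps u v"
  "kern (ps @ qs) u v = kern ps u v + kern qs u v"
  by (simp_all add: kern_def)

lemma pairing_simps [simp]:
  "pairing l [] = 0" "pairing l ((a, b) # ps) = l a * l b + pairing l ps"
  "pairing l (ps @ qs) = pairing l ps + pairing l qs"
  by (simp_all add: pairing_def)

lemma poly_sum_list: "poly (\<Sum>x\<leftarrow>xs. f x) u = (\<Sum>x\<leftarrow>xs. poly (f x) u)"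
  by (induction xs) simp_all

lemma poly_eq_off_finite:
  fixes a b :: "real poly"
  assumes "finite {x. poly a x \<noteq> poly b x}"
  shows "a = b"
proof (rule ccontr)
  assume "a \<noteq> b"
  hence "finite {x. poly (a - b) x = 0}" by (intro poly_roots_finite) simp
  moreover have "{x. poly (a - b) x = 0} \<union> {x. poly a x \<noteq> poly b x} = UNIV" by auto
  ultimately show False using assms infinite_UNIV_char_0[where ?'a = real] by (metis finite_Un)
qed

text \<open>
The pairing depends only on the kernel, not on the list that represents it: apply \<open>l\<close> in the first
variable for fixed \<open>y\<close>, then in \<open>y\<close>. Finitely many exceptions are allowed since the kernels of
interest are known after division by \<open>x - y\<close> or \<open>x + y\<close> only.
\<close>
lemma pairing_cong:
  assumes l: "linear_fun l" and eq: "\<And>y. finite {x. kern ps x y \<noteq> kern qs x y}"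
  shows "pairing l ps = pairing l qs"
proof -
  define A where "A ps y = (\<Sum>(a, b)\<leftarrow>ps. smult (poly b y) a)" for ps :: kernel_rep and y
  define B where "B ps = (\<Sum>(a, b)\<leftarrow>ps. smult (l a) b)" for ps :: kernel_rep
  have A: "poly (A ps y) x = kern ps x y" for ps x y
    by (simp add: A_def kern_def poly_sum_list case_prod_unfold mult.commute)
  have lA: "l (A ps y) = poly (B ps) y" for ps y
    by (simp add: A_def B_def linear_fun_sum_list[OF l] poly_sum_list case_prod_unfold linear_fun_simps[OF l] mult.commute)
  have lB: "l (B ps) = pairing l ps" for ps
    by (simp add: B_def pairing_def linear_fun_sum_list[OF l] case_prod_unfold linear_fun_simps[OF l])
  have "A ps y = A qs y" for y
    by (rule poly_eq_off_finite) (simp add: A eq)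
  hence "poly (B ps) y = poly (B qs) y" for y by (metis lA)
  hence "B ps = B qs" by (simp add: poly_eq_poly_eq_iff[symmetric] ext)
  thus ?thesis by (metis lB)
qed

text \<open>
A bound for all entries of the list, stronger than a bound for the degree of the kernel. It makes
the pairing depend only on the values of \<open>l\<close> on monomials of degree below \<open>d\<close>.
\<close>
definition deg_bounded :: "nat \<Rightarrow> kernel_rep \<Rightarrow> bool" where
  "deg_bounded d ps \<longleftrightarrow> (\<forall>(a, b)\<in>set ps. \<forall>i\<ge>d. coeff a i = 0 \<and> coeff b i = 0)"

definition bezout_rep :: "real poly \<Rightarrow> real poly \<Rightarrow> kernel_rep \<Rightarrow> bool" where
  "bezout_rep f g ps \<longleftrightarrow> (\<forall>u v. (u - v) * kern ps u v = poly f u * poly g v - poly g u * poly f v)"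

lemma difference_quotient_rep:
  assumes "\<And>i. i > d \<Longrightarrow> coeff f i = 0"
  shows "\<exists>ps. deg_bounded d ps \<and> (\<forall>u v. (u - v) * kern ps u v = poly f u - poly f v)"
  using assms
proof (induction d arbitrary: f)
  case 0
  obtain a f' where f: "f = pCons a f'" by (cases f)
  have "f' = 0" by (rule poly_eqI) (use 0[of "Suc i" for i] f in simp)
  thus ?case by (intro exI[of _ "[]"]) (simp add: deg_bounded_def f)
next
  case (Suc d)
  obtain a f' where f: "f = pCons a f'" by (cases f)
  have f': "coeff f' i = 0" if "i > d" for i using Suc.prems[of "Suc i"] that f by simp
  obtain ps where ps: "deg_bounded d ps" "\<And>u v. (u - v) * kern ps u v = poly f' u - poly f' v"
    using Suc.IH f' by blast
  let ?qs = "(f', 1) # map (\<lambda>(x, y). (x, pCons 0 y)) ps"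
  have "kern (map (\<lambda>(x, y). (x, pCons 0 y)) ps) u v = v * kern ps u v" for u v
    by (induction ps) (auto simp: algebra_simps)
  hence "(u - v) * kern ?qs u v = (u - v) * poly f' u + v * ((u - v) * kern ps u v)" for u v
    by (simp add: algebra_simps)
  hence "(u - v) * kern ?qs u v = poly f u - poly f v" for u v
    unfolding ps(2) by (simp add: f algebra_simps)
  moreover have "deg_bounded (Suc d) ?qs"
    using ps(1) f' by (auto simp: deg_bounded_def coeff_pCons split: nat.splits)
  ultimately show ?case by blast
qed

text \<open>
For \<open>f = a + x f'\<close> and \<open>g = b + x g'\<close> the numerator is
\<open>a (v g'(v) - u g'(u)) + b (u f'(u) - v f'(v)) + u v (f'(u) g'(v) - g'(u) f'(v))\<close>, and each summand is
divisible by \<open>u - v\<close> with quotients of the right degree.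
\<close>
lemma bezout_rep_exists:
  assumes "\<And>i. i > d \<Longrightarrow> coeff f i = 0" "\<And>i. i > d \<Longrightarrow> coeff g i = 0"
  shows "\<exists>ps. deg_bounded d ps \<and> bezout_rep f g ps"
  using assms
proof (induction d arbitrary: f g)
  case 0
  obtain a f' where f: "f = pCons a f'" by (cases f)
  obtain b g' where g: "g = pCons b g'" by (cases g)
  have "f' = 0" by (rule poly_eqI) (use 0(1)[of "Suc i" for i] f in simp)
  moreover have "g' = 0" by (rule poly_eqI) (use 0(2)[of "Suc i" for i] g in simp)
  ultimately show ?case by (intro exI[of _ "[]"]) (simp add: deg_bounded_def bezout_rep_def f g)
next
  case (Suc d)
  obtain a f' where f: "f = pCons a f'" by (cases f)
  obtain b g' where g: "g = pCons b g'" by (cases g)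
  have f': "coeff f' i = 0" if "i > d" for i using Suc.prems(1)[of "Suc i"] that f by simp
  have g': "coeff g' i = 0" if "i > d" for i using Suc.prems(2)[of "Suc i"] that g by simp
  obtain ps where ps: "deg_bounded d ps" "bezout_rep f' g' ps"
    using Suc.IH f' g' by blast
  obtain F where F: "deg_bounded (Suc d) F" "\<And>u v. (u - v) * kern F u v = poly f u - poly f v"
    using difference_quotient_rep[of "Suc d" f] Suc.prems(1) by blast
  obtain G where G: "deg_bounded (Suc d) G" "\<And>u v. (u - v) * kern G u v = poly g u - poly g v"
    using difference_quotient_rep[of "Suc d" g] Suc.prems(2) by blast
  let ?S = "\<lambda>c. map (\<lambda>(x, y). (smult c x, y))"
  let ?X = "map (\<lambda>(x, y). (pCons 0 x, pCons 0 y)) ps"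
  let ?qs = "?S (- a) G @ ?S b F @ ?X"
  have S: "kern (?S c ps) u v = c * kern ps u v" for c ps u v
    by (induction ps) (auto simp: algebra_simps)
  have X: "kern ?X u v = u * v * kern ps u v" for u v
    by (induction ps) (auto simp: algebra_simps)
  have *: "(u - v) * kern ?qs u v = - a * ((u - v) * kern G u v) + b * ((u - v) * kern F u v) + u * v * ((u - v) * kern ps u v)" for u v
    by (simp only: kern_simps S X) (simp add: algebra_simps)
  have "(u - v) * kern ?qs u v = poly f u * poly g v - poly g u * poly f v" for u v
    unfolding * F(2) G(2) ps(2)[unfolded bezout_rep_def, rule_format] by (simp add: f g algebra_simps)
  moreover have "deg_bounded (Suc d) ?qs"
    using ps(1) F(1) G(1) by (fastforce simp: deg_bounded_def coeff_pCons split: nat.splits)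
  ultimately show ?case unfolding bezout_rep_def by blast
qed

section \<open>J-fractions and positive definite Bezout kernels\<close>

text \<open>
The remainders of the Euclidean algorithm for \<open>f\<close> and \<open>g\<close>, with linear quotients \<open>a + b u\<close> listed as
pairs \<open>(b, a)\<close>, down to the last nonzero remainder \<open>c\<close>. The minus sign in front of \<open>h\<close> makes the positivity of
all \<open>b\<close> the same thing as positive definiteness.
\<close>
inductive J_fraction :: "real \<Rightarrow> real poly \<Rightarrow> real poly \<Rightarrow> (real \<times> real) list \<Rightarrow> bool" for c where
  base: "J_fraction c [:c:] 0 []"
| step: "J_fraction c g h xs \<Longrightarrow> b > 0 \<Longrightarrow> J_fraction c ([:a, b:] * g - h) g ((b, a) # xs)"

lemma J_fraction_coeffs:
  assumes "J_fraction c f g xs" "c > 0"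
  shows "coeff f (length xs) = c * prod_list (map fst xs) \<and> coeff f (length xs) > 0 \<and>
     (\<forall>i>length xs. coeff f i = 0) \<and> (\<forall>i\<ge>length xs. coeff g i = 0)"
  using assms
proof (induction rule: J_fraction.induct)
  case base
  thus ?case by (auto simp: coeff_pCons split: nat.splits)
next
  case (step g h xs b a)
  hence IH: "coeff g (length xs) = c * prod_list (map fst xs)" "coeff g (length xs) > 0"
    "\<And>i. i > length xs \<Longrightarrow> coeff g i = 0" "\<And>i. i \<ge> length xs \<Longrightarrow> coeff h i = 0" by auto
  show ?case
    using IH step.hyps by (auto simp: coeff_pCons less_Suc_eq_le Suc_le_eq split: nat.splits)
qed

lemma division_step_exists:
  fixes f g :: "real poly"
  assumes f: "coeff f (Suc d) > 0" "\<And>i. i > Suc d \<Longrightarrow> coeff f i = 0"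
    and g: "coeff g d > 0" "\<And>i. i > d \<Longrightarrow> coeff g i = 0"
  shows "\<exists>a b h. b > 0 \<and> f = [:a, b:] * g - h \<and> (\<forall>i\<ge>d. coeff h i = 0) \<and> b = coeff f (Suc d) / coeff g d"
proof -
  define b where "b = coeff f (Suc d) / coeff g d"
  define a where "a = (coeff f d - b * (if d = 0 then 0 else coeff g (d - 1))) / coeff g d"
  define h where "h = [:a, b:] * g - f"
  have b: "b * coeff g d = coeff f (Suc d)" and a: "a * coeff g d = coeff f d - b * (if d = 0 then 0 else coeff g (d - 1))"
    using g by (simp_all add: a_def b_def)
  have "coeff h i = 0" if i: "i \<ge> d" for i
  proof -
    consider "i = d" | "i = Suc d" | "i > Suc d" using i by linarith
    thus ?thesis
    proof cases
      case 1 thus ?thesis using a by (cases d) (simp_all add: h_def algebra_simps)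
    next
      case 2 thus ?thesis using b g by (simp add: h_def)
    next
      case 3 thus ?thesis using f g by (cases i) (simp_all add: h_def)
    qed
  qed
  moreover have "b > 0" using f g by (simp add: b_def)
  ultimately show ?thesis
    by (intro exI[of _ a] exI[of _ b] exI[of _ h]) (simp_all add: h_def b_def)
qed

text \<open>
Quantifying over all representations of the kernel is harmless, since the pairing depends on the
kernel only, and it spares the choice of one.
\<close>
definition bezout_posdef :: "nat \<Rightarrow> real poly \<Rightarrow> real poly \<Rightarrow> bool" where
  "bezout_posdef d f g \<longleftrightarrow> (\<forall>ps l. deg_bounded d ps \<longrightarrow> bezout_rep f g ps \<longrightarrow> linear_fun l \<longrightarrow>
     (\<exists>i<d. l (monom 1 i) \<noteq> 0) \<longrightarrow> 0 < pairing l ps)"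

lemma pairing_cong_deg_bounded:
  assumes "deg_bounded d ps" "linear_fun l" "linear_fun l'" "\<And>i. i < d \<Longrightarrow> l (monom 1 i) = l' (monom 1 i)"
  shows "pairing l ps = pairing l' ps"
proof -
  have "l a = l' a" if "\<And>i. i \<ge> d \<Longrightarrow> coeff a i = 0" for a
    using linear_fun_expand[OF assms(2) that] linear_fun_expand[OF assms(3) that] assms(4) by simp
  hence "l a * l b = l' a * l' b" if "(a, b) \<in> set ps" for a b
    using that assms(1) unfolding deg_bounded_def by fastforce
  thus ?thesis unfolding pairing_def by (intro arg_cong[where f = sum_list] map_cong) auto
qed

lemma bezout_rep_step:
  assumes "bezout_rep g h ps"
  shows "bezout_rep ([:a, b:] * g - h) g ((smult b g, g) # ps)"
  unfolding bezout_rep_def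
proof (intro allI)
  fix u v
  have "(u - v) * kern ((smult b g, g) # ps) u v = (u - v) * (b * poly g u * poly g v) + (u - v) * kern ps u v"
    by (simp add: algebra_simps)
  also have "(u - v) * kern ps u v = poly g u * poly h v - poly h u * poly g v"
    using assms by (simp add: bezout_rep_def)
  finally show "(u - v) * kern ((smult b g, g) # ps) u v =
     poly ([:a, b:] * g - h) u * poly g v - poly g u * poly ([:a, b:] * g - h) v"
    by (simp add: algebra_simps)
qed

text \<open>
Compare the coefficients of \<open>u\<^sup>d\<^sup>+\<^sup>1 v\<^sup>d\<close> in \<open>f(u) g(v) - g(u) f(v)\<close>, after division by \<open>u - v\<close>.
\<close>
lemma top_coeff_bezout:
  assumes f: "\<And>i. i > Suc d \<Longrightarrow> coeff f i = 0" and g: "\<And>i. i > d \<Longrightarrow> coeff g i = 0"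
    and ps: "deg_bounded (Suc d) ps" "bezout_rep f g ps"
  shows "pairing (\<lambda>a. coeff a d) ps = coeff f (Suc d) * coeff g d"
proof -
  define A where "A y = (\<Sum>(a, b)\<leftarrow>ps. smult (poly b y) a)" for y
  define B where "B = (\<Sum>(a, b)\<leftarrow>ps. smult (coeff a d) b)"
  have A: "poly (A y) x = kern ps x y" for x y
    by (simp add: A_def kern_def poly_sum_list case_prod_unfold mult.commute)
  have lA: "coeff (A y) d = poly B y" for y
    by (simp add: A_def B_def linear_fun_sum_list[OF linear_fun_coeff] poly_sum_list case_prod_unfold mult.commute)
  have lB: "coeff B d = pairing (\<lambda>a. coeff a d) ps"
    by (simp add: B_def pairing_def linear_fun_sum_list[OF linear_fun_coeff] case_prod_unfold)
  have 0: "coeff (A y) (Suc d) = 0" for y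
    unfolding A_def linear_fun_sum_list[OF linear_fun_coeff]
    using ps(1) by (induction ps) (auto simp: deg_bounded_def)
  have "[:- y, 1:] * A y = smult (poly g y) f - smult (poly f y) g" for y
  proof -
    have "poly ([:- y, 1:] * A y) x = poly (smult (poly g y) f - smult (poly f y) g) x" for x
      using ps(2)[unfolded bezout_rep_def, rule_format, of x y] by (simp add: A algebra_simps)
    thus ?thesis by (simp add: poly_eq_poly_eq_iff[symmetric] ext)
  qed
  hence "coeff ([:- y, 1:] * A y) (Suc d) = coeff (smult (poly g y) f - smult (poly f y) g) (Suc d)" for y
    by simp
  note * = this
  have "poly B y = poly (smult (coeff f (Suc d)) g) y" for y
    using *[of y] 0[of y] g[of "Suc d"] by (simp add: lA mult.commute)
  hence "B = smult (coeff f (Suc d)) g" by (simp add: poly_eq_poly_eq_iff[symmetric] ext)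
  thus ?thesis by (simp add: lB[symmetric])
qed

text \<open>
Testing with the functional that extracts the top coefficient gives the sign of the leading
coefficient of \<open>g\<close>. For the kernel of the next pair, a functional is corrected in degree \<open>d\<close> so that
it vanishes on \<open>g\<close>; then the split-off square \<open>b g(u) g(v)\<close> does not contribute.
\<close>
lemma bezout_posdef_imp_J_fraction:
  assumes "coeff f d > 0" "\<And>i. i > d \<Longrightarrow> coeff f i = 0" "\<And>i. i \<ge> d \<Longrightarrow> coeff g i = 0" "bezout_posdef d f g"
  shows "\<exists>c>0. \<exists>xs. J_fraction c f g xs \<and> length xs = d"
  using assms
proof (induction d arbitrary: f g)
  case 0
  have "g = 0" by (rule poly_eqI) (simp add: 0)
  moreover have "f = [:coeff f 0:]" by (rule poly_eqI) (use 0 in \<open>auto simp: coeff_pCons split: nat.splits\<close>)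
  ultimately show ?case using 0 by (metis J_fraction.base list.size(3))
next
  case (Suc d)
  have g: "coeff g i = 0" if "i > d" for i using Suc.prems(3) that by simp
  obtain ps where ps: "deg_bounded (Suc d) ps" "bezout_rep f g ps"
    using bezout_rep_exists[of "Suc d" f g] Suc.prems(2) g by fastforce
  have "0 < pairing (\<lambda>a. coeff a d) ps"
    using Suc.prems(4)[unfolded bezout_posdef_def, rule_format, OF ps linear_fun_coeff] by auto
  hence "coeff g d > 0"
    using top_coeff_bezout[OF Suc.prems(2) g ps] Suc.prems(1) by (simp add: zero_less_mult_iff)
  then obtain a b h where h: "b > 0" "f = [:a, b:] * g - h" "\<And>i. i \<ge> d \<Longrightarrow> coeff h i = 0"
    using division_step_exists[OF Suc.prems(1,2) \<open>coeff g d > 0\<close> g] by blast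
  have "bezout_posdef d g h"
    unfolding bezout_posdef_def
  proof (intro allI impI)
    fix ps l assume ps: "deg_bounded d ps" "bezout_rep g h ps" and l: "linear_fun l" "\<exists>i<d. l (monom 1 i) \<noteq> 0"
    \<comment> \<open>agrees with \<open>l\<close> below degree \<open>d\<close> and vanishes on \<open>g\<close>\<close>
    define l' where "l' p = l p - l g / coeff g d * coeff p d" for p
    have l': "linear_fun l'" using l(1) by (simp add: linear_fun_def l'_def algebra_simps)
    have eq: "l' (monom 1 i) = l (monom 1 i)" if "i < d" for i using that by (simp add: l'_def)
    have l'g: "l' g = 0" using \<open>coeff g d > 0\<close> by (simp add: l'_def)
    have "deg_bounded (Suc d) ((smult b g, g) # ps)"
      using ps(1) g unfolding deg_bounded_def by (auto simp: Suc_le_eq)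
    moreover have "bezout_rep f g ((smult b g, g) # ps)"
      unfolding h(2) by (rule bezout_rep_step[OF ps(2)])
    moreover have "\<exists>i<Suc d. l' (monom 1 i) \<noteq> 0" using l(2) eq by (metis less_SucI)
    ultimately have "0 < pairing l' ((smult b g, g) # ps)"
      using Suc.prems(4) l' unfolding bezout_posdef_def by blast
    also have "\<dots> = pairing l' ps" by (simp add: l'g)
    also have "\<dots> = pairing l ps" by (rule pairing_cong_deg_bounded[OF ps(1) l' l(1) eq])
    finally show "0 < pairing l ps" .
  qed
  then obtain c xs where "c > 0" "J_fraction c g h xs" "length xs = d"
    using Suc.IH[of g h] \<open>coeff g d > 0\<close> g h(3) by blast
  thus ?case using J_fraction.step[of c g h xs b a] h by (metis length_Cons)
qed


section \<open>Inertia of tridiagonal forms\<close>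

text \<open>
The determinant of the tridiagonal matrix with the given diagonal and off-diagonal entries \<open>-1\<close>.
\<close>
fun continuant :: "real list \<Rightarrow> real" where
  "continuant [] = 1"
| "continuant [a] = a"
| "continuant (a # b # as) = a * continuant (b # as) - continuant as"

text \<open>
The quadratic form of that matrix, with polynomials in place of the variables.
\<close>
fun tridiagonal :: "real list \<Rightarrow> real poly list \<Rightarrow> real \<Rightarrow> real \<Rightarrow> real" where
  "tridiagonal (a # b # as) (f # g # fs) u v = a * poly f u * poly f v
     - poly f u * poly g v - poly g u * poly f v + tridiagonal (b # as) (g # fs) u v"
| "tridiagonal [a] (f # fs) u v = a * poly f u * poly f v"
| "tridiagonal _ _ u v = 0"

lemma tridiagonal_shift: "length fs = length as \<Longrightarrow> tridiagonal ((a + d) # as) (f # fs) u v = tridiagonal (a # as) (f # fs) u v + d * poly f u * poly f v"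
  by (cases as; cases fs) (simp_all add: algebra_simps)

text \<open>
Elimination of the first variable replaces the next diagonal entry \<open>b\<close> by \<open>b - 1 / a\<close>.
\<close>
lemma continuant_shift: "a \<noteq> 0 \<Longrightarrow> a * continuant ((b - 1 / a) # as) = continuant (a # b # as)"
  by (cases as) (simp_all add: field_simps)

text \<open>
The leading principal minors, starting with the empty one.
\<close>
definition continuants :: "real list \<Rightarrow> nat \<Rightarrow> real list" where
  "continuants as r = map (\<lambda>m. continuant (take m as)) [0..<r]"

lemma continuants_Suc: "continuants as (Suc r) = 1 # map (\<lambda>m. continuant (take (Suc m) as)) [0..<r]"
  unfolding continuants_def upt_conv_Cons[OF zero_less_Suc] by (simp add: map_Suc_upt[symmetric] del: upt_Suc)

lemma continuants_nth_0: "continuants as (Suc r) ! 0 = 1"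
  by (simp add: continuants_Suc)

lemma length_continuants [simp]: "length (continuants as r) = r"
  by (simp add: continuants_def)

lemma frobenius_changes_single [simp]: "frobenius_changes [x] = 0"
  by (simp add: frobenius_changes_def)

lemma frobenius_changes_continuants_scale:
  assumes "s \<noteq> 0"
  shows "frobenius_changes (map ((*) s) (continuants as (Suc r))) = frobenius_changes (continuants as (Suc r))"
proof (rule frobenius_changes_cong_sgn[where \<sigma> = "sgn s"])
  show "sgn s * sgn s = 1" using assms by (auto simp: sgn_if)
qed (auto simp: sgn_mult continuants_nth_0)

lemma frobenius_changes_continuants_nonzero:
  assumes "a \<noteq> 0"
  shows "frobenius_changes (continuants (a # b # as) (Suc (Suc r))) =
     (if a < 0 then 1 else 0) + frobenius_changes (continuants ((b - 1 / a) # as) (Suc r))"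
proof -
  have "continuant (take (Suc m) (a # b # as)) = a * continuant (take m ((b - 1 / a) # as))" for m
    by (cases m) (simp_all only: take_Suc_Cons take_0 continuant_shift[OF assms], simp)
  hence "continuants (a # b # as) (Suc (Suc r)) = 1 # map ((*) a) (continuants ((b - 1 / a) # as) (Suc r))"
    unfolding continuants_Suc[of _ "Suc r"] by (simp add: continuants_def del: upt_Suc)
  moreover have "map ((*) a) (continuants ((b - 1 / a) # as) (Suc r)) = a # map ((*) a) (tl (continuants ((b - 1 / a) # as) (Suc r)))"
    by (simp add: continuants_Suc)
  ultimately show ?thesis
    using frobenius_changes_Cons[of a 1 "map ((*) a) (tl (continuants ((b - 1 / a) # as) (Suc r)))"]
      frobenius_changes_continuants_scale[OF assms, of "(b - 1 / a) # as" r] assms by simp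
qed

lemma frobenius_changes_continuants_zero:
  "frobenius_changes (continuants (0 # b # as) (Suc (Suc (Suc r)))) = 1 + frobenius_changes (continuants as (Suc r))"
proof -
  have upt: "[0..<Suc (Suc k)] = 0 # Suc 0 # map (\<lambda>m. Suc (Suc m)) [0..<k]" for k
    by (induction k) simp_all
  have "continuants (0 # b # as) (Suc (Suc (Suc r))) = 1 # 0 # map (\<lambda>m. continuant (take (Suc (Suc m)) (0 # b # as))) [0..<Suc r]"
    unfolding continuants_def upt by (simp del: upt_Suc)
  also have "map (\<lambda>m. continuant (take (Suc (Suc m)) (0 # b # as))) [0..<Suc r] = map ((*) (- 1)) (continuants as (Suc r))"
    by (simp add: continuants_def)
  finally have *: "continuants (0 # b # as) (Suc (Suc (Suc r))) = 1 # 0 # map ((*) (- 1)) (continuants as (Suc r))" .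
  have "map ((*) (- 1)) (continuants as (Suc r)) = - 1 # map ((*) (- 1)) (tl (continuants as (Suc r)))"
    by (simp add: continuants_Suc)
  thus ?thesis unfolding *
    using frobenius_changes_zero[of 1 "-1" "map ((*) (- 1)) (tl (continuants as (Suc r)))"]
      frobenius_changes_continuants_scale[of "-1" as r] by simp
qed

definition gram :: "real poly list \<Rightarrow> real \<Rightarrow> real \<Rightarrow> real" where
  "gram P u v = (\<Sum>f\<leftarrow>P. poly f u * poly f v)"

lemma gram_simps [simp]: "gram [] u v = 0" "gram (f # P) u v = poly f u * poly f v + gram P u v"
  "gram (P @ Q) u v = gram P u v + gram Q u v"
  by (simp_all add: gram_def)

text \<open>
If the first diagonal entry \<open>a\<close> is nonzero, completing the square splits off one square of the sign of
\<open>a\<close>. If it is zero, the first two variables form a hyperbolic plane, which gives one square of either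
sign, and the minors \<open>1, 0, -1\<close> contribute one sign change. A vanishing determinant can only come from
a last remaining entry \<open>0\<close>, and costs one square.
\<close>
lemma tridiagonal_diagonalise:
  assumes "length fs = length as"
  defines "z \<equiv> (if continuant as = 0 then 1 else 0 :: nat)"
  shows "\<exists>P N. (\<forall>u v. tridiagonal as fs u v = gram P u v - gram N u v) \<and> length P + length N + z = length as \<and>
     length N = frobenius_changes (continuants as (Suc (length as) - z))"
  using assms(1) unfolding z_def
proof (induction "length as" arbitrary: as fs rule: less_induct)
  case less
  consider "as = []" | a where "as = [a]" | a b as' where "as = a # b # as'"
    by (metis list.exhaust)
  thus ?case
  proof cases
    case 1
    thus ?thesis
      by (intro exI[of _ "[]"]) (simp add: continuants_def)
  next
    case (2 a)
    then obtain f where fs: "fs = [f]" using less.prems by (auto simp: length_Suc_conv)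
    consider "a = 0" | "a > 0" | "a < 0" by linarith
    thus ?thesis
    proof cases
      case 1
      thus ?thesis using 2 fs
        by (intro exI[of _ "[]"]) (simp add: continuants_def)
    next
      case a: 2
      have "sqrt a * (sqrt a * x) = a * x" for x using a by (simp flip: mult.assoc)
      thus ?thesis using 2 fs a frobenius_changes_Cons[of a 1 "[]"]
        by (intro exI[of _ "[smult (sqrt a) f]"] exI[of _ "[]"])
           (simp add: continuants_def algebra_simps)
    next
      case 3
      then obtain s where s: "s * s = - a"
        by (metis less_imp_le neg_0_le_iff_le real_sqrt_mult_self abs_of_nonneg)
      have "poly (smult s f) u * poly (smult s f) v = (s * s) * (poly f u * poly f v)" for u v
        by (simp add: mult_ac)
      hence "tridiagonal as fs u v = gram [] u v - gram [smult s f] u v" for u v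
        by (simp add: 2 fs s del: poly_smult)
      moreover have "length [smult s f] = frobenius_changes (continuants as (Suc (length as) - 0))"
        using 3 frobenius_changes_Cons[of a 1 "[]"] by (simp add: 2 continuants_def)
      ultimately show ?thesis using 2 3
        by (intro exI[of _ "[]"] exI[of _ "[smult s f]"]) auto
    qed
  next
    case (3 a b as')
    then obtain f g fs' where fs: "fs = f # g # fs'" "length fs' = length as'"
      using less.prems by (auto simp: length_Suc_conv)
    show ?thesis
    proof (cases "a = 0")
      case False
      let ?as = "(b - 1 / a) # as'"
      define z where "z = (if continuant ?as = 0 then 1 else 0 :: nat)"
      obtain P N where PN: "\<And>u v. tridiagonal ?as (g # fs') u v = gram P u v - gram N u v"
        "length P + length N + z = length ?as"
        "length N = frobenius_changes (continuants ?as (Suc (length ?as) - z))"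
        using less.hyps[of ?as "g # fs'"] 3 fs unfolding z_def by auto
      have z: "(if continuant as = 0 then 1 else 0) = z"
        using continuant_shift[OF False, of b as'] False by (auto simp: z_def 3)
      have tridiagonal: "tridiagonal as fs u v = a * poly (f - smult (1 / a) g) u * poly (f - smult (1 / a) g) v + (gram P u v - gram N u v)" for u v
        using tridiagonal_shift[OF fs(2), of b "- (1 / a)" g u v] False
        by (simp add: 3 fs flip: PN(1)) (simp add: field_simps)
      let ?h = "smult (sqrt \<bar>a\<bar>) (f - smult (1 / a) g)"
      have h: "poly ?h u * poly ?h v = \<bar>a\<bar> * (poly (f - smult (1 / a) g) u * poly (f - smult (1 / a) g) v)" for u v
      proof -
        have "poly ?h u * poly ?h v = (sqrt \<bar>a\<bar> * sqrt \<bar>a\<bar>) * (poly (f - smult (1 / a) g) u * poly (f - smult (1 / a) g) v)"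
          by (simp only: poly_smult mult_ac)
        thus ?thesis by (simp only: real_sqrt_mult_self abs_abs)
      qed
      have "Suc (length as) - z = Suc (Suc (length ?as - z))" "Suc (length ?as) - z = Suc (length ?as - z)"
        by (auto simp: 3 z_def)
      hence V: "frobenius_changes (continuants as (Suc (length as) - z)) = (if a < 0 then 1 else 0) + length N"
        using frobenius_changes_continuants_nonzero[OF False, of b as' "length ?as - z"] PN(3) 3 by simp
      show ?thesis
      proof (cases "a < 0")
        case True
        thus ?thesis unfolding z using V PN(2) h tridiagonal
          by (intro exI[of _ P] exI[of _ "?h # N"]) (simp add: 3)
      next
        case False
        thus ?thesis unfolding z using V PN(2) h tridiagonal
          by (intro exI[of _ "?h # P"] exI[of _ N]) (simp add: 3)
      qed
    next
      case True
      define z where "z = (if continuant as' = 0 then 1 else 0 :: nat)"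
      obtain P N where PN: "\<And>u v. tridiagonal as' fs' u v = gram P u v - gram N u v"
        "length P + length N + z = length as'"
        "length N = frobenius_changes (continuants as' (Suc (length as') - z))"
        using less.hyps[of as' fs'] 3 fs unfolding z_def by auto
      have z: "(if continuant as = 0 then 1 else 0) = z"
        by (auto simp: z_def 3 True)
      \<comment> \<open>everything that is multiplied by \<open>g\<close>, so that the first two rows become \<open>- k g - g k\<close>\<close>
      define k where "k = f + (if as' = [] then 0 else hd fs') - smult (b / 2) g"
      have tridiagonal: "tridiagonal as fs u v = gram P u v - gram N u v - poly k u * poly g v - poly g u * poly k v" for u v
        unfolding PN(1)[symmetric] using fs(2)
        by (cases as'; cases fs') (auto simp: 3 fs True k_def field_simps)
      let ?h = "\<lambda>s. smult (1 / sqrt 2) (g + smult s k)"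
      have h: "poly (?h s) u * poly (?h s) v = (poly g u + s * poly k u) * (poly g v + s * poly k v) / 2" for s u v
      proof -
        have "poly (?h s) u * poly (?h s) v = (1 / sqrt 2 * (1 / sqrt 2)) * ((poly g u + s * poly k u) * (poly g v + s * poly k v))"
          by (simp only: poly_smult poly_add mult_ac)
        thus ?thesis by simp
      qed
      have "Suc (length as) - z = Suc (Suc (Suc (length as' - z)))" "Suc (length as') - z = Suc (length as' - z)"
        using PN(2) by (auto simp: 3 z_def)
      hence V: "frobenius_changes (continuants as (Suc (length as) - z)) = 1 + length N"
        using frobenius_changes_continuants_zero[of b as' "length as' - z"] PN(3) 3 True by simp
      have "tridiagonal as fs u v = gram (?h (-1) # P) u v - gram (?h 1 # N) u v" for u v
        unfolding gram_simps h tridiagonal by (simp add: field_simps)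
      thus ?thesis unfolding z using V PN(2)
        by (intro exI[of _ "?h (-1) # P"] exI[of _ "?h 1 # N"]) (simp add: 3)
    qed
  qed
qed

section \<open>Kernels, half-plane and Wronskian of a J-fraction\<close>

text \<open>
The Bezout kernel of \<open>f\<close> and \<open>g\<close> is a sum of squares. The kernel of \<open>u g(u)\<close> and \<open>f(u)\<close> is tridiagonal
in the remainders \<open>g, h, \<dots>\<close>: passing from \<open>(f, g)\<close> to \<open>(g, h)\<close> it loses
\<open>a g(u) g(v) - g(u) h(v) - h(u) g(v)\<close>.
\<close>
lemma J_fraction_kernels:
  assumes "J_fraction c f g xs"
  shows "\<exists>fs Q. length fs = length xs \<and> length Q = length xs \<and> (xs \<noteq> [] \<longrightarrow> hd fs = g) \<and>
     (\<forall>u v. (u - v) * gram Q u v = poly f u * poly g v - poly g u * poly f v) \<and>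
     (\<forall>u v. (u - v) * tridiagonal (map snd xs) fs u v = u * poly g u * poly f v - v * poly g v * poly f u)"
  using assms
proof (induction rule: J_fraction.induct)
  case base
  show ?case by (intro exI[of _ "[]"]) simp
next
  case (step g h xs b a)
  then obtain fs Q where IH: "length fs = length xs" "length Q = length xs" "xs \<noteq> [] \<longrightarrow> hd fs = h"
    "\<And>u v. (u - v) * gram Q u v = poly g u * poly h v - poly h u * poly g v"
    "\<And>u v. (u - v) * tridiagonal (map snd xs) fs u v = u * poly h u * poly g v - v * poly h v * poly g u"
    by blast
  have h0: "h = 0" if "xs = []"
    using step.hyps(1) that by (auto elim: J_fraction.cases)
  obtain s where s: "s * s = b" using step.hyps(2) by (metis less_imp_le abs_of_nonneg real_sqrt_mult_self)
  have tridiagonal: "tridiagonal (map snd ((b, a) # xs)) (g # fs) u v = a * poly g u * poly g v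
     - poly g u * poly h v - poly h u * poly g v + tridiagonal (map snd xs) fs u v" for u v
    using IH(1,3) h0 by (cases xs; cases fs) auto
  have "(u - v) * tridiagonal (map snd ((b, a) # xs)) (g # fs) u v
      = u * poly g u * poly ([:a, b:] * g - h) v - v * poly g v * poly ([:a, b:] * g - h) u" for u v
  proof -
    have "(u - v) * tridiagonal (map snd ((b, a) # xs)) (g # fs) u v = (u - v) * (a * poly g u * poly g v
     - poly g u * poly h v - poly h u * poly g v) + (u - v) * tridiagonal (map snd xs) fs u v"
      unfolding tridiagonal by (simp add: algebra_simps)
    thus ?thesis unfolding IH(5) by (simp add: algebra_simps)
  qed
  moreover have "(u - v) * gram (smult s g # Q) u v =
     poly ([:a, b:] * g - h) u * poly g v - poly g u * poly ([:a, b:] * g - h) v" for u v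
  proof -
    have "(u - v) * gram (smult s g # Q) u v = (u - v) * (s * s) * (poly g u * poly g v) + (u - v) * gram Q u v"
      by (simp add: algebra_simps)
    thus ?thesis unfolding IH(4) s by (simp add: algebra_simps)
  qed
  ultimately show ?case using IH(1,2)
    by (intro exI[of _ "g # fs"] exI[of _ "smult s g # Q"]) auto
qed

lemma J_fraction_at_0:
  assumes "J_fraction c f g xs"
  shows "poly f 0 = c * continuant (map snd xs) \<and>
     poly g 0 = (if xs = [] then 0 else c * continuant (map snd (tl xs)))"
  using assms
proof (induction rule: J_fraction.induct)
  case (step g h xs b a)
  thus ?case by (cases xs) (auto simp: algebra_simps)
qed simp

abbreviation cpoly :: "real poly \<Rightarrow> complex poly" where
  "cpoly \<equiv> map_poly complex_of_real"

lemma cpoly_simps [simp]: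
  "cpoly (p + q) = cpoly p + cpoly q" "cpoly (p - q) = cpoly p - cpoly q"
  "cpoly (p * q) = cpoly p * cpoly q" "cpoly (- p) = - cpoly p" "cpoly 0 = 0" "cpoly 1 = 1"
  "cpoly (pCons a p) = pCons (of_real a) (cpoly p)" "cpoly (smult a p) = smult (of_real a) (cpoly p)"
  by (rule poly_eqI; simp add: coeff_map_poly coeff_mult coeff_pCons split: nat.split)+

lemma poly_cpoly_of_real [simp]: "poly (cpoly p) (of_real x) = of_real (poly p x)"
  by (induction p) simp_all

lemma poly_cpoly_cnj: "poly (cpoly p) (cnj z) = cnj (poly (cpoly p) z)"
  by (induction p) simp_all

text \<open>
One division step adds \<open>b Im u |g(u)|\<^sup>2\<close>.
\<close>
lemma J_fraction_Im_nonneg: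
  assumes "J_fraction c f g xs" "Im u \<ge> 0"
  shows "Im (poly (cpoly f) u * cnj (poly (cpoly g) u)) \<ge> 0"
  using assms(1)
proof (induction rule: J_fraction.induct)
  case (step g h xs b a)
  let ?G = "poly (cpoly g) u" and ?H = "poly (cpoly h) u"
  have "Im (poly (cpoly ([:a, b:] * g - h)) u * cnj ?G) =
      b * Im u * ((Re ?G)\<^sup>2 + (Im ?G)\<^sup>2) + Im (?G * cnj ?H)"
    by (simp add: algebra_simps power2_eq_square)
  thus ?case using step assms(2) by simp
qed simp

lemma J_fraction_no_common_root:
  assumes "J_fraction c f g xs" "c > 0"
  shows "poly (cpoly f) u \<noteq> 0 \<or> poly (cpoly g) u \<noteq> 0"
  using assms(1)
proof (induction rule: J_fraction.induct)
  case base
  thus ?case using assms(2) by simp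
qed auto

text \<open>
One division step adds \<open>b g(x)\<^sup>2\<close>; this is the Bezout kernel on the diagonal.
\<close>
lemma J_fraction_wronskian_nonneg:
  assumes "J_fraction c f g xs"
  shows "poly (pderiv f) x * poly g x - poly (pderiv g) x * poly f x \<ge> 0"
  using assms
proof (induction rule: J_fraction.induct)
  case (step g h xs b a)
  have "poly (pderiv ([:a, b:] * g - h)) x * poly g x - poly (pderiv g) x * poly ([:a, b:] * g - h) x
    = b * (poly g x)\<^sup>2 + (poly (pderiv g) x * poly h x - poly (pderiv h) x * poly g x)"
    by (simp add: pderiv_mult pderiv_diff pderiv_add pderiv_smult pderiv_pCons algebra_simps power2_eq_square)
  thus ?case using step by simp
qed simp

section \<open>Hurwitz determinants of a J-fraction\<close>

abbreviation pair_det :: "nat \<Rightarrow> nat \<Rightarrow> real poly \<Rightarrow> real poly \<Rightarrow> real" where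
  "pair_det m L f g \<equiv> fps_det m (rev_fps L f) (rev_fps (L - 1) g)"

lemma J_fraction_revf:
  assumes "J_fraction c g h xs" "c > 0"
  shows "rev_fps (Suc (length xs)) ([:a, b:] * g - h) = fps_const b * rev_fps (length xs) g
     + fps_X * (fps_const a * rev_fps (length xs) g - fps_X * rev_fps (length xs - 1) h)"
  using J_fraction_coeffs[OF assms] by (intro rev_fps_jstep) (auto intro: degree_le)

lemma J_fraction_dets_odd:
  assumes "J_fraction c f g xs" "c > 0" "j < length xs"
  shows "pair_det (2 * j + 1) (length xs) f g > 0"
  using assms
proof (induction arbitrary: j rule: J_fraction.induct)
  case (step g h xs b a)
  have G: "coeff g (length xs) > 0" using J_fraction_coeffs[OF step.hyps(1) step.prems(1)] by simp
  show ?case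
  proof (cases j)
    case 0
    thus ?thesis using G by (simp add: fps_det_1)
  next
    case (Suc i)
    have "pair_det (2 * i + 3) (Suc (length xs)) ([:a, b:] * g - h) g
      = (coeff g (length xs))\<^sup>2 * pair_det (2 * i + 1) (length xs) g h"
      using fps_det_odd_step[OF J_fraction_revf[OF step.hyps(1) step.prems(1)], of i a b] by simp
    moreover have "pair_det (2 * i + 1) (length xs) g h > 0"
      using step Suc by simp
    ultimately show ?thesis using G Suc by (simp add: eval_nat_numeral)
  qed
qed simp

text \<open>
The product of the squared leading coefficients of the first \<open>j\<close> remainders, by which the determinant
of size \<open>2 j\<close> differs from a continuant.
\<close>
fun lead_scale :: "real \<Rightarrow> nat \<Rightarrow> (real \<times> real) list \<Rightarrow> real" where
  "lead_scale c (Suc j) (x # xs) = (c * prod_list (map fst xs))\<^sup>2 * lead_scale c j xs"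
| "lead_scale c _ _ = 1"

lemma J_fraction_dets_even:
  assumes "J_fraction c f g xs" "c > 0" "j \<le> length xs"
  shows "pair_det (2 * j) (length xs) f g = lead_scale c j xs * continuant (take j (map snd xs))"
  using assms
proof (induction xs arbitrary: j f g rule: length_induct)
  case (1 xs)
  note c = \<open>c > 0\<close>
  show ?case
  proof (cases j)
    case 0
    thus ?thesis by (simp add: mixed_det_def)
  next
    case (Suc i)
    from 1(2) show ?thesis
    proof (cases rule: J_fraction.cases)
      case base
      thus ?thesis using 1(4) Suc by simp
    next
      case (step h xs' b a)
      have G: "coeff g (length xs') = c * prod_list (map fst xs')"
        using J_fraction_coeffs[OF step(3) c] by simp
      note F = J_fraction_revf[OF step(3) c, of a b]
      show ?thesis
      proof (cases i)
        case 0
        thus ?thesis using fps_det_2[OF F] Suc by (simp add: step G)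
      next
        case i: (Suc k)
        from step(3) show ?thesis
        proof (cases rule: J_fraction.cases)
          case base
          thus ?thesis using 1(4) Suc i step by simp
        next
          case step': (step h' xs'' b' a')
          have Y: "coeff h (length xs'') = c * prod_list (map fst xs'')"
            using J_fraction_coeffs[OF step'(3) c] by simp
          have IH1: "pair_det (2 * k + 2) (length xs') g h = lead_scale c (Suc k) xs' * continuant (take (Suc k) (map snd xs'))"
            using 1(1)[rule_format, of xs' g h "Suc k"] step step' 1 Suc i by simp
          have IH2: "pair_det (2 * k) (length xs'') h h' = lead_scale c k xs'' * continuant (take k (map snd xs''))"
            using 1(1)[rule_format, of xs'' h h' k] step step' 1 Suc i by simp
          have len: "length xs' - Suc 0 = length xs''" by (simp add: step'(2))
          have G': "rev_fps (length xs') g = fps_const b' * rev_fps (length xs' - 1) h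
             + fps_X * (fps_const a' * rev_fps (length xs' - 1) h - fps_X * rev_fps (length xs'' - 1) h')"
            using J_fraction_revf[OF step'(3) c, of a' b'] by (simp add: step'(1,2))
          have "pair_det (2 * k + 4) (length xs) f g = (coeff g (length xs'))\<^sup>2 *
             (a * pair_det (2 * k + 2) (length xs') g h - (coeff h (length xs''))\<^sup>2 * pair_det (2 * k) (length xs'') h h')"
            using fps_det_even_step[OF F G', of k] len by (simp add: step(1,2))
          moreover have "2 * j = 2 * k + 4" by (simp add: Suc i)
          moreover have "lead_scale c j xs = (c * prod_list (map fst xs'))\<^sup>2 * lead_scale c (Suc k) xs'"
            by (simp add: Suc i step(2))
          moreover have "lead_scale c (Suc k) xs' = (c * prod_list (map fst xs''))\<^sup>2 * lead_scale c k xs''"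
            by (simp add: step'(2))
          moreover have "continuant (take j (map snd xs)) = a * continuant (take (Suc k) (map snd xs')) - continuant (take k (map snd xs''))"
            by (simp add: Suc i step(2) step'(2))
          ultimately show ?thesis by (simp only: IH1 IH2 G Y) (simp only: algebra_simps)
        qed
      qed
    qed
  qed
qed

lemma lead_scale_pos:
  assumes "J_fraction c f g xs" "c > 0"
  shows "lead_scale c j xs > 0"
  using assms
proof (induction arbitrary: j rule: J_fraction.induct)
  case (step g h xs b a)
  have "c * prod_list (map fst xs) > 0" using J_fraction_coeffs[OF step.hyps(1) step.prems] by simp
  hence "(c * prod_list (map fst xs))\<^sup>2 * lead_scale c k xs > 0" for k
    using mult_pos_pos[OF zero_less_power] step.IH step.prems by blast
  thus ?case by (cases j) (simp_all only: lead_scale.simps zero_less_one)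
qed simp

lemma pair_dets_pos_imp_J_fraction:
  assumes "coeff f L > 0" "\<And>i. i > L \<Longrightarrow> coeff f i = 0" "\<And>i. i \<ge> L \<Longrightarrow> coeff g i = 0"
    "\<And>j. j < L \<Longrightarrow> pair_det (2 * j + 1) L f g > 0"
  shows "\<exists>c>0. \<exists>xs. J_fraction c f g xs \<and> length xs = L"
  using assms
proof (induction L arbitrary: f g)
  case 0
  have "g = 0" by (rule poly_eqI) (simp add: 0)
  moreover have "f = [:coeff f 0:]" by (rule poly_eqI) (use 0 in \<open>auto simp: coeff_pCons split: nat.splits\<close>)
  ultimately show ?case using 0 by (metis J_fraction.base list.size(3))
next
  case (Suc d)
  have g: "coeff g i = 0" if "i > d" for i using Suc.prems(3) that by simp
  have G: "coeff g d > 0" using Suc.prems(4)[of 0] by (simp add: fps_det_1)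
  obtain a b h where h: "b > 0" "f = [:a, b:] * g - h" "\<And>i. i \<ge> d \<Longrightarrow> coeff h i = 0"
    using division_step_exists[OF Suc.prems(1,2) G g] by blast
  have "pair_det (2 * j + 1) d g h > 0" if "j < d" for j
  proof -
    have "rev_fps (Suc d) f = fps_const b * rev_fps d g + fps_X * (fps_const a * rev_fps d g - fps_X * rev_fps (d - 1) h)"
      unfolding h(2) by (rule rev_fps_jstep) (use g h(3) in \<open>auto intro: degree_le\<close>)
    from fps_det_odd_step[OF this, of j] have "pair_det (2 * Suc j + 1) (Suc d) f g = (coeff g d)\<^sup>2 * pair_det (2 * j + 1) d g h"
      by (simp add: eval_nat_numeral)
    moreover have "pair_det (2 * Suc j + 1) (Suc d) f g > 0" using Suc.prems(4)[of "Suc j"] that by simp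
    ultimately show ?thesis by (simp add: zero_less_mult_iff)
  qed
  then obtain c xs where "c > 0" "J_fraction c g h xs" "length xs = d"
    using Suc.IH[of g h] G g h(3) by blast
  thus ?case using J_fraction.step[of c g h xs b a] h by (metis length_Cons)
qed

section \<open>Even and odd parts\<close>

definition even_part :: "real poly \<Rightarrow> real poly" where
  "even_part p = Poly (map (\<lambda>i. coeff p (2 * i)) [0..<Suc (degree p)])"

definition odd_part :: "real poly \<Rightarrow> real poly" where
  "odd_part p = Poly (map (\<lambda>i. coeff p (2 * i + 1)) [0..<Suc (degree p)])"

lemma coeff_even_part [simp]: "coeff (even_part p) i = coeff p (2 * i)"
  by (auto simp: even_part_def nth_default_def coeff_eq_0 not_less simp del: upt_Suc)

lemma coeff_odd_part [simp]: "coeff (odd_part p) i = coeff p (2 * i + 1)"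
  by (auto simp: odd_part_def nth_default_def coeff_eq_0 not_less simp del: upt_Suc)

lemma parts_linear:
  "even_part (p + q) = even_part p + even_part q" "odd_part (p + q) = odd_part p + odd_part q"
  "even_part (smult c p) = smult c (even_part p)" "odd_part (smult c p) = smult c (odd_part p)"
  by (rule poly_eqI; simp)+

lemma parts_pCons:
  "even_part (pCons a p) = pCons a (odd_part p)" "odd_part (pCons a p) = even_part p"
  by (rule poly_eqI; simp add: coeff_pCons split: nat.split)+

lemma parts_0 [simp]: "even_part 0 = 0" "odd_part 0 = 0"
  by (rule poly_eqI; simp)+

lemma poly_parts: "poly p x = poly (even_part p) (x\<^sup>2) + x * poly (odd_part p) (x\<^sup>2)"
  by (induction p) (simp_all add: parts_pCons algebra_simps power2_eq_square)

lemma poly_cpoly_parts: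
  "poly (cpoly p) x = poly (cpoly (even_part p)) (x\<^sup>2) + x * poly (cpoly (odd_part p)) (x\<^sup>2)"
  by (induction p) (simp_all add: parts_pCons algebra_simps power2_eq_square)

text \<open>
For odd degree the multiple \<open>u o(u)\<close> is added to make the degree of the first polynomial of the pair
exceed that of the odd part by one; its leading coefficient is the one of \<open>p\<close>.
\<close>
definition J_num :: "real poly \<Rightarrow> real poly" where
  "J_num p = (if even (degree p) then even_part p else even_part p + pCons 0 (odd_part p))"

abbreviation J_len :: "real poly \<Rightarrow> nat" where
  "J_len p \<equiv> (degree p + 1) div 2"

lemma J_num_coeffs:
  assumes "lead_coeff p > 0" 
  shows "coeff (J_num p) (J_len p) = lead_coeff p" "\<And>i. i > J_len p \<Longrightarrow> coeff (J_num p) i = 0"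
    "\<And>i. i \<ge> J_len p \<Longrightarrow> coeff (odd_part p) i = 0"
  by (auto simp: J_num_def coeff_pCons coeff_eq_0 elim!: evenE oddE split: nat.split)

lemma hurwitz_det_even:
  assumes "even (degree p)"
  shows "hurwitz_det m p = pair_det m (J_len p) (J_num p) (odd_part p)"
proof -
  obtain L where L: "degree p = 2 * L" using assms by (auto elim: evenE)
  have "Abs_fps (\<lambda>i. desc_coeff p (2 * int i)) = rev_fps (J_len p) (J_num p)"
    by (rule fps_ext) (auto simp: rev_fps_def J_num_def desc_coeff_def L nat_mult_distrib diff_mult_distrib2)
  moreover have "Abs_fps (\<lambda>i. desc_coeff p (2 * int i + 1)) = rev_fps (J_len p - 1) (odd_part p)"
  proof (rule fps_ext)
    fix i
    have "2 * L - nat (2 * int i + 1) = 2 * (L - 1 - i) + 1" if "Suc i \<le> L" using that by linarith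
    moreover have "2 * int i + 1 \<le> 2 * int L \<longleftrightarrow> Suc i \<le> L" by linarith
    moreover have "coeff p (Suc 0) = 0" if "L = 0" using that L by (intro coeff_eq_0) simp
    ultimately show "fps_nth (Abs_fps (\<lambda>i. desc_coeff p (2 * int i + 1))) i = fps_nth (rev_fps (J_len p - 1) (odd_part p)) i"
      by (auto simp: rev_fps_def desc_coeff_def L)
  qed
  ultimately show ?thesis by (simp add: hurwitz_det_eq_fps)
qed

text \<open>
For odd degree, \<open>F\<close> and \<open>G\<close> of \<open>p\<close> come from the odd and the even part. Since the numerator
\<open>e + u o\<close> has the coefficients \<open>F + X G\<close>, this is a single Routh step.
\<close>
lemma hurwitz_det_odd:
  assumes "odd (degree p)"
  shows "pair_det (Suc m) (J_len p) (J_num p) (odd_part p) = lead_coeff p * hurwitz_det m p"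
proof -
  obtain l where l: "degree p = 2 * l + 1" using assms by (auto elim: oddE)
  have F: "Abs_fps (\<lambda>i. desc_coeff p (2 * int i)) = rev_fps l (odd_part p)"
  proof (rule fps_ext)
    fix i
    have "2 * l + 1 - nat (2 * int i) = 2 * (l - i) + 1" if "i \<le> l" using that by linarith
    moreover have "2 * int i \<le> 2 * int l + 1 \<longleftrightarrow> i \<le> l" by linarith
    ultimately show "fps_nth (Abs_fps (\<lambda>i. desc_coeff p (2 * int i))) i = fps_nth (rev_fps l (odd_part p)) i"
      by (auto simp: rev_fps_def desc_coeff_def l)
  qed
  have G: "Abs_fps (\<lambda>i. desc_coeff p (2 * int i + 1)) = rev_fps l (even_part p)"
  proof (rule fps_ext)
    fix i
    have "2 * l + 1 - nat (2 * int i + 1) = 2 * (l - i)" if "i \<le> l" using that by linarith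
    thus "fps_nth (Abs_fps (\<lambda>i. desc_coeff p (2 * int i + 1))) i = fps_nth (rev_fps l (even_part p)) i"
      by (auto simp: rev_fps_def desc_coeff_def l)
  qed
  have "rev_fps (Suc l) (J_num p) = fps_const 1 * rev_fps l (odd_part p) + fps_X * rev_fps l (even_part p)"
  proof (rule fps_ext)
    fix i
    have "coeff p (Suc (Suc (2 * l))) = 0" by (rule coeff_eq_0) (simp add: l)
    thus "fps_nth (rev_fps (Suc l) (J_num p)) i = fps_nth (fps_const 1 * rev_fps l (odd_part p) + fps_X * rev_fps l (even_part p)) i"
    proof (cases i)
      case (Suc k)
      show ?thesis
      proof (cases "k < l")
        case True
        then obtain e where "l = Suc (k + e)" using less_imp_Suc_add by blast
        thus ?thesis by (simp add: rev_fps_def J_num_def l Suc Suc_diff_le)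
      qed (auto simp: rev_fps_def J_num_def l Suc coeff_pCons not_less split: nat.splits)
    qed (simp add: rev_fps_def J_num_def l)
  qed
  thus ?thesis
    using fps_det_expand[of m 1 "rev_fps l (odd_part p)" "rev_fps l (even_part p)"] F G l
    by (simp add: hurwitz_det_eq_fps)
qed

text \<open>
The determinants on the left have odd sizes \<open>2 j + 1\<close> with respect to the pair of the J-fraction, in
both parities of the degree. For odd degree the size \<open>1\<close> is the leading coefficient of \<open>p\<close>.
\<close>
proposition hurwitz_dets_pos_iff_J_fraction:
  assumes "degree p \<ge> 1" "lead_coeff p > 0"
  shows "(\<forall>j\<in>{1..degree p - 1}. even (degree p - 1 - j) \<longrightarrow> hurwitz_det j p > 0) \<longleftrightarrow>
     (\<exists>c>0. \<exists>xs. J_fraction c (J_num p) (odd_part p) xs \<and> length xs = J_len p)"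
proof -
  have "(\<forall>j\<in>{1..degree p - 1}. even (degree p - 1 - j) \<longrightarrow> hurwitz_det j p > 0) \<longleftrightarrow>
     (\<forall>j<J_len p. pair_det (2 * j + 1) (J_len p) (J_num p) (odd_part p) > 0)"
  proof (cases "even (degree p)")
    case True
    then obtain L where L: "degree p = 2 * L" by (auto elim: evenE)
    have "(\<forall>j\<in>{1..degree p - 1}. even (degree p - 1 - j) \<longrightarrow> Q j) \<longleftrightarrow> (\<forall>i<L. Q (2 * i + 1))" for Q
    proof (intro iffI allI impI ballI)
      fix i assume "\<forall>j\<in>{1..degree p - 1}. even (degree p - 1 - j) \<longrightarrow> Q j" "i < L"
      thus "Q (2 * i + 1)" by (auto simp: L)
    next
      fix j assume *: "\<forall>i<L. Q (2 * i + 1)" "j \<in> {1..degree p - 1}" "even (degree p - 1 - j)"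
      hence "odd j" by (auto simp: L)
      then obtain i where "j = 2 * i + 1" by (rule oddE)
      thus "Q j" using * L by auto
    qed
    thus ?thesis using L by (simp add: hurwitz_det_even[OF True])
  next
    case False
    then obtain l where l: "degree p = 2 * l + 1" by (auto elim: oddE)
    have "(\<forall>j\<in>{1..degree p - 1}. even (degree p - 1 - j) \<longrightarrow> Q j) \<longleftrightarrow> (\<forall>i<l. Q (2 * i + 2))" for Q
    proof (intro iffI allI impI ballI)
      fix i assume "\<forall>j\<in>{1..degree p - 1}. even (degree p - 1 - j) \<longrightarrow> Q j" "i < l"
      thus "Q (2 * i + 2)" by (auto simp: l)
    next
      fix j assume *: "\<forall>i<l. Q (2 * i + 2)" "j \<in> {1..degree p - 1}" "even (degree p - 1 - j)"
      hence "even j" by (auto simp: l)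
      then obtain i where "j = 2 * i" by (rule evenE)
      moreover obtain i' where "i = Suc i'" using * calculation by (cases i) auto
      ultimately show "Q j" using * l by auto
    qed
    moreover have "pair_det (2 * j + 1) (J_len p) (J_num p) (odd_part p) = lead_coeff p * hurwitz_det (2 * j) p" for j
      using hurwitz_det_odd[OF False, of "2 * j"] by simp
    moreover have "hurwitz_det 0 p = 1" by (simp add: hurwitz_det_def det_def)
    ultimately show ?thesis using assms(2) l
      by (simp add: zero_less_mult_iff All_less_Suc2)
  qed
  also have "\<dots> \<longleftrightarrow> (\<exists>c>0. \<exists>xs. J_fraction c (J_num p) (odd_part p) xs \<and> length xs = J_len p)"
  proof
    assume "\<forall>j<J_len p. pair_det (2 * j + 1) (J_len p) (J_num p) (odd_part p) > 0"
    thus "\<exists>c>0. \<exists>xs. J_fraction c (J_num p) (odd_part p) xs \<and> length xs = J_len p"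
      using J_num_coeffs[OF assms(2)] assms(2) by (intro pair_dets_pos_imp_J_fraction) auto
  next
    assume "\<exists>c>0. \<exists>xs. J_fraction c (J_num p) (odd_part p) xs \<and> length xs = J_len p"
    thus "\<forall>j<J_len p. pair_det (2 * j + 1) (J_len p) (J_num p) (odd_part p) > 0"
      using J_fraction_dets_odd by metis
  qed
  finally show ?thesis .
qed

lemma filter_parity:
  "filter (\<lambda>j. even j = even (2 * k)) [1..<Suc (2 * k)] = map (\<lambda>i. 2 * i + 2) [0..<k]"
  "filter (\<lambda>j. even j = even (2 * k + 1)) [1..<Suc (2 * k + 1)] = map (\<lambda>i. 2 * i + 1) [0..<Suc k]"
  by (induction k) simp_all

text \<open>
The terms of the sequence are continuants up to positive factors.
\<close>
lemma frobenius_hurwitz_seq: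
  assumes jf: "J_fraction c (J_num p) (odd_part p) xs" "c > 0" "length xs = J_len p"
    and p: "lead_coeff p > 0" and m: "m \<le> degree p" "even m = even (degree p)"
  shows "frobenius_changes (hurwitz_seq m p) = frobenius_changes (continuants (map snd xs) (Suc ((m + 1) div 2)))"
proof (rule frobenius_changes_cong_sgn[where \<sigma> = 1])
  have len: "length (filter (\<lambda>j. even j = even m) [1..<Suc m]) = (m + 1) div 2"
  proof (cases "even m")
    case True
    then obtain k where "m = 2 * k" by (rule evenE)
    thus ?thesis using filter_parity(1)[of k] by (simp del: upt_Suc)
  next
    case False
    then obtain k where "m = 2 * k + 1" by (rule oddE)
    thus ?thesis using filter_parity(2)[of k] by (simp del: upt_Suc)
  qed
  thus "length (hurwitz_seq m p) = length (continuants (map snd xs) (Suc ((m + 1) div 2)))"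
    by (simp add: hurwitz_seq_def del: upt_Suc)
  show "sgn (hurwitz_seq m p ! i) = 1 * sgn (continuants (map snd xs) (Suc ((m + 1) div 2)) ! i)"
    if i: "i < length (continuants (map snd xs) (Suc ((m + 1) div 2)))" for i
  proof (cases i)
    case 0
    thus ?thesis by (simp add: hurwitz_seq_def continuants_nth_0)
  next
    case (Suc j)
    have j: "j < (m + 1) div 2" using i Suc by simp
    have le: "Suc j \<le> length xs" using j m(1) jf(3) by linarith
    have H: "pair_det (2 * Suc j) (J_len p) (J_num p) (odd_part p) = lead_scale c (Suc j) xs * continuant (take (Suc j) (map snd xs))"
      using J_fraction_dets_even[OF jf(1,2) le] jf(3) by simp
    have "sgn (hurwitz_seq m p ! Suc j) = sgn (pair_det (2 * Suc j) (J_len p) (J_num p) (odd_part p))"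
    proof (cases "even m")
      case True
      then obtain k where k: "m = 2 * k" by (rule evenE)
      hence "hurwitz_seq m p ! Suc j = hurwitz_det (2 * j + 2) p"
        using filter_parity(1)[of k] j by (simp add: hurwitz_seq_def del: upt_Suc)
      thus ?thesis using hurwitz_det_even[of p] True m by simp
    next
      case False
      then obtain k where k: "m = 2 * k + 1" by (rule oddE)
      hence "hurwitz_seq m p ! Suc j = hurwitz_det (2 * j + 1) p"
        using filter_parity(2)[of k] j by (simp add: hurwitz_seq_def del: upt_Suc)
      moreover have "pair_det (2 * Suc j) (J_len p) (J_num p) (odd_part p) = lead_coeff p * hurwitz_det (2 * j + 1) p"
        using hurwitz_det_odd[of p "2 * j + 1"] False m by simp
      ultimately show ?thesis using p by (simp add: sgn_mult)
    qed
    also have "\<dots> = sgn (continuant (take (Suc j) (map snd xs)))"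
      unfolding H using lead_scale_pos[OF jf(1,2)] by (simp add: sgn_mult)
    also have "continuant (take (Suc j) (map snd xs)) = continuants (map snd xs) (Suc ((m + 1) div 2)) ! Suc j"
      using j by (simp add: continuants_def del: upt_Suc)
    finally show ?thesis by (simp add: Suc)
  qed
  show "continuants (map snd xs) (Suc ((m + 1) div 2)) ! 0 \<noteq> 0" by (simp add: continuants_nth_0)
qed simp

section \<open>The Hermite kernel of a polynomial with prescribed zeros\<close>

definition stable :: "real poly \<Rightarrow> bool" where
  "stable q \<longleftrightarrow> q \<noteq> 0 \<and> (\<forall>z. poly (cpoly q) z = 0 \<longrightarrow> Re z < 0)"

text \<open>
\<open>Z\<close> is the set of zeros in the closed right half-plane. The last condition replaces all parity
conditions on the negative zeros.
\<close>
definition root_form :: "real poly \<Rightarrow> real set \<Rightarrow> real poly \<Rightarrow> bool" where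
  "root_form p Z q \<longleftrightarrow> finite Z \<and> (\<forall>a\<in>Z. 0 \<le> a) \<and> p = (\<Prod>a\<in>Z. [:- a, 1:]) * q \<and> stable q \<and>
     (\<forall>a\<in>Z. 0 < a \<longrightarrow> poly p (- a) * poly (pderiv p) a < 0)"

text \<open>
Spanning in dual form, which is how it is used: the arguments about inertia only involve functionals.
\<close>
definition spans :: "nat set \<Rightarrow> real poly list \<Rightarrow> real poly list \<Rightarrow> bool" where
  "spans S P N \<longleftrightarrow> (\<forall>l. linear_fun l \<longrightarrow> (\<forall>f\<in>set P \<union> set N. l f = 0) \<longrightarrow> (\<forall>i\<in>S. l (monom 1 i) = 0))"

text \<open>
\<open>P\<close> and \<open>N\<close> diagonalise the Hermite kernel \<open>(p(x) p(y) - p(-x) p(-y)) / (x + y)\<close> into positive and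
negative squares.
\<close>
definition hermite_rep :: "real poly \<Rightarrow> real poly list \<Rightarrow> real poly list \<Rightarrow> bool" where
  "hermite_rep p P N \<longleftrightarrow> (\<forall>x y. (x + y) * (gram P x y - gram N x y) = poly p x * poly p y - poly p (- x) * poly p (- y))"

definition reflect :: "real poly \<Rightarrow> real poly" where
  "reflect p = pcompose p [:0, -1:]"

lemma poly_reflect [simp]: "poly (reflect p) x = poly p (- x)"
  by (simp add: reflect_def poly_pcompose)

lemma poly_cpoly_reflect [simp]: "poly (cpoly (reflect p)) z = poly (cpoly p) (- z)"
  by (induction p) (simp_all add: reflect_def pcompose_pCons)

lemma degree_reflect [simp]: "degree (reflect p) = degree p"
  by (simp add: reflect_def degree_pcompose)

lemma reflect_eq_0 [simp]: "reflect p = 0 \<longleftrightarrow> p = 0"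
proof
  assume "reflect p = 0"
  hence "poly p x = 0" for x using poly_reflect[of p "- x"] by simp
  thus "p = 0" using poly_all_0_iff_0 by blast
qed (simp add: reflect_def)

lemma cpoly_eq_0 [simp]: "cpoly p = 0 \<longleftrightarrow> p = 0"
  by (metis cpoly_simps(5) map_poly_eq_0_iff of_real_0 of_real_eq_0_iff)

lemma degree_cpoly [simp]: "degree (cpoly p) = degree p"
  by (rule degree_map_poly) simp

lemma cpoly_root_exists:
  assumes "degree p > 0"
  obtains z where "poly (cpoly p) z = 0"
  using fundamental_theorem_of_algebra[of "cpoly p"] assms by (auto simp: constant_degree)

lemma common_divisor_bezout:
  fixes a b :: "real poly"
  shows "\<exists>s t. (s * a + t * b) dvd a \<and> (s * a + t * b) dvd b"
proof (induction "if b = 0 then 0 else Suc (degree b)" arbitrary: a b rule: less_induct)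
  case less
  show ?case
  proof (cases "b = 0")
    case True
    thus ?thesis by (intro exI[of _ 1] exI[of _ 0]) simp
  next
    case False
    have "(if a mod b = 0 then 0 else Suc (degree (a mod b))) < (if b = 0 then 0 else Suc (degree b))"
      using degree_mod_less[OF False, of a] False by auto
    from less.hyps[OF this]
    obtain s t where st: "(s * b + t * (a mod b)) dvd b" "(s * b + t * (a mod b)) dvd a mod b" by blast
    have "s * b + t * m = t * (k * b + m) + (s - t * k) * b" for k m by (simp add: algebra_simps)
    from this[of "a mod b" "a div b"]
    have "s * b + t * (a mod b) = t * a + (s - t * (a div b)) * b" by simp
    moreover have "(s * b + t * (a mod b)) dvd a"
      using st by (metis dvd_mod_iff)
    ultimately show ?thesis using st(1) by metis
  qed
qed

text \<open>
Over the reals a nonconstant common divisor would have a complex root.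
\<close>
lemma bezout_no_common_root:
  assumes "\<And>z. poly (cpoly a) z = 0 \<Longrightarrow> poly (cpoly b) z \<noteq> 0"
  shows "\<exists>s t. s * a + t * b = (1 :: real poly)"
proof -
  obtain s t where d: "(s * a + t * b) dvd a" "(s * a + t * b) dvd b"
    using common_divisor_bezout by blast
  define d where "d = s * a + t * b"
  note d = d[folded d_def]
  have "d \<noteq> 0" using assms[of 0] d by auto
  have "degree d = 0"
  proof (rule ccontr)
    assume "degree d \<noteq> 0"
    then obtain z where z: "poly (cpoly d) z = 0" using cpoly_root_exists by blast
    hence "poly (cpoly a) z = 0" "poly (cpoly b) z = 0" using d by (auto elim!: dvdE)
    thus False using assms by blast
  qed
  then obtain c where c: "d = [:c:]" by (auto elim: degree_eq_zeroE)
  with \<open>d \<noteq> 0\<close> have "c \<noteq> 0" by auto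
  have "smult (inverse c) s * a + smult (inverse c) t * b = smult (inverse c) d"
    by (simp add: d_def smult_add_right)
  also have "\<dots> = 1" using \<open>c \<noteq> 0\<close> by (simp add: c one_pCons)
  finally show ?thesis by (intro exI)
qed

lemma linear_fun_mult_left: "linear_fun l \<Longrightarrow> linear_fun (\<lambda>f. l (p * f))"
  by (simp add: linear_fun_def distrib_left)

lemma spans_kills:
  assumes "spans {..<n} P N" "linear_fun l" "\<forall>f\<in>set P \<union> set N. l f = 0" "degree h < n"
  shows "l h = 0"
proof -
  have "l h = (\<Sum>i<n. coeff h i * l (monom 1 i))"
    by (rule linear_fun_expand[OF assms(2)]) (use assms(4) in \<open>auto intro: coeff_eq_0\<close>)
  moreover have "\<forall>i\<in>{..<n}. l (monom 1 i) = 0" using assms(1-3) unfolding spans_def by blast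
  ultimately show ?thesis by simp
qed

lemma gram_map_mult: "gram (map ((*) p) P) x y = poly p x * poly p y * gram P x y"
  by (induction P) (simp_all add: algebra_simps)

text \<open>
The Hermite kernel of \<open>p d\<close> is \<open>p(x) p(y)\<close> times the one of \<open>d\<close> plus \<open>d(-x) d(-y)\<close> times the one of \<open>p\<close>.
Spanning is preserved when \<open>p(x)\<close> and \<open>d(-x)\<close> are coprime, because then every polynomial of small
degree is \<open>p(x) a(x) + d(-x) b(x)\<close> with \<open>a\<close> and \<open>b\<close> of small degree.
\<close>
lemma hermite_rep_mult:
  assumes p: "hermite_rep p P N" "spans {..<degree p} P N" and d: "hermite_rep d P' N'" "spans {..<degree d} P' N'"
    and nz: "p \<noteq> 0" "d \<noteq> 0" and coprime: "\<And>z. poly (cpoly p) z = 0 \<Longrightarrow> poly (cpoly d) (- z) \<noteq> 0"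
  defines "P2 \<equiv> map ((*) p) P' @ map ((*) (reflect d)) P" and "N2 \<equiv> map ((*) p) N' @ map ((*) (reflect d)) N"
  shows "hermite_rep (p * d) P2 N2 \<and> spans {..<degree (p * d)} P2 N2"
proof
  show "hermite_rep (p * d) P2 N2"
    unfolding hermite_rep_def
  proof (intro allI)
    fix x y
    have "(x + y) * (gram P2 x y - gram N2 x y) = poly p x * poly p y * ((x + y) * (gram P' x y - gram N' x y))
       + poly d (- x) * poly d (- y) * ((x + y) * (gram P x y - gram N x y))"
      by (simp add: P2_def N2_def gram_map_mult algebra_simps)
    also have "(x + y) * (gram P' x y - gram N' x y) = poly d x * poly d y - poly d (- x) * poly d (- y)"
      using d(1) by (simp add: hermite_rep_def)
    also have "(x + y) * (gram P x y - gram N x y) = poly p x * poly p y - poly p (- x) * poly p (- y)"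
      using p(1) by (simp add: hermite_rep_def)
    finally show "(x + y) * (gram P2 x y - gram N2 x y) =
        poly (p * d) x * poly (p * d) y - poly (p * d) (- x) * poly (p * d) (- y)"
      by (simp add: algebra_simps)
  qed
  show "spans {..<degree (p * d)} P2 N2"
    unfolding spans_def
  proof (intro allI impI ballI)
    fix l i assume l: "linear_fun l" and kills: "\<forall>f\<in>set P2 \<union> set N2. l f = 0" and i: "i \<in> {..<degree (p * d)}"
    have lp: "l (p * f) = 0" if "degree f < degree d" for f
      by (rule spans_kills[OF d(2) linear_fun_mult_left[OF l, of p] _ that]) (use kills in \<open>auto simp: P2_def N2_def\<close>)
    have ld: "l (reflect d * f) = 0" if "degree f < degree p" for f
      by (rule spans_kills[OF p(2) linear_fun_mult_left[OF l, of "reflect d"] _ that]) (use kills in \<open>auto simp: P2_def N2_def\<close>)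
    obtain s t where st: "s * p + t * reflect d = 1"
      using bezout_no_common_root[of p "reflect d"] coprime by auto
    define h where "h = (monom 1 i :: real poly)"
    \<comment> \<open>the Bezout combination of \<open>h\<close>, with the first cofactor reduced to small degree\<close>
    define a where "a = (h * s) mod reflect d"
    define b where "b = (h * s) div reflect d * p + h * t"
    have "h = h * (s * p + t * reflect d)" by (simp add: st)
    also have "\<dots> = (h * s) * p + h * t * reflect d" by (simp add: algebra_simps)
    also have "h * s = a + (h * s) div reflect d * reflect d" unfolding a_def by simp
    finally have h: "h = p * a + reflect d * b" by (simp add: b_def algebra_simps)
    have a: "a = 0 \<or> degree a < degree d"
      using degree_mod_less[of "reflect d" "h * s"] nz by (auto simp: a_def)
    have b: "b = 0 \<or> degree b < degree p"
    proof (rule ccontr)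
      assume *: "\<not> ?thesis"
      have "reflect d * b = h - p * a" using h by simp
      moreover have "degree (reflect d * b) \<ge> degree (p * d)"
        using * nz by (simp add: degree_mult_eq)
      moreover have "degree h < degree (p * d)" using i by (simp add: h_def degree_monom_eq)
      moreover have "degree (p * a) < degree (p * d)"
        using a i nz degree_mult_le[of p a] by (cases "a = 0") (auto simp: degree_mult_eq)
      ultimately show False using degree_diff_less[of h "degree (p * d)" "p * a"] by simp
    qed
    have "l (p * a) = 0" using a lp linear_fun_simps(3)[OF l] by (cases "a = 0") auto
    moreover have "l (reflect d * b) = 0" using b ld linear_fun_simps(3)[OF l] by (cases "b = 0") auto
    ultimately show "l (monom 1 i) = 0"
      using h linear_fun_simps(1)[OF l] by (simp add: h_def)
  qed
qed

lemma linear_fun_const: "linear_fun l \<Longrightarrow> l [:s:] = s * l (monom 1 0)"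
  using linear_fun_simps(2)[of l s "monom 1 0"] by (simp add: monom_0)

lemma spans_const:
  assumes "s \<noteq> 0" "[:s:] \<in> set P \<union> set N"
  shows "spans {..<1} P N"
  unfolding spans_def
proof (intro allI impI ballI)
  fix l i assume l: "linear_fun l" "\<forall>f\<in>set P \<union> set N. l f = 0" and i: "i \<in> {..<1 :: nat}"
  have "l [:s:] = 0" using l(2) assms(2) by blast
  thus "l (monom 1 i) = 0" using assms(1) i linear_fun_const[OF l(1), of s] by simp
qed

lemma square_root_exists: "0 \<le> b \<Longrightarrow> \<exists>s :: real. s * s = b"
  by (metis abs_of_nonneg real_sqrt_mult_self)

lemma hermite_rep_linear:
  assumes "a > 0"
  shows "\<exists>f. (hermite_rep [:a, 1:] [f] [] \<and> spans {..<1} [f] []) \<and>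
     (hermite_rep [:- a, 1:] [] [f] \<and> spans {..<1} [] [f])"
proof -
  obtain s where s: "s * s = 2 * a" using square_root_exists[of "2 * a"] assms by auto
  hence "s \<noteq> 0" using assms by auto
  have gram: "(x + y) * gram [[:s:]] x y = (x + y) * (2 * a)" for x y by (simp add: s)
  have "hermite_rep [:a, 1:] [[:s:]] []" "hermite_rep [:- a, 1:] [] [[:s:]]"
    unfolding hermite_rep_def by (simp_all add: right_diff_distrib gram del: gram_simps(2)) (simp_all add: algebra_simps)
  moreover have "spans {..<1} [[:s:]] []" "spans {..<1} [] [[:s:]]"
    by (rule spans_const[OF \<open>s \<noteq> 0\<close>]; simp)+
  ultimately show ?thesis by blast
qed

text \<open>
The Hermite kernel of \<open>x\<^sup>2 + b x + c\<close> is \<open>2 b (x y + c)\<close>.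
\<close>
lemma hermite_rep_quadratic:
  assumes "b > 0" "c > 0"
  shows "\<exists>f g. hermite_rep [:c, b, 1:] [f, g] [] \<and> spans {..<2} [f, g] []"
proof -
  obtain s where s: "s * s = 2 * b" using square_root_exists[of "2 * b"] assms by auto
  obtain t where t: "t * t = 2 * b * c" using square_root_exists[of "2 * b * c"] assms by auto
  have nz: "s \<noteq> 0" "t \<noteq> 0" using s t assms by auto
  have "hermite_rep [:c, b, 1:] [[:0, s:], [:t:]] []"
    unfolding hermite_rep_def
  proof (intro allI)
    fix x y
    have "(x + y) * (gram [[:0, s:], [:t:]] x y - gram [] x y) = (x + y) * (s * s * (x * y) + t * t)"
      by (simp add: algebra_simps)
    thus "(x + y) * (gram [[:0, s:], [:t:]] x y - gram [] x y) =
       poly [:c, b, 1:] x * poly [:c, b, 1:] y - poly [:c, b, 1:] (- x) * poly [:c, b, 1:] (- y)"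
      unfolding s t by (simp add: algebra_simps)
  qed
  moreover have "spans {..<2} [[:0, s:], [:t:]] []"
    unfolding spans_def
  proof (intro allI impI ballI)
    fix l i assume l: "linear_fun l" "\<forall>f\<in>set [[:0, s:], [:t:]] \<union> set []. l f = 0" "i \<in> {..<2 :: nat}"
    have "[:0, s:] = smult s (monom 1 1)" by (simp add: monom_Suc monom_0)
    hence "l (monom 1 1) = 0" using l nz linear_fun_simps(2)[OF l(1), of s "monom 1 1"] by simp
    moreover have "l (monom 1 0) = 0" using l(2) nz linear_fun_const[OF l(1), of t] by simp
    moreover have "i = 0 \<or> i = 1" using l(3) by auto
    ultimately show "l (monom 1 i) = 0" by auto
  qed
  ultimately show ?thesis by blast
qed

lemma quadratic_factor:
  assumes "poly (cpoly q) z = 0" "Im z \<noteq> 0"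
  shows "[:(cmod z)\<^sup>2, - 2 * Re z, 1:] dvd q"
proof -
  define D where "D = [:(cmod z)\<^sup>2, - 2 * Re z, 1:]"
  have "z ^ 2 - 2 * Re z * z + (cmod z)\<^sup>2 = 0"
    by (simp add: complex_eq_iff power2_eq_square cmod_def)
  hence D: "poly (cpoly D) z = 0"
    by (simp add: D_def algebra_simps power2_eq_square)
  have "D \<noteq> 0" "degree D = 2" by (simp_all add: D_def)
  define r where "r = q mod D"
  have "degree r < 2" using degree_mod_less[OF \<open>D \<noteq> 0\<close>, of q] \<open>degree D = 2\<close> by (auto simp: r_def)
  hence r: "r = [:coeff r 0, coeff r 1:]"
    by (intro poly_eqI) (auto simp: coeff_pCons coeff_eq_0 split: nat.splits)
  have "q = q div D * D + r" by (simp add: r_def)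
  hence "poly (cpoly q) z = poly (cpoly (q div D * D + r)) z" by simp
  hence "poly (cpoly r) z = 0" using D assms(1) by simp
  hence "of_real (coeff r 0) + z * of_real (coeff r 1) = 0" by (subst (asm) r) simp
  hence "coeff r 0 = 0 \<and> coeff r 1 = 0" using assms(2) by (auto simp: complex_eq_iff)
  hence "r = 0" using r by simp
  thus ?thesis by (simp add: r_def D_def mod_eq_0_iff_dvd)
qed

lemma stable_dvd: "stable (a * b) \<Longrightarrow> stable a \<and> stable b"
  by (auto simp: stable_def)

text \<open>
Split off real linear or quadratic factors; stability makes their coefficients positive and the
factors coprime to the reflected ones.
\<close>
lemma stable_hermite_rep:
  assumes "stable q"
  shows "\<exists>P. length P = degree q \<and> hermite_rep q P [] \<and> spans {..<degree q} P []"
  using assms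
proof (induction "degree q" arbitrary: q rule: less_induct)
  case less
  show ?case
  proof (cases "degree q = 0")
    case True
    then obtain c where "q = [:c:]" by (auto elim: degree_eq_zeroE)
    thus ?thesis by (intro exI[of _ "[]"]) (simp add: hermite_rep_def spans_def)
  next
    case False
    then obtain z where z: "poly (cpoly q) z = 0" using cpoly_root_exists by blast
    hence re: "Re z < 0" using less.prems by (simp add: stable_def)
    obtain d k P' where dk: "q = k * d" "degree d > 0" "length P' = degree d"
      "hermite_rep d P' []" "spans {..<degree d} P' []"
    proof (cases "Im z = 0")
      case True
      hence "z = of_real (Re z)" by (simp add: complex_eq_iff)
      hence "poly q (Re z) = 0" using z by (metis poly_cpoly_of_real of_real_eq_0_iff)
      then obtain k where "q = k * [:- Re z, 1:]" by (metis poly_eq_0_iff_dvd dvdE mult.commute)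
      moreover obtain f where "hermite_rep [:- Re z, 1:] [f] [] \<and> spans {..<1} [f] []"
        using hermite_rep_linear[of "- Re z"] re by auto
      ultimately show ?thesis using that[of k "[:- Re z, 1:]" "[f]"] by simp
    next
      case False
      then obtain k where "q = k * [:(cmod z)\<^sup>2, - 2 * Re z, 1:]"
        using quadratic_factor[OF z] by (metis dvdE mult.commute)
      moreover have "z \<noteq> 0" using re by auto
      then obtain f g where "hermite_rep [:(cmod z)\<^sup>2, - 2 * Re z, 1:] [f, g] [] \<and> spans {..<2} [f, g] []"
        using hermite_rep_quadratic[of "- 2 * Re z" "(cmod z)\<^sup>2"] re by auto
      ultimately show ?thesis using that[of k "[:(cmod z)\<^sup>2, - 2 * Re z, 1:]" "[f, g]"] by (simp add: numeral_2_eq_2)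
    qed
    have st: "stable k" "stable d" using stable_dvd[of k d] less.prems dk(1) by auto
    hence nz: "k \<noteq> 0" "d \<noteq> 0" by (auto simp: stable_def)
    hence deg: "degree q = degree k + degree d" by (simp add: dk(1) degree_mult_eq)
    obtain P where P: "length P = degree k" "hermite_rep k P []" "spans {..<degree k} P []"
      using less.hyps[of k] st deg dk(2) by auto
    have "poly (cpoly d) (- w) \<noteq> 0" if "poly (cpoly k) w = 0" for w
      using st that unfolding stable_def by fastforce
    from hermite_rep_mult[OF P(2,3) dk(4,5) nz this] show ?thesis
      using P(1) dk(3) by (intro exI[of _ "map ((*) k) P' @ map ((*) (reflect d)) P"]) (simp add: dk(1) nz degree_mult_eq)
  qed
qed

lemma degree_prod_linear: "finite Z \<Longrightarrow> degree (\<Prod>a\<in>Z. [:- a, 1 :: real:]) = card Z"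
  by (subst degree_prod_sum_eq) auto

text \<open>
The positive zeros are split off one by one from the stable factor; \<open>p(-a) \<noteq> 0\<close> gives the required
coprimality. A zero at \<open>0\<close> only multiplies the kernel by \<open>x y\<close>, which shifts the spanned monomials.
\<close>
lemma root_form_hermite_rep:
  assumes rf: "root_form p Z q"
  defines "e \<equiv> (if 0 \<in> Z then 1 else 0 :: nat)"
  shows "\<exists>P N. length P + length N + e = degree p \<and> length N + e = card Z \<and>
     hermite_rep p P N \<and> spans {e..<degree p} P N"
proof -
  note rf = rf[unfolded root_form_def]
  have fin: "finite Z" and st: "stable q" and p: "p = (\<Prod>a\<in>Z. [:- a, 1:]) * q" using rf by auto
  have q0: "q \<noteq> 0" using st by (simp add: stable_def)
  define pr where "pr F = (\<Prod>a\<in>F. [:- a, 1:]) * q" for F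
  have pr0: "pr F \<noteq> 0" if "finite F" for F using q0 that by (simp add: pr_def)
  have main: "\<exists>P N. length P = degree q \<and> length N = card F \<and> hermite_rep (pr F) P N \<and> spans {..<degree (pr F)} P N"
    if "finite F" "F \<subseteq> Z - {0}" for F
    using that
  proof (induction F rule: finite_induct)
    case empty
    thus ?case using stable_hermite_rep[OF st] by (auto simp: pr_def)
  next
    case (insert a F)
    then obtain P N where PN: "length P = degree q" "length N = card F" "hermite_rep (pr F) P N" "spans {..<degree (pr F)} P N"
      by auto
    have a: "a \<in> Z" "a > 0" using insert.prems rf by force+
    obtain f where f: "hermite_rep [:- a, 1:] [] [f]" "spans {..<degree [:- a, 1:]} [] [f]"
      using hermite_rep_linear[OF a(2)] by auto
    have eq: "pr (insert a F) = pr F * [:- a, 1:]"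
      unfolding pr_def using insert.hyps by (simp add: mult_ac del: mult_pCons_left mult_pCons_right)
    have "pr F dvd p"
    proof -
      have "p = (\<Prod>a\<in>Z - F. [:- a, 1:]) * pr F"
        unfolding p pr_def using fin insert.prems by (subst prod.subset_diff[of F Z]) (auto simp: mult_ac)
      thus ?thesis by simp
    qed
    moreover have "poly p (- a) \<noteq> 0" using a rf by force
    ultimately have "poly (pr F) (- a) \<noteq> 0" by (auto elim!: dvdE)
    hence cop: "poly (cpoly [:- a, 1:]) (- z) \<noteq> 0" if "poly (cpoly (pr F)) z = 0" for z
    proof -
      have "z \<noteq> of_real (- a)"
        using that \<open>poly (pr F) (- a) \<noteq> 0\<close> poly_cpoly_of_real[of "pr F" "- a"] by (metis of_real_eq_0_iff)
      thus ?thesis by (auto simp: neg_eq_iff_add_eq_0 add_eq_0_iff)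
    qed
    have "[:- a, 1:] \<noteq> 0" by simp
    from hermite_rep_mult[OF PN(3,4) f pr0[OF insert.hyps(1)] this cop] show ?case
      unfolding eq using PN(1,2) insert.hyps
      by (intro exI[of _ "map ((*) (reflect [:- a, 1:])) P"] exI[of _ "pr F * f # map ((*) (reflect [:- a, 1:])) N"]) simp
  qed
  have deg: "degree p = card Z + degree q"
    using fin q0 by (simp add: p degree_mult_eq degree_prod_linear)
  obtain P N where PN: "length P = degree q" "length N = card (Z - {0})" "hermite_rep (pr (Z - {0})) P N"
      "spans {..<degree (pr (Z - {0}))} P N"
    using main[of "Z - {0}"] fin by auto
  show ?thesis
  proof (cases "0 \<in> Z")
    case False
    hence Z: "Z - {0} = Z" by auto
    have pr: "pr Z = p" by (simp add: pr_def p)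
    have e: "e = 0" "{e..<degree p} = {..<degree p}" using False by (auto simp: e_def)
    have "length P + length N + e = degree p \<and> length N + e = card Z \<and> hermite_rep p P N \<and> spans {e..<degree p} P N"
      using PN[unfolded Z pr] deg unfolding e(2) by (simp add: e(1))
    thus ?thesis by blast
  next
    case True
    have card: "card Z = Suc (card (Z - {0}))" by (rule card_Suc_Diff1[OF fin True, symmetric])
    have eq: "p = [:0, 1:] * pr (Z - {0})"
      unfolding p pr_def using fin True by (subst prod.remove[of Z 0]) (auto simp: mult_ac simp del: mult_pCons_left mult_pCons_right)
    have deg': "degree p = Suc (degree (pr (Z - {0})))"
      unfolding eq using pr0[of "Z - {0}"] fin by (subst degree_mult_eq) auto
    let ?m = "map ((*) [:0, 1:])"
    have "hermite_rep p (?m P) (?m N)"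
      unfolding hermite_rep_def
    proof (intro allI)
      fix x y
      have *: "(x + y) * (gram (?m P) x y - gram (?m N) x y) = x * y * ((x + y) * (gram P x y - gram N x y))"
        unfolding gram_map_mult by (simp add: algebra_simps)
      have p_at: "poly p z = z * poly (pr (Z - {0})) z" for z
        by (subst eq) simp
      show "(x + y) * (gram (?m P) x y - gram (?m N) x y) = poly p x * poly p y - poly p (- x) * poly p (- y)"
        unfolding * PN(3)[unfolded hermite_rep_def, rule_format] p_at by (simp add: algebra_simps)
    qed
    moreover have "spans {1..<degree p} (?m P) (?m N)"
      unfolding spans_def
    proof (intro allI impI ballI)
      fix l i assume l: "linear_fun l" "\<forall>f\<in>set (?m P) \<union> set (?m N). l f = 0" and i: "i \<in> {1..<degree p}"
      obtain j where j: "i = Suc j" using i by (cases i) auto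
      have "(\<lambda>f. l ([:0, 1:] * f)) (monom 1 j) = 0"
        using PN(4)[unfolded spans_def, rule_format, OF linear_fun_mult_left[OF l(1), of "[:0, 1:]"]] l(2) i j deg' by auto
      thus "l (monom 1 i) = 0" by (simp add: j monom_Suc)
    qed
    moreover have "e = 1" using True by (simp add: e_def)
    ultimately have "length (?m P) + length (?m N) + e = degree p \<and> length (?m N) + e = card Z \<and>
        hermite_rep p (?m P) (?m N) \<and> spans {e..<degree p} (?m P) (?m N)"
      using PN(1,2) deg card by simp
    thus ?thesis by blast
  qed
qed

section \<open>The law of inertia\<close>

text \<open>
More unknowns than homogeneous linear equations, solved by elimination.
\<close>
lemma nontrivial_combination:
  fixes M :: "'i \<Rightarrow> 'g \<Rightarrow> real"
  assumes "finite I" "card I > length N"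
  shows "\<exists>c. (\<exists>i\<in>I. c i \<noteq> 0) \<and> (\<forall>g\<in>set N. (\<Sum>i\<in>I. c i * M i g) = 0)"
  using assms
proof (induction N arbitrary: I M)
  case Nil
  then obtain i where "i \<in> I" by fastforce
  thus ?case by (intro exI[of _ "\<lambda>_. 1"]) auto
next
  case (Cons g N)
  show ?case
  proof (cases "\<forall>i\<in>I. M i g = 0")
    case True
    obtain c where "\<exists>i\<in>I. c i \<noteq> 0" "\<forall>h\<in>set N. (\<Sum>i\<in>I. c i * M i h) = 0"
      using Cons.IH[of I M] Cons.prems by auto
    thus ?thesis using True by (intro exI[of _ c]) auto
  next
    case False
    then obtain k where k: "k \<in> I" "M k g \<noteq> 0" by blast
    define M' where "M' i h = M i h - M i g / M k g * M k h" for i h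
    have "card (I - {k}) > length N" using Cons.prems k by simp
    then obtain c where c: "\<exists>i\<in>I - {k}. c i \<noteq> 0" "\<forall>h\<in>set N. (\<Sum>i\<in>I - {k}. c i * M' i h) = 0"
      using Cons.IH[of "I - {k}" M'] Cons.prems by auto
    define s where "s = (\<Sum>i\<in>I - {k}. c i * (M i g / M k g))"
    define c' where "c' i = (if i = k then - s else c i)" for i
    have sum: "(\<Sum>i\<in>I. c' i * M i h) = (\<Sum>i\<in>I - {k}. c i * M' i h)" for h
    proof -
      have "(\<Sum>i\<in>I. c' i * M i h) = - s * M k h + (\<Sum>i\<in>I - {k}. c i * M i h)"
        using k Cons.prems by (subst sum.remove[of _ k]) (auto simp: c'_def)
      moreover have "(\<Sum>i\<in>I - {k}. c i * M' i h) = (\<Sum>i\<in>I - {k}. c i * M i h) - s * M k h"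
        by (simp add: M'_def s_def sum_distrib_right sum_subtractf right_diff_distrib mult.assoc)
      ultimately show ?thesis by simp
    qed
    have "M' i g = 0" for i using k by (simp add: M'_def)
    hence "(\<Sum>i\<in>I. c' i * M i h) = 0" if "h \<in> set (g # N)" for h
      unfolding sum using that c(2) by auto
    moreover have "\<exists>i\<in>I. c' i \<noteq> 0" using c(1) by (auto simp: c'_def)
    ultimately show ?thesis by blast
  qed
qed

definition scaled_squares :: "real \<Rightarrow> real poly list \<Rightarrow> kernel_rep" where
  "scaled_squares s P = map (\<lambda>f. (smult s f, f)) P"

lemma kern_scaled_squares [simp]: "kern (scaled_squares s P) u v = s * gram P u v"
  by (induction P) (simp_all add: scaled_squares_def algebra_simps)

lemma pairing_scaled_squares: "linear_fun l \<Longrightarrow> pairing l (scaled_squares s P) = s * (\<Sum>f\<leftarrow>P. (l f)\<^sup>2)"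
  by (induction P) (simp_all add: scaled_squares_def linear_fun_simps algebra_simps power2_eq_square)

lemma sum_list_squares_nonneg: "(\<Sum>f\<leftarrow>P. (l f)\<^sup>2) \<ge> (0 :: real)"
  by (induction P) auto

lemma sum_list_squares_eq_0:
  "\<forall>f\<in>set P. l f = 0 \<Longrightarrow> (\<Sum>f\<leftarrow>P. (l f)\<^sup>2) = (0 :: real)"
  by (induction P) auto

lemma sum_list_squares_le_0:
  "(\<Sum>f\<leftarrow>P. (l f)\<^sup>2) \<le> (0 :: real) \<Longrightarrow> \<forall>f\<in>set P. l f = 0"
proof (induction P)
  case (Cons g P)
  have "(\<Sum>f\<leftarrow>P. (l f)\<^sup>2) \<ge> 0" by (rule sum_list_squares_nonneg)
  moreover have "(l g)\<^sup>2 \<ge> 0" by simp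
  moreover have "(l g)\<^sup>2 + (\<Sum>f\<leftarrow>P. (l f)\<^sup>2) \<le> 0" using Cons.prems by simp
  ultimately have "(l g)\<^sup>2 = 0" "(\<Sum>f\<leftarrow>P. (l f)\<^sup>2) \<le> 0" by linarith+
  thus ?case using Cons.IH by simp
qed simp

text \<open>
Otherwise a nonzero combination of coefficient functionals kills \<open>P\<close> and \<open>N'\<close>. On it the first kernel
is a negative and the second a positive sum of squares, so it kills \<open>N\<close> as well, contradicting
the spanning property.
\<close>
lemma inertia_le:
  assumes eq: "\<And>y. finite {x. gram P x y - gram N x y \<noteq> gram P' x y - gram N' x y}"
    and spans: "spans S P N" and S: "finite S" "card S = length P + length N"
  shows "length N \<le> length N'"
proof (rule ccontr)
  assume "\<not> ?thesis"
  hence "card S > length (P @ N')" using S by simp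
  from nontrivial_combination[OF S(1) this, of "\<lambda>i f. coeff f i"]
  obtain c where c: "\<exists>i\<in>S. c i \<noteq> 0" "\<forall>f\<in>set P \<union> set N'. (\<Sum>i\<in>S. c i * coeff f i) = 0" by auto
  define l where "l f = (\<Sum>i\<in>S. c i * coeff f i)" for f :: "real poly"
  have l: "linear_fun l" by (simp add: linear_fun_def l_def sum.distrib sum_distrib_left algebra_simps)
  have "pairing l (scaled_squares 1 P @ scaled_squares (-1) N) = pairing l (scaled_squares 1 P' @ scaled_squares (-1) N')"
    by (rule pairing_cong[OF l]) (use eq in simp)
  moreover have "(\<Sum>f\<leftarrow>P. (l f)\<^sup>2) = 0" "(\<Sum>f\<leftarrow>N'. (l f)\<^sup>2) = 0"
    using c(2) by (auto simp: l_def intro!: sum_list_squares_eq_0)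
  ultimately have "(\<Sum>f\<leftarrow>N. (l f)\<^sup>2) \<le> 0"
    using sum_list_squares_nonneg[of l P'] by (simp add: pairing_scaled_squares[OF l])
  hence "\<forall>f\<in>set N. l f = 0" by (rule sum_list_squares_le_0)
  hence "\<forall>i\<in>S. l (monom 1 i) = 0"
    using spans l c(2) unfolding spans_def by (auto simp: l_def)
  moreover have "l (monom 1 i) = c i" if "i \<in> S" for i
    using that S(1) by (simp add: l_def if_distrib[of "(*) _"] cong: if_cong)
  ultimately show False using c(1) by simp
qed

lemma inertia:
  assumes eq: "\<And>y. finite {x. gram P x y - gram N x y \<noteq> gram P' x y - gram N' x y}"
    and spans: "spans S P N" and S: "finite S" "card S = length P + length N"
    and len: "length P + length N = length P' + length N'"
  shows "length N = length N'"
proof -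
  have "length N \<le> length N'" by (rule inertia_le[OF eq spans S])
  moreover have "length P \<le> length P'"
  proof (rule inertia_le[of N P N' P' S])
    show "finite {x. gram N x y - gram P x y \<noteq> gram N' x y - gram P' x y}" for y
      by (rule finite_subset[OF _ eq[of y]]) auto
    show "spans S N P" using spans by (simp add: spans_def Un_commute)
  qed (use S in auto)
  ultimately show ?thesis using len by linarith
qed

section \<open>From the zeros to the J-fraction\<close>

lemma hermite_rep_kernel_values:
  assumes "hermite_rep p P N" "x + y \<noteq> 0"
  shows "gram P x y - gram N x y = (poly p x * poly p y - poly p (- x) * poly p (- y)) / (x + y)"
  using assms by (simp add: hermite_rep_def field_simps)

text \<open>
The Hermite kernel of the stable polynomial \<open>r(x) = \<Prod> (x + a)\<close> is positive, and at the points \<open>a, b\<close> it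
is \<open>r(a) r(b) / (a + b)\<close> since \<open>r(-a) = 0\<close>.
\<close>
lemma cauchy_form_nonneg:
  fixes d :: "real \<Rightarrow> real"
  assumes W: "finite W" "\<And>a. a \<in> W \<Longrightarrow> a > 0"
  shows "(\<Sum>a\<in>W. \<Sum>b\<in>W. d a * d b / (a + b)) \<ge> 0"
proof -
  define r where "r = (\<Prod>a\<in>W. [:a, 1 :: real:])"
  have cr: "poly (cpoly r) z = (\<Prod>a\<in>W. z + of_real a)" for z
    unfolding r_def using W(1) by (induction W rule: finite_induct) (simp_all add: algebra_simps)
  have "stable r"
    unfolding stable_def
  proof (intro conjI allI impI)
    show "r \<noteq> 0" using W(1) by (simp add: r_def)
    fix z assume "poly (cpoly r) z = 0"
    then obtain a where "a \<in> W" "z + of_real a = 0" using W(1) by (auto simp: cr)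
    hence "z = - of_real a" by (simp add: eq_neg_iff_add_eq_0)
    thus "Re z < 0" using W(2)[OF \<open>a \<in> W\<close>] by simp
  qed
  then obtain P where P: "hermite_rep r P []" using stable_hermite_rep by blast
  have rp: "poly r a > 0" "poly r (- a) = 0" if "a \<in> W" for a
  proof -
    have "poly r x = (\<Prod>b\<in>W. x + b)" for x by (simp add: r_def poly_prod add.commute)
    thus "poly r a > 0" "poly r (- a) = 0" using that W by (auto intro!: prod_pos add_pos_pos)
  qed
  define t where "t a = d a / poly r a" for a
  have "d a * d b / (a + b) = (\<Sum>f\<leftarrow>P. (t a * poly f a) * (t b * poly f b))" if "a \<in> W" "b \<in> W" for a b
  proof -
    have "a + b > 0" using W(2) that by (simp add: add_pos_pos)
    hence "gram P a b = poly r a * poly r b / (a + b)"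
      using hermite_rep_kernel_values[OF P, of a b] rp(2) that by simp
    moreover have "(\<Sum>f\<leftarrow>P. (t a * poly f a) * (t b * poly f b)) = t a * t b * gram P a b"
      unfolding gram_def sum_list_const_mult[symmetric] by (simp add: mult_ac)
    ultimately show ?thesis using rp(1)[OF that(1)] rp(1)[OF that(2)] by (simp add: t_def)
  qed
  hence "(\<Sum>a\<in>W. \<Sum>b\<in>W. d a * d b / (a + b)) = (\<Sum>a\<in>W. \<Sum>b\<in>W. \<Sum>f\<leftarrow>P. (t a * poly f a) * (t b * poly f b))"
    by simp
  also have "\<dots> = (\<Sum>f\<leftarrow>P. (\<Sum>a\<in>W. t a * poly f a)\<^sup>2)"
    by (induction P) (simp_all add: sum.distrib power2_eq_square sum_product)
  also have "\<dots> \<ge> 0" by (rule sum_list_squares_nonneg)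
  finally show ?thesis .
qed

text \<open>
Differentiate the identity for \<open>(u - v)\<close> times the kernel with respect to \<open>u\<close> and put \<open>u = v\<close>.
\<close>
lemma bezout_rep_diagonal:
  assumes "bezout_rep f g ps"
  shows "kern ps v v = poly (pderiv f) v * poly g v - poly (pderiv g) v * poly f v"
proof -
  define A where "A = (\<Sum>(a, b)\<leftarrow>ps. smult (poly b v) a)"
  have A: "poly A x = kern ps x v" for x
    by (simp add: A_def kern_def poly_sum_list case_prod_unfold mult.commute)
  have "[:- v, 1:] * A = smult (poly g v) f - smult (poly f v) g"
  proof -
    have "poly ([:- v, 1:] * A) x = poly (smult (poly g v) f - smult (poly f v) g) x" for x
      using assms[unfolded bezout_rep_def, rule_format, of x v] by (simp add: A algebra_simps)
    thus ?thesis by (simp add: poly_eq_poly_eq_iff[symmetric] ext)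
  qed
  hence "poly (pderiv ([:- v, 1:] * A)) v = poly (pderiv (smult (poly g v) f - smult (poly f v) g)) v" by simp
  thus ?thesis
    by (simp add: pderiv_mult pderiv_diff pderiv_smult pderiv_pCons A algebra_simps del: mult_pCons_left)
qed

definition at_square :: "real poly \<Rightarrow> real poly" where
  "at_square a = pcompose a [:0, 0, 1:]"

lemma poly_at_square [simp]: "poly (at_square a) x = poly a (x\<^sup>2)"
  by (simp add: at_square_def poly_pcompose power2_eq_square)

lemma at_square_pCons: "at_square (pCons a p) = pCons a (pCons 0 (at_square p))"
  by (simp add: at_square_def pcompose_pCons)

lemma parts_at_square [simp]: "even_part (at_square a) = a" "odd_part (at_square a) = 0"
  by (induction a) (simp_all add: at_square_pCons parts_pCons, simp_all add: at_square_def)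

lemma at_square_parts: "p = at_square (even_part p) + pCons 0 (at_square (odd_part p))"
proof -
  have "poly p x = poly (at_square (even_part p) + pCons 0 (at_square (odd_part p))) x" for x
    using poly_parts[of p x] by simp
  thus ?thesis by (simp add: poly_eq_poly_eq_iff[symmetric] ext)
qed

lemma poly_pderiv_parts:
  "poly (pderiv p) x = 2 * x * poly (pderiv (even_part p)) (x\<^sup>2) + poly (odd_part p) (x\<^sup>2)
     + 2 * x\<^sup>2 * poly (pderiv (odd_part p)) (x\<^sup>2)"
proof -
  have "poly (pderiv (at_square a)) y = 2 * y * poly (pderiv a) (y\<^sup>2)" for a y
    by (simp add: at_square_def pderiv_pcompose poly_pcompose pderiv_pCons power2_eq_square)
  thus ?thesis
    by (subst at_square_parts) (simp add: pderiv_add pderiv_pCons power2_eq_square algebra_simps)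
qed

lemma parts_at_root:
  assumes "poly p a = 0"
  shows "poly (even_part p) (a\<^sup>2) = poly p (- a) / 2" "a * poly (odd_part p) (a\<^sup>2) = - poly p (- a) / 2"
  using assms poly_parts[of p a] poly_parts[of p "- a"] by auto

text \<open>
At the square of a zero \<open>a\<close> of \<open>p\<close> both parts are determined by \<open>p(-a)\<close>. The result is a Cauchy matrix
with a negative sign plus a diagonal matrix with entries \<open>p(-a) p'(a) / 4\<close>.
\<close>
lemma even_kernel_at_roots:
  assumes ps: "bezout_rep (pCons 0 (odd_part p)) (even_part p) ps"
    and a: "poly p a = 0" "a > 0" and b: "poly p b = 0" "b > 0"
  shows "kern ps (a\<^sup>2) (b\<^sup>2) = - (poly p (- a) * poly p (- b) / (a + b)) / 4
      + (if a = b then poly p (- a) * poly (pderiv p) a / 4 else 0)"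
proof (cases "a = b")
  case False
  let ?A = "poly p (- a)" and ?B = "poly p (- b)"
  have "(a\<^sup>2 - b\<^sup>2) * kern ps (a\<^sup>2) (b\<^sup>2)
      = a * (a * poly (odd_part p) (a\<^sup>2)) * poly (even_part p) (b\<^sup>2) - b * (b * poly (odd_part p) (b\<^sup>2)) * poly (even_part p) (a\<^sup>2)"
    using ps[unfolded bezout_rep_def, rule_format, of "a\<^sup>2" "b\<^sup>2"] by (simp add: algebra_simps power2_eq_square)
  also have "\<dots> = (a - b) * (- (?A * ?B) / 4)"
    unfolding parts_at_root[OF a(1)] parts_at_root[OF b(1)] by (simp add: field_simps)
  also have "a\<^sup>2 - b\<^sup>2 = (a - b) * (a + b)" by (simp add: algebra_simps power2_eq_square)
  finally have "(a - b) * ((a + b) * kern ps (a\<^sup>2) (b\<^sup>2)) = (a - b) * (- (?A * ?B) / 4)"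
    by (simp only: mult.assoc)
  hence "(a + b) * kern ps (a\<^sup>2) (b\<^sup>2) = - (?A * ?B) / 4"
    using False by (simp only: mult_cancel_left) simp
  thus ?thesis using False a b by (simp add: field_simps)
next
  case True
  define A where "A = poly p (- a)"
  define o' where "o' = poly (odd_part p) (a\<^sup>2)"
  have e: "poly (even_part p) (a\<^sup>2) = A / 2" and o: "a * o' = - A / 2"
    using parts_at_root[OF a(1)] by (simp_all add: A_def o'_def)
  have A: "A = - 2 * a * o'" using o by simp
  have "kern ps (a\<^sup>2) (a\<^sup>2) = (o' + a\<^sup>2 * poly (pderiv (odd_part p)) (a\<^sup>2)) * (A / 2)
      - poly (pderiv (even_part p)) (a\<^sup>2) * (a * (a * o'))"
    unfolding bezout_rep_diagonal[OF ps] e by (simp add: pderiv_pCons o'_def power2_eq_square)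
  also have "\<dots> = - (A * A / (a + a)) / 4 + A * poly (pderiv p) a / 4"
  proof -
    have 1: "A * A / (a + a) = 2 * a * o' * o'" unfolding A using a(2) by simp
    have 2: "(o' + a\<^sup>2 * X) * (A / 2) - Y * (a * (a * o'))
        = - (2 * a * o' * o') / 4 + A * (2 * a * Y + o' + 2 * a\<^sup>2 * X) / 4" for X Y
      unfolding A by (simp add: algebra_simps power2_eq_square)
    show ?thesis unfolding poly_pderiv_parts[of p a] o'_def[symmetric] 1 by (rule 2)
  qed
  finally show ?thesis by (simp add: True A_def)
qed

text \<open>
Suppose that the Bezout kernel is not positive at \<open>l\<close>. Combine \<open>l\<close>, acting on odd parts, with the
evaluations of even parts at \<open>a\<^sup>2\<close> for the positive zeros \<open>a\<close>. These are more functionals than the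
Hermite kernel has negative squares, so some nontrivial combination \<open>L\<close> kills all of these. The
Hermite kernel is then nonnegative at \<open>L\<close>, while the two kernels of which it is composed are
nonpositive, the second one strictly if an evaluation occurs. Hence \<open>L\<close> is a multiple of \<open>l\<close>
and kills all squares, and therefore all odd monomials.
\<close>
lemma root_form_imp_bezout_posdef:
  assumes rf: "root_form p Z q"
  shows "bezout_posdef (degree p div 2) (even_part p) (odd_part p)"
  unfolding bezout_posdef_def
proof (intro allI impI)
  fix ps l
  assume ps: "bezout_rep (even_part p) (odd_part p) ps" and l: "linear_fun l"
    and nz: "\<exists>i<degree p div 2. l (monom 1 i) \<noteq> 0"
  show "0 < pairing l ps"
  proof (rule ccontr)
    assume "\<not> 0 < pairing l ps"
    hence neg: "pairing l ps \<le> 0" by simp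
    define e where "e = (if 0 \<in> Z then 1 else 0 :: nat)"
    obtain P N where PN: "length N + e = card Z" "hermite_rep p P N" "spans {e..<degree p} P N"
      using root_form_hermite_rep[OF rf] unfolding e_def by blast
    define W where "W = Z - {0}"
    have fin: "finite W" and card: "card W = length N"
      using rf PN(1) by (auto simp: W_def e_def root_form_def card_Diff_singleton_if split: if_splits)
    have W: "a > 0" "poly p a = 0" "poly p (- a) * poly (pderiv p) a < 0" if "a \<in> W" for a
      using that rf by (force simp: W_def root_form_def poly_prod)+
    \<comment> \<open>\<open>None\<close> stands for \<open>l\<close> on odd parts, \<open>Some a\<close> for the evaluation of even parts at \<open>a\<^sup>2\<close>\<close>
    define M where "M i f = (case i of None \<Rightarrow> l (odd_part f) | Some a \<Rightarrow> poly (even_part f) (a\<^sup>2))" for i f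
    define I where "I = insert None (Some ` W)"
    have "card I > length N" "finite I" using fin card by (simp_all add: I_def card_image)
    from nontrivial_combination[OF this(2,1), of M]
    obtain c where c: "\<exists>i\<in>I. c i \<noteq> 0" "\<forall>g\<in>set N. (\<Sum>i\<in>I. c i * M i g) = 0" by blast
    define t where "t = c None"
    define E where "E f = (\<Sum>a\<in>W. c (Some a) * poly f (a\<^sup>2))" for f
    define L where "L f = t * l (odd_part f) + E (even_part f)" for f
    have sumI: "(\<Sum>i\<in>I. c i * M i g) = L g" for g
      unfolding I_def L_def E_def t_def using fin by (subst sum.insert) (auto simp: M_def sum.reindex)
    have Elin: "linear_fun E" by (simp add: linear_fun_def E_def sum.distrib sum_distrib_left algebra_simps)
    have L: "linear_fun L"
      using l Elin by (simp add: linear_fun_def L_def parts_linear algebra_simps)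
    have LN: "\<forall>g\<in>set N. L g = 0" using c(2) by (simp add: sumI)
    have "coeff (pCons 0 (odd_part p)) i = 0" "coeff (even_part p) i = 0" if "i > Suc (degree p)" for i
      using that by (cases i; simp add: coeff_eq_0)+
    then obtain ps2 where ps2: "bezout_rep (pCons 0 (odd_part p)) (even_part p) ps2"
      using bezout_rep_exists by blast
    define qs where "qs = map (\<lambda>(a, b). (smult 2 (pCons 0 (at_square a)), pCons 0 (at_square b))) ps"
    define qs2 where "qs2 = map (\<lambda>(a, b). (smult 2 (at_square a), at_square b)) ps2"
    have kq: "kern qs x y = 2 * x * y * kern ps (x\<^sup>2) (y\<^sup>2)" for x y
      unfolding qs_def by (induction ps) (auto simp: algebra_simps)
    have kq2: "kern qs2 x y = 2 * kern ps2 (x\<^sup>2) (y\<^sup>2)" for x y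
      unfolding qs2_def by (induction ps2) (auto simp: algebra_simps)
    have lq: "pairing L qs = 2 * t\<^sup>2 * pairing l ps"
      unfolding qs_def
      by (induction ps) (auto simp: algebra_simps L_def parts_pCons parts_linear power2_eq_square
          linear_fun_simps(2,3)[OF l] linear_fun_simps(3)[OF Elin])
    have lq2: "pairing L qs2 = 2 * pairing E ps2"
      unfolding qs2_def using linear_fun_simps(3)[OF l] linear_fun_simps(2)[OF L]
      by (induction ps2) (auto simp: algebra_simps L_def)
    have "pairing L (scaled_squares 1 P @ scaled_squares (-1) N) = pairing L (qs @ qs2)"
    proof (rule pairing_cong[OF L])
      fix y
      have "kern (scaled_squares 1 P @ scaled_squares (-1) N) x y = kern (qs @ qs2) x y" if "x \<noteq> y" "x \<noteq> - y" for x y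
      proof -
        have "(x - y) * (x + y) * kern (qs @ qs2) x y
            = 2 * x * y * ((x\<^sup>2 - y\<^sup>2) * kern ps (x\<^sup>2) (y\<^sup>2)) + 2 * ((x\<^sup>2 - y\<^sup>2) * kern ps2 (x\<^sup>2) (y\<^sup>2))"
          by (simp add: kq kq2 algebra_simps power2_eq_square)
        also have "\<dots> = (x - y) * (poly p x * poly p y - poly p (- x) * poly p (- y))"
          unfolding ps[unfolded bezout_rep_def, rule_format] ps2[unfolded bezout_rep_def, rule_format]
            poly_parts[of p x] poly_parts[of p y] poly_parts[of p "- x"] poly_parts[of p "- y"]
          by (simp add: algebra_simps power2_eq_square)
        also have "\<dots> = (x - y) * (x + y) * kern (scaled_squares 1 P @ scaled_squares (-1) N) x y"
          using PN(2)[unfolded hermite_rep_def, rule_format, of x y] by (simp add: mult.assoc)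
        finally show ?thesis using that by (simp add: eq_neg_iff_add_eq_0)
      qed
      hence "{x. kern (scaled_squares 1 P @ scaled_squares (-1) N) x y \<noteq> kern (qs @ qs2) x y} \<subseteq> {y, - y}" by blast
      thus "finite {x. kern (scaled_squares 1 P @ scaled_squares (-1) N) x y \<noteq> kern (qs @ qs2) x y}"
        by (rule finite_subset) simp
    qed
    hence total: "(\<Sum>f\<leftarrow>P. (L f)\<^sup>2) = 2 * t\<^sup>2 * pairing l ps + 2 * pairing E ps2"
      using sum_list_squares_eq_0[OF LN] by (simp add: pairing_scaled_squares[OF L] lq lq2)
    define D where "D a = c (Some a) * poly p (- a)" for a
    have E2: "pairing E ps2 = - (\<Sum>a\<in>W. \<Sum>b\<in>W. D a * D b / (a + b)) / 4
        + (\<Sum>a\<in>W. (c (Some a))\<^sup>2 * (poly p (- a) * poly (pderiv p) a)) / 4"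
    proof -
      have "pairing E ps2 = (\<Sum>a\<in>W. \<Sum>b\<in>W. c (Some a) * c (Some b) * kern ps2 (a\<^sup>2) (b\<^sup>2))"
        by (induction ps2) (auto simp: E_def sum.distrib sum_product algebra_simps)
      also have "\<dots> = (\<Sum>a\<in>W. \<Sum>b\<in>W. - (D a * D b / (a + b)) / 4
          + (if a = b then (c (Some a))\<^sup>2 * (poly p (- a) * poly (pderiv p) a) / 4 else 0))"
      proof (intro sum.cong refl)
        fix a b assume "a \<in> W" "b \<in> W"
        note kern = even_kernel_at_roots[OF ps2 W(2,1)[OF this(1)] W(2,1)[OF this(2)]]
        show "c (Some a) * c (Some b) * kern ps2 (a\<^sup>2) (b\<^sup>2) = - (D a * D b / (a + b)) / 4
          + (if a = b then (c (Some a))\<^sup>2 * (poly p (- a) * poly (pderiv p) a) / 4 else 0)"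
          unfolding kern by (cases "a = b") (simp_all add: D_def power2_eq_square algebra_simps)
      qed
      also have "\<dots> = - (\<Sum>a\<in>W. \<Sum>b\<in>W. D a * D b / (a + b)) / 4
        + (\<Sum>a\<in>W. (c (Some a))\<^sup>2 * (poly p (- a) * poly (pderiv p) a)) / 4"
        using fin by (simp add: sum.distrib sum_subtractf sum_negf sum_divide_distrib)
      finally show ?thesis .
    qed
    have cauchy: "(\<Sum>a\<in>W. \<Sum>b\<in>W. D a * D b / (a + b)) \<ge> 0"
      by (rule cauchy_form_nonneg[OF fin]) (rule W(1))
    have diag_term: "(c (Some a))\<^sup>2 * (poly p (- a) * poly (pderiv p) a) \<le> 0" if "a \<in> W" for a
      using W(3)[OF that] by (simp add: mult_nonneg_nonpos)
    hence diag: "(\<Sum>a\<in>W. (c (Some a))\<^sup>2 * (poly p (- a) * poly (pderiv p) a)) \<le> 0"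
      by (rule sum_nonpos)
    have "t\<^sup>2 * pairing l ps \<le> 0" using neg by (simp add: mult_nonneg_nonpos)
    hence LP: "(\<Sum>f\<leftarrow>P. (L f)\<^sup>2) \<le> 0"
      and "(\<Sum>a\<in>W. (c (Some a))\<^sup>2 * (poly p (- a) * poly (pderiv p) a)) = 0"
      using total E2 cauchy diag sum_list_squares_nonneg[of L P] by linarith+
    hence "\<forall>a\<in>W. (c (Some a))\<^sup>2 * (poly p (- a) * poly (pderiv p) a) = 0"
      using sum_nonneg_eq_0_iff[OF fin, of "\<lambda>a. - ((c (Some a))\<^sup>2 * (poly p (- a) * poly (pderiv p) a))"] diag_term
      by (simp add: sum_negf)
    hence c0: "c (Some a) = 0" if "a \<in> W" for a using that W(3)[OF that] by auto
    hence "t \<noteq> 0" using c(1) by (auto simp: I_def t_def)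
    have "\<forall>f\<in>set P \<union> set N. L f = 0" using LN sum_list_squares_le_0[OF LP] by blast
    hence kill: "\<forall>i\<in>{e..<degree p}. L (monom 1 i) = 0" using PN(3) L unfolding spans_def by blast
    obtain i where i: "i < degree p div 2" "l (monom 1 i) \<noteq> 0" using nz by blast
    \<comment> \<open>the odd monomials below the degree are exactly what \<open>l\<close> sees below \<open>degree p div 2\<close>\<close>
    have "2 * i + 1 \<in> {e..<degree p}" using i(1) by (auto simp: e_def)
    hence "L (monom 1 (2 * i + 1)) = 0" using kill by blast
    moreover have "odd_part (monom 1 (2 * i + 1)) = monom 1 i" by (rule poly_eqI) auto
    ultimately show False using \<open>t \<noteq> 0\<close> i(2) by (simp add: L_def E_def c0)
  qed
qed

text \<open>
Replacing \<open>f\<close> by \<open>f + u g\<close> adds \<open>g(u) g(v)\<close> to the Bezout kernel.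
\<close>
lemma bezout_posdef_add_shift:
  assumes pd: "bezout_posdef d f g" and g: "coeff g d \<noteq> 0" "\<And>i. i > d \<Longrightarrow> coeff g i = 0" and f: "\<And>i. i > d \<Longrightarrow> coeff f i = 0"
  shows "bezout_posdef (Suc d) (f + pCons 0 g) g"
  unfolding bezout_posdef_def
proof (intro allI impI)
  fix ps l
  assume ps: "deg_bounded (Suc d) ps" "bezout_rep (f + pCons 0 g) g ps" and l: "linear_fun l" "\<exists>i<Suc d. l (monom 1 i) \<noteq> 0"
  obtain qs where qs: "deg_bounded d qs" "bezout_rep f g qs"
    using bezout_rep_exists[of d f g] f g by blast
  have "pairing l ps = pairing l ((g, g) # qs)"
  proof (rule pairing_cong[OF l(1)])
    fix y
    have "kern ps x y = kern ((g, g) # qs) x y" if "x \<noteq> y" for x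
    proof -
      have "(x - y) * kern ((g, g) # qs) x y = (x - y) * poly g x * poly g y + (x - y) * kern qs x y"
        by (simp add: algebra_simps)
      also have "\<dots> = (x - y) * kern ps x y"
        unfolding ps(2)[unfolded bezout_rep_def, rule_format] qs(2)[unfolded bezout_rep_def, rule_format]
        by (simp add: algebra_simps)
      finally show ?thesis using that by simp
    qed
    hence "{x. kern ps x y \<noteq> kern ((g, g) # qs) x y} \<subseteq> {y}" by blast
    thus "finite {x. kern ps x y \<noteq> kern ((g, g) # qs) x y}" by (rule finite_subset) simp
  qed
  also have "\<dots> > 0"
  proof (cases "\<exists>i<d. l (monom 1 i) \<noteq> 0")
    case True
    hence "pairing l qs > 0" using pd qs l(1) unfolding bezout_posdef_def by blast
    thus ?thesis by (simp add: add_nonneg_pos)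
  next
    case False
    hence "l (monom 1 d) \<noteq> 0" using l(2) by (metis less_Suc_eq)
    moreover have "l g = (\<Sum>i<Suc d. coeff g i * l (monom 1 i))"
      by (rule linear_fun_expand[OF l(1)]) (use g in simp)
    ultimately have "l g \<noteq> 0" using False g(1) by simp
    hence "l g * l g > 0" by (simp add: zero_less_mult_iff linorder_neq_iff disj_commute)
    moreover have "pairing l qs = pairing (\<lambda>_. 0) qs"
      by (rule pairing_cong_deg_bounded[OF qs(1) l(1)]) (use False in \<open>auto simp: linear_fun_def\<close>)
    moreover have "pairing (\<lambda>_. 0) qs = 0" by (simp add: pairing_def case_prod_unfold)
    ultimately show ?thesis by simp
  qed
  finally show "0 < pairing l ps" .
qed

proposition root_form_imp_J_fraction:
  assumes rf: "root_form p Z q" and p: "lead_coeff p > 0"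
  shows "\<exists>c>0. \<exists>xs. J_fraction c (J_num p) (odd_part p) xs \<and> length xs = J_len p"
proof -
  have "bezout_posdef (J_len p) (J_num p) (odd_part p)"
  proof (cases "even (degree p)")
    case True
    hence "J_len p = degree p div 2" by (auto elim: evenE)
    thus ?thesis using root_form_imp_bezout_posdef[OF rf] True by (simp add: J_num_def)
  next
    case False
    then obtain d where d: "degree p = 2 * d + 1" by (auto elim: oddE)
    have "bezout_posdef (Suc d) (even_part p + pCons 0 (odd_part p)) (odd_part p)"
    proof (rule bezout_posdef_add_shift)
      show "bezout_posdef d (even_part p) (odd_part p)" using root_form_imp_bezout_posdef[OF rf] d by simp
      show "coeff (odd_part p) d \<noteq> 0" using p d by simp
    qed (auto simp: d coeff_eq_0)
    thus ?thesis using d by (simp add: J_num_def)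
  qed
  thus ?thesis using J_num_coeffs[OF p] p by (intro bezout_posdef_imp_J_fraction) auto
qed

section \<open>From the J-fraction to the zeros\<close>

text \<open>
For odd degree the first quotient has \<open>b = 1\<close>, so \<open>e = f - u o = a o - h\<close>, and the Bezout kernel of \<open>e\<close>
and \<open>o\<close> is the one of the next pair \<open>(o, h)\<close>, with one square less. The second kernel does not see
the added \<open>u o(u)\<close>.
\<close>
lemma J_fraction_even_odd_parts:
  assumes p: "degree p \<ge> 1" "lead_coeff p > 0"
    and jf: "c > 0" "J_fraction c (J_num p) (odd_part p) xs" "length xs = J_len p"
  shows "Im u \<ge> 0 \<Longrightarrow> Im (poly (cpoly (even_part p)) u * cnj (poly (cpoly (odd_part p)) u)) \<ge> 0" (is "_ \<Longrightarrow> ?Im")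
    and "poly (pderiv (even_part p)) x * poly (odd_part p) x - poly (pderiv (odd_part p)) x * poly (even_part p) x \<ge> 0" (is ?W)
    and "poly (cpoly (even_part p)) u \<noteq> 0 \<or> poly (cpoly (odd_part p)) u \<noteq> 0" (is ?C)
    and "\<exists>fs Q. length fs = length xs \<and> length Q = degree p div 2 \<and>
      (\<forall>u v. (u - v) * gram Q u v = poly (even_part p) u * poly (odd_part p) v - poly (odd_part p) u * poly (even_part p) v) \<and>
      (\<forall>u v. (u - v) * tridiagonal (map snd xs) fs u v
          = u * poly (odd_part p) u * poly (even_part p) v - v * poly (odd_part p) v * poly (even_part p) u)" (is ?K)
proof -
  let ?e = "even_part p" and ?o = "odd_part p"
  have "(Im u \<ge> 0 \<longrightarrow> ?Im) \<and> ?W \<and> ?C \<and> ?K"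
  proof (cases "even (degree p)")
    case True
    hence eq: "J_num p = ?e" "J_len p = degree p div 2" by (auto simp: J_num_def elim: evenE)
    note jf' = jf(2)[unfolded eq(1)]
    have "?Im" if "Im u \<ge> 0" by (rule J_fraction_Im_nonneg[OF jf' that])
    moreover have ?W by (rule J_fraction_wronskian_nonneg[OF jf'])
    moreover have ?C by (rule J_fraction_no_common_root[OF jf' jf(1)])
    moreover have ?K
    proof -
      obtain fs Q where "length fs = length xs" "length Q = length xs"
        "\<forall>u v. (u - v) * gram Q u v = poly ?e u * poly ?o v - poly ?o u * poly ?e v"
        "\<forall>u v. (u - v) * tridiagonal (map snd xs) fs u v = u * poly ?o u * poly ?e v - v * poly ?o v * poly ?e u"
        using J_fraction_kernels[OF jf'] by blast
      thus ?thesis using jf(3) eq(2) by (intro exI[of _ fs] exI[of _ Q]) simp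
    qed
    ultimately show ?thesis by blast
  next
    case False
    then obtain d where d: "degree p = 2 * d + 1" by (auto elim: oddE)
    from jf(2) show ?thesis
    proof (cases rule: J_fraction.cases)
      case base
      thus ?thesis using jf(3) d by simp
    next
      case (step h xs' b a)
      note jf' = \<open>J_fraction c ?o h xs'\<close>
      have len: "length xs' = d" using jf(3) d step(2) by simp
      have num: "J_num p = [:a, b:] * ?o - h" by (rule step(1))
      have "lead_coeff p = b * lead_coeff p"
      proof -
        have "coeff (J_num p) (Suc d) = b * coeff ?o d"
        proof -
          have "coeff ?o (Suc d) = 0" "coeff h (Suc d) = 0"
            using J_fraction_coeffs[OF jf' jf(1)] unfolding len by (blast intro: lessI le_SucI)+
          thus ?thesis by (simp add: num del: coeff_odd_part)
        qed
        thus ?thesis using J_num_coeffs(1)[OF p(2)] d by simp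
      qed
      hence b: "b = 1" using p by auto
      have "J_num p = ?e + pCons 0 ?o" using False by (simp add: J_num_def)
      hence e: "?e = smult a ?o - h" using num b by simp
      have Im: ?Im if "Im u \<ge> 0"
      proof -
        let ?O = "poly (cpoly ?o) u" and ?H = "poly (cpoly h) u"
        have "Im (poly (cpoly ?e) u * cnj ?O) = Im (?O * cnj ?H)"
          unfolding e by (simp add: algebra_simps)
        thus ?thesis using J_fraction_Im_nonneg[OF jf' that] by simp
      qed
      have W: ?W
        using J_fraction_wronskian_nonneg[OF jf', of x] unfolding e by (simp add: pderiv_diff pderiv_smult algebra_simps)
      have C: ?C using J_fraction_no_common_root[OF jf' jf(1), of u] unfolding e by auto
      obtain Q where Q: "length Q = length xs'" "\<And>u v. (u - v) * gram Q u v = poly ?o u * poly h v - poly h u * poly ?o v"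
        using J_fraction_kernels[OF jf'] by blast
      obtain fs where fs: "length fs = length xs" "\<And>u v. (u - v) * tridiagonal (map snd xs) fs u v
          = u * poly ?o u * poly (J_num p) v - v * poly ?o v * poly (J_num p) u"
        using J_fraction_kernels[OF jf(2)] by blast
      have "(u - v) * gram Q u v = poly ?e u * poly ?o v - poly ?o u * poly ?e v" for u v
        unfolding Q(2) e by (simp add: algebra_simps)
      moreover have "(u - v) * tridiagonal (map snd xs) fs u v = u * poly ?o u * poly ?e v - v * poly ?o v * poly ?e u" for u v
        unfolding fs(2) num e b by (simp add: algebra_simps)
      moreover have "length Q = degree p div 2" using Q(1) len d by simp
      ultimately have ?K using fs(1) by blast
      thus ?thesis using Im W C by blast
    qed
  qed
  thus "Im u \<ge> 0 \<Longrightarrow> ?Im" ?W ?C ?K by blast+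
qed

lemma prod_linear_dvd:
  fixes p :: "real poly"
  assumes "finite Z" "\<And>a. a \<in> Z \<Longrightarrow> poly p a = 0"
  shows "(\<Prod>a\<in>Z. [:- a, 1:]) dvd p"
  using assms
proof (induction Z rule: finite_induct)
  case (insert a Z)
  then obtain k where k: "p = (\<Prod>a\<in>Z. [:- a, 1:]) * k" by (auto elim: dvdE)
  have "poly (\<Prod>a\<in>Z. [:- a, 1:]) a \<noteq> 0" using insert.hyps by (auto simp: poly_prod)
  hence "poly k a = 0" using insert.prems[of a] k by simp
  hence "[:- a, 1:] dvd k" by (simp add: poly_eq_0_iff_dvd)
  hence "(\<Prod>a\<in>Z. [:- a, 1:]) * [:- a, 1:] dvd p" unfolding k by (rule mult_dvd_mono[OF dvd_refl])
  thus ?case using insert.hyps by (simp add: mult.commute del: mult_pCons_left mult_pCons_right)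
qed simp

text \<open>
At a zero \<open>w\<close> one has \<open>e(w\<^sup>2) = - w o(w\<^sup>2)\<close>. If \<open>w\<close> had positive imaginary and nonnegative real part, this
would contradict the inequality in the upper half-plane. At a real zero \<open>a \<ge> 0\<close> the identity
\<open>o p'(a) = 2 a (e' o - o' e) + o\<^sup>2\<close> (with the parts taken at \<open>a\<^sup>2\<close>) gives \<open>o p'(a) > 0\<close>, and
\<open>p(-a) = - 2 a o\<close>.
\<close>
lemma J_fraction_imp_root_form:
  assumes p: "degree p \<ge> 1" "lead_coeff p > 0"
    and jf: "c > 0" "J_fraction c (J_num p) (odd_part p) xs" "length xs = J_len p"
  shows "\<exists>Z q. root_form p Z q"
proof -
  note F = J_fraction_even_odd_parts[OF p jf]
  define Z where "Z = {a. 0 \<le> a \<and> poly p a = 0}"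
  have p0: "p \<noteq> 0" using p by auto
  have fin: "finite Z" unfolding Z_def by (rule finite_subset[OF _ poly_roots_finite[OF p0]]) auto
  have simple: "poly (odd_part p) (a\<^sup>2) * poly (pderiv p) a > 0"
    and even: "poly (even_part p) (a\<^sup>2) = - a * poly (odd_part p) (a\<^sup>2)" if "a \<in> Z" for a
  proof -
    let ?o = "poly (odd_part p) (a\<^sup>2)" and ?e = "poly (even_part p) (a\<^sup>2)"
    let ?o' = "poly (pderiv (odd_part p)) (a\<^sup>2)" and ?e' = "poly (pderiv (even_part p)) (a\<^sup>2)"
    show e: "?e = - a * ?o" using that poly_parts[of p a] by (simp add: Z_def)
    have "?o \<noteq> 0"
      using F(3)[of "of_real (a\<^sup>2)"] e by (auto simp del: of_real_power)
    have "?o * poly (pderiv p) a = 2 * a * (?e' * ?o - ?o' * ?e) + ?o\<^sup>2"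
      unfolding poly_pderiv_parts[of p a] e by (simp add: algebra_simps power2_eq_square)
    moreover have "2 * a * (?e' * ?o - ?o' * ?e) \<ge> 0"
      using F(2)[of "a\<^sup>2"] that by (simp add: Z_def)
    moreover have "?o\<^sup>2 > 0" using \<open>?o \<noteq> 0\<close> by simp
    ultimately show "?o * poly (pderiv p) a > 0" by linarith
  qed
  have real_root: "z \<in> of_real ` Z" if z: "poly (cpoly p) z = 0" "Re z \<ge> 0" for z
  proof -
    have im: "Im w \<le> 0" if w: "poly (cpoly p) w = 0" "Re w \<ge> 0" for w
    proof (rule ccontr)
      assume "\<not> Im w \<le> 0"
      hence pos: "Im w > 0" by simp
      let ?E = "poly (cpoly (even_part p)) (w\<^sup>2)" and ?O = "poly (cpoly (odd_part p)) (w\<^sup>2)"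
      have E: "?E = - w * ?O" using w(1) poly_cpoly_parts[of p w] by (simp add: eq_neg_iff_add_eq_0)
      have "Im (w\<^sup>2) \<ge> 0" using w(2) pos by (simp add: power2_eq_square)
      from F(1)[OF this] have "Im w * ((Re ?O)\<^sup>2 + (Im ?O)\<^sup>2) \<le> 0"
        unfolding E by (simp add: algebra_simps power2_eq_square)
      hence "(Re ?O)\<^sup>2 + (Im ?O)\<^sup>2 \<le> 0" using pos by (simp add: mult_le_0_iff)
      hence "?O = 0" by (simp add: complex_eq_iff sum_power2_le_zero_iff)
      thus False using F(3)[of "w\<^sup>2"] E by simp
    qed
    have "Im z = 0"
      using im[OF z] im[of "cnj z"] z by (simp add: poly_cpoly_cnj)
    hence "z = of_real (Re z)" by (simp add: complex_eq_iff)
    moreover have "poly p (Re z) = 0" using z(1) calculation by (metis poly_cpoly_of_real of_real_eq_0_iff)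
    ultimately show ?thesis using z(2) by (auto simp: Z_def)
  qed
  obtain q where q: "p = (\<Prod>a\<in>Z. [:- a, 1:]) * q"
    using prod_linear_dvd[OF fin, of p] by (auto simp: Z_def elim: dvdE)
  have "stable q"
    unfolding stable_def
  proof (intro conjI allI impI)
    show "q \<noteq> 0" using q p0 by auto
    fix z assume z: "poly (cpoly q) z = 0"
    show "Re z < 0"
    proof (rule ccontr)
      assume "\<not> Re z < 0"
      hence "z \<in> of_real ` Z" using real_root z by (simp add: q)
      then obtain a where a: "a \<in> Z" "z = of_real a" by blast
      have "poly q a = 0" using z a by simp
      moreover have "poly (\<Prod>a\<in>Z. [:- a, 1:]) a = 0" using a fin by (auto simp: poly_prod)
      ultimately have "poly (pderiv p) a = 0" unfolding q by (simp add: pderiv_mult)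
      thus False using simple[OF a(1)] by simp
    qed
  qed
  moreover have "poly p (- a) * poly (pderiv p) a < 0" if "a \<in> Z" "0 < a" for a
  proof -
    have "poly p (- a) = - 2 * a * poly (odd_part p) (a\<^sup>2)"
      using poly_parts[of p "- a"] even[OF that(1)] by simp
    hence "poly p (- a) * poly (pderiv p) a = - (2 * a * (poly (odd_part p) (a\<^sup>2) * poly (pderiv p) a))"
      by simp
    also have "\<dots> < 0" using mult_pos_pos[OF that(2) simple[OF that(1)]] by (simp add: mult_ac)
    finally show ?thesis .
  qed
  moreover have "\<forall>a\<in>Z. 0 \<le> a" by (simp add: Z_def)
  ultimately have "root_form p Z q"
    unfolding root_form_def using fin q by blast
  thus ?thesis by blast
qed

section \<open>The number of zeros in the right half-plane\<close>

lemma root_form_at_0: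
  assumes "root_form p Z q"
  shows "poly p 0 = 0 \<longleftrightarrow> 0 \<in> Z"
proof -
  have "finite Z" "p = (\<Prod>a\<in>Z. [:- a, 1:]) * q" "stable q" using assms by (auto simp: root_form_def)
  moreover have "poly q 0 \<noteq> 0" using \<open>stable q\<close> poly_cpoly_of_real[of q 0] by (force simp: stable_def)
  ultimately show ?thesis by (simp add: poly_prod)
qed

text \<open>
Both diagonalisations of the Hermite kernel consist of \<open>deg p - z\<close> squares; comparing the negative
ones gives the count. The bound on the order comes for free, since the tridiagonal form has only
\<open>(deg p + 1) div 2\<close> variables.
\<close>
proposition root_form_card:
  assumes p: "degree p \<ge> 1" "lead_coeff p > 0"
    and jf: "c > 0" "J_fraction c (J_num p) (odd_part p) xs" "length xs = J_len p"
    and rf: "root_form p Z q"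
  defines "z \<equiv> (if poly p 0 = 0 then 1 else 0 :: nat)"
  shows "card Z = frobenius_changes (continuants (map snd xs) (Suc (J_len p) - z)) + z \<and> card Z \<le> J_len p"
proof -
  obtain P N where PN: "length P + length N + z = degree p" "length N + z = card Z"
      "hermite_rep p P N" "spans {z..<degree p} P N"
    using root_form_hermite_rep[OF rf] root_form_at_0[OF rf] unfolding z_def by auto
  have "poly (J_num p) 0 = poly p 0" using poly_parts[of p 0] by (simp add: J_num_def)
  hence z: "z = (if continuant (map snd xs) = 0 then 1 else 0)"
    using J_fraction_at_0[OF jf(2)] jf(1) by (auto simp: z_def)
  obtain fs Q where fQ: "length fs = length xs" "length Q = degree p div 2"
      "\<And>u v. (u - v) * gram Q u v = poly (even_part p) u * poly (odd_part p) v - poly (odd_part p) u * poly (even_part p) v"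
      "\<And>u v. (u - v) * tridiagonal (map snd xs) fs u v
          = u * poly (odd_part p) u * poly (even_part p) v - v * poly (odd_part p) v * poly (even_part p) u"
    using J_fraction_even_odd_parts(4)[OF p jf] by blast
  obtain P2 N2 where PN2: "\<And>u v. tridiagonal (map snd xs) fs u v = gram P2 u v - gram N2 u v"
      "length P2 + length N2 + z = length xs" "length N2 = frobenius_changes (continuants (map snd xs) (Suc (length xs) - z))"
    using tridiagonal_diagonalise[of fs "map snd xs"] fQ(1) unfolding z by auto
  define ev od where "ev = map (\<lambda>f. smult (sqrt 2) (at_square f))" and "od = map (\<lambda>f. smult (sqrt 2) (pCons 0 (at_square f)))"
  have sqrt2: "sqrt 2 * (sqrt 2 * x) = 2 * x" for x by (simp flip: mult.assoc)
  have ev: "gram (ev R) x y = 2 * gram R (x\<^sup>2) (y\<^sup>2)" for R x y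
    unfolding ev_def by (induction R) (simp_all add: sqrt2 mult_ac distrib_left)
  have od: "gram (od R) x y = 2 * x * y * gram R (x\<^sup>2) (y\<^sup>2)" for R x y
    unfolding od_def by (induction R) (simp_all add: sqrt2 mult_ac distrib_left)
  have "length N = length (ev N2)"
  proof (rule inertia)
    fix y
    have "gram P x y - gram N x y = gram (ev P2 @ od Q) x y - gram (ev N2) x y" if "x \<noteq> y" "x \<noteq> - y" for x
    proof -
      have "(x - y) * (x + y) * (gram (ev P2 @ od Q) x y - gram (ev N2) x y)
         = 2 * ((x\<^sup>2 - y\<^sup>2) * tridiagonal (map snd xs) fs (x\<^sup>2) (y\<^sup>2)) + 2 * x * y * ((x\<^sup>2 - y\<^sup>2) * gram Q (x\<^sup>2) (y\<^sup>2))"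
        unfolding PN2(1) by (simp add: ev od algebra_simps power2_eq_square)
      also have "\<dots> = (x - y) * (poly p x * poly p y - poly p (- x) * poly p (- y))"
        unfolding fQ(3,4) poly_parts[of p x] poly_parts[of p y] poly_parts[of p "- x"] poly_parts[of p "- y"]
        by (simp add: algebra_simps power2_eq_square)
      also have "\<dots> = (x - y) * (x + y) * (gram P x y - gram N x y)"
        using PN(3)[unfolded hermite_rep_def, rule_format, of x y] by (simp add: mult.assoc)
      finally show ?thesis using that by (simp add: eq_neg_iff_add_eq_0)
    qed
    hence "{x. gram P x y - gram N x y \<noteq> gram (ev P2 @ od Q) x y - gram (ev N2) x y} \<subseteq> {y, - y}" by blast
    thus "finite {x. gram P x y - gram N x y \<noteq> gram (ev P2 @ od Q) x y - gram (ev N2) x y}"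
      by (rule finite_subset) simp
  next
    show "spans {z..<degree p} P N" by (rule PN(4))
    show "card {z..<degree p} = length P + length N" using PN(1) by simp
    have "degree p = J_len p + degree p div 2" by presburger
    thus "length P + length N = length (ev P2 @ od Q) + length (ev N2)"
      using PN(1) PN2(2) fQ(2) jf(3) by (simp add: ev_def od_def)
  qed simp
  hence "length N = length N2" by (simp add: ev_def)
  thus ?thesis using PN(2) PN2(2,3) jf(3) by simp
qed

section \<open>Parity of the number of zeros on an interval\<close>

lemma mult_neg_pos_iff: "a < 0 \<Longrightarrow> b \<noteq> 0 \<Longrightarrow> 0 < a * b \<longleftrightarrow> \<not> 0 < b" for a b :: real
  by (auto simp: zero_less_mult_iff)

lemma pos_beyond_roots:
  fixes r :: "real poly"
  assumes "r \<noteq> 0" "\<And>x. x \<ge> c \<Longrightarrow> poly r x \<noteq> 0"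
  shows "lead_coeff r * poly r c > 0"
proof -
  have main: "poly r c > 0" if r: "lead_coeff r > 0" "\<And>x. x \<ge> c \<Longrightarrow> poly r x \<noteq> 0" for r :: "real poly"
  proof (rule ccontr)
    assume "\<not> poly r c > 0"
    hence neg: "poly r c < 0" using r(2)[of c] by simp
    obtain M where M: "\<And>x. x \<ge> M \<Longrightarrow> poly r x \<ge> lead_coeff r"
      using poly_pinfty_gt_lc[OF r(1)] by blast
    have "poly r (max M (c + 1)) > 0" using M[of "max M (c + 1)"] r(1) by simp
    moreover have "c < max M (c + 1)" by simp
    ultimately obtain x where "x > c" "poly r x = 0"
      using poly_IVT_pos[OF _ neg] by blast
    thus False using r(2)[of x] by simp
  qed
  consider "lead_coeff r > 0" | "lead_coeff r < 0" using assms(1) by (metis leading_coeff_0_iff linorder_neqE_linordered_idom)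
  thus ?thesis
  proof cases
    case 1
    thus ?thesis using main[of r] assms(2) by simp
  next
    case 2
    have "poly (- r) c > 0" by (rule main) (use 2 assms(2) in auto)
    thus ?thesis using 2 by (simp add: mult_neg_neg)
  qed
qed

lemma real_zeros_in_mult:
  "a \<noteq> 0 \<Longrightarrow> b \<noteq> 0 \<Longrightarrow> real_zeros_in (a * b) S = real_zeros_in a S + real_zeros_in b S"
  by (simp add: real_zeros_in_def proots_mult)

lemma real_zeros_in_linear: "real_zeros_in [:- r, 1:] S = (if r \<in> S then 1 else 0)"
  by (simp add: real_zeros_in_def)

lemma real_zeros_in_no_roots:
  assumes "p \<noteq> 0" "\<And>x. x \<in> S \<Longrightarrow> poly p x \<noteq> 0"
  shows "real_zeros_in p S = 0"
proof -
  have "filter_mset (\<lambda>x. x \<in> S) (proots p) = {#}"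
    by (rule multiset_eqI) (use assms in \<open>auto simp: order_0I\<close>)
  thus ?thesis by (simp add: real_zeros_in_def)
qed

text \<open>
Each zero in the interval, counted with multiplicity, changes the sign between the endpoints once.
\<close>
lemma even_zeros_interval:
  assumes "q \<noteq> 0" "a < b" "poly q a \<noteq> 0" "poly q b \<noteq> 0"
  shows "even (real_zeros_in q {a<..<b}) \<longleftrightarrow> poly q a * poly q b > 0"
  using assms
proof (induction "degree q" arbitrary: q rule: less_induct)
  case less
  show ?case
  proof (cases "\<exists>x. a < x \<and> x < b \<and> poly q x = 0")
    case False
    hence "real_zeros_in q {a<..<b} = 0" using less.prems by (intro real_zeros_in_no_roots) auto
    moreover have "poly q a * poly q b > 0"
      using less.prems False poly_IVT_pos[OF less.prems(2), of q] poly_IVT_neg[OF less.prems(2), of q]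
      by (metis linorder_neqE_linordered_idom mult_neg_neg mult_pos_pos)
    ultimately show ?thesis by simp
  next
    case True
    then obtain x k where x: "a < x" "x < b" and q: "q = [:- x, 1:] * k" by (auto simp: poly_eq_0_iff_dvd elim: dvdE)
    have k: "k \<noteq> 0" "poly k a \<noteq> 0" "poly k b \<noteq> 0" using less.prems q by auto
    have "degree k < degree q" unfolding q using k by (subst degree_mult_eq) auto
    hence IH: "even (real_zeros_in k {a<..<b}) \<longleftrightarrow> poly k a * poly k b > 0"
      using less.hyps less.prems(2) k by blast
    have "real_zeros_in q {a<..<b} = Suc (real_zeros_in k {a<..<b})"
      unfolding q using real_zeros_in_mult[of "[:- x, 1:]" k "{a<..<b}"] k x by (simp add: real_zeros_in_linear del: mult_pCons_left)
    moreover have "poly q a * poly q b > 0 \<longleftrightarrow> \<not> poly k a * poly k b > 0"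
    proof -
      have eq: "poly q a * poly q b = ((a - x) * (b - x)) * (poly k a * poly k b)" by (simp add: q algebra_simps)
      have "(a - x) * (b - x) < 0" using x by (simp add: mult_neg_pos)
      thus ?thesis unfolding eq using k by (intro mult_neg_pos_iff) simp_all
    qed
    ultimately show ?thesis using IH by simp
  qed
qed

lemma lead_coeff_reflect: "lead_coeff (reflect q) = (-1) ^ degree q * lead_coeff q"
  unfolding reflect_def by (subst lead_coeff_comp) (auto simp: mult.commute)

lemma even_zeros_ray:
  assumes "q \<noteq> 0" "poly q b \<noteq> 0"
  shows "even (real_zeros_in q {..<b}) \<longleftrightarrow> (-1) ^ degree q * lead_coeff q * poly q b > 0"
  using assms
proof (induction "degree q" arbitrary: q rule: less_induct)
  case less
  show ?case
  proof (cases "\<exists>x. x < b \<and> poly q x = 0")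
    case False
    hence "real_zeros_in q {..<b} = 0" using less.prems by (intro real_zeros_in_no_roots) auto
    moreover have "lead_coeff (reflect q) * poly (reflect q) (- b) > 0"
    proof (rule pos_beyond_roots)
      fix x assume "x \<ge> - b"
      hence "- x = b \<or> - x < b" by auto
      thus "poly (reflect q) x \<noteq> 0" using False less.prems by auto
    qed (use less.prems in simp)
    ultimately show ?thesis unfolding lead_coeff_reflect by simp
  next
    case True
    then obtain x k where x: "x < b" and q: "q = [:- x, 1:] * k" by (auto simp: poly_eq_0_iff_dvd elim: dvdE)
    have k: "k \<noteq> 0" "poly k b \<noteq> 0" using less.prems q by auto
    have deg: "degree q = Suc (degree k)" unfolding q using k by (subst degree_mult_eq) auto
    hence IH: "even (real_zeros_in k {..<b}) \<longleftrightarrow> (-1) ^ degree k * lead_coeff k * poly k b > 0"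
      using less.hyps k by simp
    have "real_zeros_in q {..<b} = Suc (real_zeros_in k {..<b})"
      unfolding q using real_zeros_in_mult[of "[:- x, 1:]" k "{..<b}"] k x by (simp add: real_zeros_in_linear del: mult_pCons_left)
    moreover have "(-1) ^ degree q * lead_coeff q * poly q b > 0 \<longleftrightarrow> \<not> (-1) ^ degree k * lead_coeff k * poly k b > 0"
    proof -
      have "lead_coeff q = lead_coeff k" unfolding q lead_coeff_mult by simp
      hence eq: "(-1) ^ degree q * lead_coeff q * poly q b = (x - b) * ((-1) ^ degree k * lead_coeff k * poly k b)"
        by (simp add: deg) (simp add: q algebra_simps)
      show ?thesis unfolding eq using x k by (intro mult_neg_pos_iff) simp_all
    qed
    ultimately show ?thesis using IH by simp
  qed
qed

section \<open>Generalized Hurwitz polynomials in terms of signs\<close>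

lemma sign_prod_square_differences:
  fixes a :: real
  assumes "finite F" "a \<notin> F" "a \<ge> 0" "\<And>b. b \<in> F \<Longrightarrow> b \<ge> 0"
  shows "(-1) ^ card {b \<in> F. b < a} * (\<Prod>b\<in>F. b\<^sup>2 - a\<^sup>2) > 0"
  using assms
proof (induction F rule: finite_induct)
  case (insert b F)
  have IH: "(-1) ^ card {b \<in> F. b < a} * (\<Prod>b\<in>F. b\<^sup>2 - a\<^sup>2) > 0" using insert by simp
  show ?case
  proof (cases "b < a")
    case True
    hence "{x \<in> insert b F. x < a} = insert b {x \<in> F. x < a}" by auto
    moreover have "b \<notin> {x \<in> F. x < a}" "finite {x \<in> F. x < a}" using insert.hyps by auto
    moreover have "b\<^sup>2 - a\<^sup>2 < 0" using True insert.prems by (simp add: power_strict_mono)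
    ultimately show ?thesis using IH insert.hyps mult_neg_neg[of "b\<^sup>2 - a\<^sup>2" "- ((-1) ^ card {b \<in> F. b < a} * (\<Prod>b\<in>F. b\<^sup>2 - a\<^sup>2))"]
      by (simp add: algebra_simps)
  next
    case False
    hence "{x \<in> insert b F. x < a} = {x \<in> F. x < a}" by auto
    moreover have "b\<^sup>2 - a\<^sup>2 > 0" using False insert.prems by (simp add: power_strict_mono)
    ultimately show ?thesis using IH insert.hyps mult_pos_pos[of "b\<^sup>2 - a\<^sup>2" "(-1) ^ card {b \<in> F. b < a} * (\<Prod>b\<in>F. b\<^sup>2 - a\<^sup>2)"]
      by (simp add: algebra_simps)
  qed
qed simp

lemma pderiv_at_simple_root:
  fixes q :: "real poly"
  assumes "finite Z" "a \<in> Z" "p = (\<Prod>b\<in>Z. [:- b, 1:]) * q"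
  shows "poly (pderiv p) a = (\<Prod>b\<in>Z - {a}. a - b) * poly q a"
proof -
  have "p = [:- a, 1:] * ((\<Prod>b\<in>Z - {a}. [:- b, 1:]) * q)"
    unfolding assms(3) prod.remove[OF assms(1,2)] by (simp only: mult.assoc)
  hence "poly (pderiv p) a = poly ((\<Prod>b\<in>Z - {a}. [:- b, 1:]) * q) a"
    by (simp add: pderiv_mult pderiv_pCons del: mult_pCons_left)
  thus ?thesis by (simp add: poly_prod)
qed

text \<open>
With \<open>Z\<close> factored out, \<open>p(-a) p'(a)\<close> is \<open>-2 a q(a) q(-a)\<close> times the product of \<open>b\<^sup>2 - a\<^sup>2\<close> over the
other elements \<open>b\<close> of \<open>Z\<close>, of which exactly those below \<open>a\<close> give negative factors.
\<close>
lemma root_pair_sign: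
  fixes q :: "real poly"
  assumes Z: "finite Z" "a \<in> Z" "\<And>b. b \<in> Z \<Longrightarrow> b \<ge> 0" and a: "a > 0"
    and p: "p = (\<Prod>b\<in>Z. [:- b, 1:]) * q" and q: "poly q a > 0"
  shows "poly p (- a) * poly (pderiv p) a < 0 \<longleftrightarrow> (-1) ^ card {b \<in> Z. b < a} * poly q (- a) > 0"
proof -
  have 1: "poly p (- a) = - 2 * a * ((\<Prod>b\<in>Z - {a}. - a - b) * poly q (- a))"
  proof -
    have "poly [:- b, 1:] (- a) = - a - b" for b by simp
    hence "poly p (- a) = (\<Prod>b\<in>Z. - a - b) * poly q (- a)" by (simp only: p poly_mult poly_prod)
    thus ?thesis unfolding prod.remove[OF Z(1,2)] by simp
  qed
  have 2: "(\<Prod>b\<in>Z - {a}. - a - b) * (\<Prod>b\<in>Z - {a}. a - b) = (\<Prod>b\<in>Z - {a}. b\<^sup>2 - a\<^sup>2)"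
    unfolding prod.distrib[symmetric] by (intro prod.cong refl) (simp add: algebra_simps power2_eq_square)
  have prod: "poly p (- a) * poly (pderiv p) a
      = - (2 * a * poly q a) * ((\<Prod>b\<in>Z - {a}. b\<^sup>2 - a\<^sup>2) * poly q (- a))"
    unfolding pderiv_at_simple_root[OF Z(1,2) p] 1 2[symmetric] by (simp only: mult_ac mult_minus_left mult_minus_right)
  define s where "s = ((-1) ^ card {b \<in> Z. b < a} :: real)"
  have "{b \<in> Z - {a}. b < a} = {b \<in> Z. b < a}" by auto
  hence sgn: "s * (\<Prod>b\<in>Z - {a}. b\<^sup>2 - a\<^sup>2) > 0"
    using sign_prod_square_differences[of "Z - {a}" a] Z a by (simp add: s_def)
  have "s * s = 1" by (simp add: s_def flip: power_add)
  moreover have "(s * (\<Prod>b\<in>Z - {a}. b\<^sup>2 - a\<^sup>2)) * (s * poly q (- a)) = (s * s) * ((\<Prod>b\<in>Z - {a}. b\<^sup>2 - a\<^sup>2) * poly q (- a))"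
    by (simp only: mult_ac)
  ultimately have "(\<Prod>b\<in>Z - {a}. b\<^sup>2 - a\<^sup>2) * poly q (- a) = (s * (\<Prod>b\<in>Z - {a}. b\<^sup>2 - a\<^sup>2)) * (s * poly q (- a))"
    by simp
  moreover have "0 < x * y \<longleftrightarrow> 0 < y" if "x > 0" for x y :: real
    using that by (simp add: zero_less_mult_iff)
  ultimately have "(\<Prod>b\<in>Z - {a}. b\<^sup>2 - a\<^sup>2) * poly q (- a) > 0 \<longleftrightarrow> s * poly q (- a) > 0"
    using sgn by metis
  thus ?thesis unfolding prod using a q by (simp add: s_def mult_less_0_iff zero_less_mult_iff)
qed

lemma pderiv_cpoly: "pderiv (cpoly p) = cpoly (pderiv p)"
  by (rule poly_eqI) (simp add: coeff_pderiv coeff_map_poly)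

lemma order_cpoly_real_root:
  assumes "poly p a = 0" "degree p \<ge> 1"
  shows "order (of_real a) (cpoly p) = 1 \<longleftrightarrow> poly (pderiv p) a \<noteq> 0"
proof -
  have "p \<noteq> 0" using assms(2) by auto
  have d: "pderiv (cpoly p) \<noteq> 0" using assms(2) by (simp add: pderiv_cpoly pderiv_eq_0_iff)
  have "order (of_real a) (cpoly p) = Suc (order (of_real a) (pderiv (cpoly p)))"
    using assms(1) \<open>p \<noteq> 0\<close> by (intro order_pderiv) simp_all
  moreover have "order (of_real a) (pderiv (cpoly p)) = 0 \<longleftrightarrow> poly (pderiv (cpoly p)) (of_real a) \<noteq> 0"
    using order_root[of "pderiv (cpoly p)" "of_real a"] d by simp
  ultimately show ?thesis by (simp add: pderiv_cpoly)
qed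

lemma stable_pos:
  assumes "stable q" "lead_coeff q > 0" "x \<ge> 0"
  shows "poly q x > 0"
proof -
  have "poly q y \<noteq> 0" if "y \<ge> x" for y
  proof
    assume "poly q y = 0"
    hence "poly (cpoly q) (of_real y) = 0" by simp
    hence "Re (of_real y) < 0" using assms(1) unfolding stable_def by blast
    thus False using that assms(3) by simp
  qed
  hence "lead_coeff q * poly q x > 0" using assms(1) by (intro pos_beyond_roots) (auto simp: stable_def)
  thus ?thesis using assms(2) by (simp add: zero_less_mult_iff)
qed

lemma real_zeros_in_factor:
  assumes "finite Z" "p = (\<Prod>b\<in>Z. [:- b, 1:]) * q" "q \<noteq> 0" "Z \<inter> S = {}"
  shows "real_zeros_in p S = real_zeros_in q S"
proof -
  have "real_zeros_in (\<Prod>b\<in>Z. [:- b, 1:]) S = 0"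
    using assms by (intro real_zeros_in_no_roots) (auto simp: poly_prod)
  moreover have "(\<Prod>b\<in>Z. [:- b, 1 :: real:]) \<noteq> 0" using assms(1) by simp
  ultimately show ?thesis using assms(3) by (simp add: assms(2) real_zeros_in_mult)
qed

lemma enumeration_card:
  fixes \<mu> :: "nat \<Rightarrow> real"
  assumes "strict_mono_on {1..k} \<mu>" "i \<in> {1..k}"
  shows "card {b \<in> \<mu> ` {1..k}. b < \<mu> i} = i - (1 :: nat)"
proof -
  have inj: "inj_on \<mu> {1..k}" using assms(1) by (rule strict_mono_on_imp_inj_on)
  have "{b \<in> \<mu> ` {1..k}. b < \<mu> i} = \<mu> ` {1..<i}"
  proof (intro equalityI subsetI)
    fix b assume "b \<in> {b \<in> \<mu> ` {1..k}. b < \<mu> i}"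
    then obtain j where j: "j \<in> {1..k}" "b = \<mu> j" "\<mu> j < \<mu> i" by auto
    hence "j < i" using strict_mono_on_less[OF assms(1) j(1) assms(2)] by simp
    thus "b \<in> \<mu> ` {1..<i}" using j by auto
  next
    fix b assume "b \<in> \<mu> ` {1..<i}"
    then obtain j where "j \<in> {1..<i}" "b = \<mu> j" by auto
    thus "b \<in> {b \<in> \<mu> ` {1..k}. b < \<mu> i}"
      using assms strict_mono_onD[OF assms(1), of j i] by auto
  qed
  moreover have "inj_on \<mu> {1..<i}" using inj assms(2) by (auto intro: inj_on_subset)
  ultimately show ?thesis by (simp add: card_image)
qed

text \<open>
The cofactor \<open>q\<close> of the zeros in the right half-plane is positive on the nonnegative axis. Starting
with \<open>q(0) > 0\<close>, the parity conditions yield the signs of \<open>q(-\<mu> 1), q(-\<mu> 2), \<dots>\<close> in turn.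
\<close>
proposition generalized_hurwitz_imp_root_form:
  assumes "generalized_hurwitz_order p k" "degree p \<ge> 1"
  shows "\<exists>Z q. root_form p Z q \<and> card Z = k"
proof -
  from assms(1) obtain \<mu> where lead: "0 < lead_coeff p" and mono: "strict_mono_on {1..k} \<mu>"
    and nonneg': "\<forall>i\<in>{1..k}. 0 \<le> \<mu> i"
    and zeros: "{z :: complex. poly (cpoly p) z = 0 \<and> 0 \<le> Re z} = (\<lambda>i. complex_of_real (\<mu> i)) ` {1..k}"
    and simple': "\<forall>i\<in>{1..k}. order (complex_of_real (\<mu> i)) (cpoly p) = 1"
    and mirror': "\<forall>i\<in>{1..k}. 0 < \<mu> i \<longrightarrow> poly p (- \<mu> i) \<noteq> 0"
    and odd': "\<forall>i\<in>{1..<k}. odd (real_zeros_in p {- \<mu> (Suc i)<..<- \<mu> i})"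
    and even': "1 \<le> k \<longrightarrow> even (real_zeros_in p {- \<mu> 1<..<0})"
    unfolding generalized_hurwitz_order_def by (elim exE conjE) (rule that)
  note nonneg = bspec[OF nonneg'] and simple = bspec[OF simple'] and mirror = mp[OF bspec[OF mirror']]
    and odd = bspec[OF odd'] and even = mp[OF even']
  define Z where "Z = \<mu> ` {1..k}"
  have fin: "finite Z" by (simp add: Z_def)
  have card: "card Z = k"
    using strict_mono_on_imp_inj_on[OF mono] by (simp add: Z_def card_image)
  have Z0: "a \<ge> 0" if "a \<in> Z" for a using that nonneg by (auto simp: Z_def)
  have root: "poly p a = 0" if "a \<in> Z" for a
  proof -
    have "complex_of_real a \<in> {z. poly (cpoly p) z = 0 \<and> 0 \<le> Re z}"
      unfolding zeros using that by (auto simp: Z_def)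
    thus ?thesis by simp
  qed
  obtain q where q: "p = (\<Prod>a\<in>Z. [:- a, 1:]) * q"
    using prod_linear_dvd[OF fin root] by (auto elim: dvdE)
  have q0: "q \<noteq> 0" using q assms(2) by auto
  have st: "stable q"
    unfolding stable_def
  proof (intro conjI allI impI q0)
    fix z assume z: "poly (cpoly q) z = 0"
    show "Re z < 0"
    proof (rule ccontr)
      assume "\<not> Re z < 0"
      hence "z \<in> {z. poly (cpoly p) z = 0 \<and> 0 \<le> Re z}" using z by (simp add: q)
      then obtain i where i: "i \<in> {1..k}" "z = of_real (\<mu> i)" unfolding zeros by auto
      hence iZ: "\<mu> i \<in> Z" by (simp add: Z_def)
      have "poly (pderiv p) (\<mu> i) \<noteq> 0"
        using order_cpoly_real_root[OF root[OF iZ] assms(2)] simple[OF i(1)] by simp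
      moreover have "poly q (\<mu> i) = 0" using z i(2) by simp
      ultimately show False using pderiv_at_simple_root[OF fin iZ q] by simp
    qed
  qed
  have "lead_coeff p = lead_coeff q"
    unfolding q lead_coeff_mult lead_coeff_prod by simp
  hence leadq: "lead_coeff q > 0" using lead by simp
  note qpos = stable_pos[OF st leadq]
  have zeros_eq: "real_zeros_in p {a<..<b} = real_zeros_in q {a<..<b}" if "b \<le> 0" for a b
    by (rule real_zeros_in_factor[OF fin q q0]) (use Z0 that in force)
  have qnz: "poly q (- \<mu> i) \<noteq> 0" if "i \<in> {1..k}" for i
  proof (cases "\<mu> i = 0")
    case True
    thus ?thesis using qpos[of 0] by simp
  next
    case False
    hence "poly p (- \<mu> i) \<noteq> 0" using mirror nonneg that by (simp add: less_le)
    thus ?thesis by (simp add: q)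
  qed
  have sign: "(-1) ^ (i - 1) * poly q (- \<mu> i) > 0" if "1 \<le> i" "i \<le> k" for i
    using that
  proof (induction i rule: dec_induct)
    case base
    show ?case
    proof (cases "\<mu> 1 = 0")
      case True
      thus ?thesis using qpos[of 0] by simp
    next
      case False
      hence "- \<mu> 1 < 0" using nonneg[of 1] base by simp
      hence "poly q (- \<mu> 1) * poly q 0 > 0"
        using even_zeros_interval[OF q0, of "- \<mu> 1" 0] qnz[of 1] qpos[of 0] even base zeros_eq[of 0 "- \<mu> 1"] by simp
      thus ?thesis using qpos[of 0] by (simp add: zero_less_mult_iff)
    qed
  next
    case (step i)
    have i: "i \<in> {1..<k}" "i \<in> {1..k}" "Suc i \<in> {1..k}" using step by auto
    have "- \<mu> (Suc i) < - \<mu> i" using strict_mono_onD[OF mono i(2,3)] by simp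
    hence "\<not> poly q (- \<mu> (Suc i)) * poly q (- \<mu> i) > 0"
      using even_zeros_interval[OF q0, of "- \<mu> (Suc i)" "- \<mu> i"] qnz[OF i(2)] qnz[OF i(3)] odd[OF i(1)]
        zeros_eq[of "- \<mu> i" "- \<mu> (Suc i)"] nonneg[OF i(2)] by simp
    moreover have "poly q (- \<mu> (Suc i)) * poly q (- \<mu> i) \<noteq> 0" using qnz[OF i(2)] qnz[OF i(3)] by simp
    ultimately have neg: "poly q (- \<mu> (Suc i)) * poly q (- \<mu> i) < 0" by linarith
    have IH: "(-1) ^ (i - 1) * poly q (- \<mu> i) > 0" using step by simp
    obtain j where j: "i = Suc j" using step.hyps by (cases i) auto
    define s where "s = ((-1) ^ j :: real)"
    have "s = 1 \<or> s = - 1" unfolding s_def by (cases "even j") auto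
    hence "- s * poly q (- \<mu> (Suc i)) > 0"
      using neg IH by (auto simp: j s_def[symmetric] mult_less_0_iff)
    thus ?case by (simp add: j s_def)
  qed
  have "poly p (- a) * poly (pderiv p) a < 0" if a: "a \<in> Z" "a > 0" for a
  proof -
    obtain i where i: "i \<in> {1..k}" "a = \<mu> i" using a by (auto simp: Z_def)
    have "(-1) ^ card {b \<in> Z. b < a} * poly q (- a) > 0"
      using enumeration_card[OF mono i(1)] sign[of i] i by (simp add: Z_def)
    thus ?thesis using root_pair_sign[OF fin a(1) Z0 a(2) q qpos[of a]] a(2) by simp
  qed
  hence "root_form p Z q" unfolding root_form_def using fin Z0 q st by blast
  thus ?thesis using card by blast
qed

text \<open>
Conversely, the signs of \<open>q(-\<mu> i)\<close> alternate, starting with a positive one, which fixes the parities between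
these points and, with the sign at \<open>-\<infinity>\<close>, beyond the last one.
\<close>
proposition root_form_imp_generalized_hurwitz:
  assumes rf: "root_form p Z q" and p: "degree p \<ge> 1" "lead_coeff p > 0" and card: "card Z \<le> (degree p + 1) div 2"
  shows "generalized_hurwitz_order p (card Z)"
proof -
  have fin: "finite Z" and Z0: "\<And>a. a \<in> Z \<Longrightarrow> 0 \<le> a" and q: "p = (\<Prod>a\<in>Z. [:- a, 1:]) * q" and st: "stable q"
    and neg: "\<And>a. a \<in> Z \<Longrightarrow> 0 < a \<Longrightarrow> poly p (- a) * poly (pderiv p) a < 0"
    using rf unfolding root_form_def by auto
  have q0: "q \<noteq> 0" using st by (simp add: stable_def)
  have leadeq: "lead_coeff p = lead_coeff q"
    unfolding q lead_coeff_mult lead_coeff_prod by simp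
  hence leadq: "lead_coeff q > 0" using p by simp
  note qpos = stable_pos[OF st leadq]
  define k where "k = card Z"
  \<comment> \<open>the zeros are numbered from \<open>1\<close>, list positions from \<open>0\<close>\<close>
  define \<mu> where "\<mu> i = sorted_list_of_set Z ! (i - 1)" for i
  have len: "length (sorted_list_of_set Z) = k" by (simp add: k_def)
  have mono: "strict_mono_on {1..k} \<mu>"
  proof (rule strict_mono_onI)
    fix i j assume ij: "i \<in> {1..k}" "j \<in> {1..k}" "i < j"
    have "sorted_wrt (<) (sorted_list_of_set Z)" by (rule strict_sorted_list_of_set)
    moreover have "i - 1 < j - 1" "j - 1 < length (sorted_list_of_set Z)" using ij len by auto
    ultimately show "\<mu> i < \<mu> j" unfolding \<mu>_def by (rule sorted_wrt_nth_less)
  qed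
  have img: "\<mu> ` {1..k} = Z"
  proof -
    have "\<mu> ` {1..k} = set (sorted_list_of_set Z)"
    proof (intro equalityI subsetI)
      fix x assume "x \<in> \<mu> ` {1..k}"
      then obtain i where "i \<in> {1..k}" "x = sorted_list_of_set Z ! (i - 1)" by (auto simp: \<mu>_def)
      moreover have "i - 1 < length (sorted_list_of_set Z)" using calculation(1) len by auto
      ultimately show "x \<in> set (sorted_list_of_set Z)" using nth_mem by blast
    next
      fix x assume "x \<in> set (sorted_list_of_set Z)"
      then obtain j where "j < k" "x = sorted_list_of_set Z ! j" using len by (auto simp: in_set_conv_nth)
      hence "x = \<mu> (Suc j)" "Suc j \<in> {1..k}" by (auto simp: \<mu>_def)
      thus "x \<in> \<mu> ` {1..k}" by blast
    qed
    thus ?thesis using fin by simp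
  qed
  have \<mu>Z: "\<mu> i \<in> Z" if "i \<in> {1..k}" for i using img that by blast
  have \<mu>0: "\<mu> i \<ge> 0" if "i \<in> {1..k}" for i using Z0[OF \<mu>Z[OF that]] .
  have root: "poly p a = 0" if "a \<in> Z" for a using that fin by (auto simp: q poly_prod)
  have simple: "poly (pderiv p) a \<noteq> 0" if "a \<in> Z" for a
    using pderiv_at_simple_root[OF fin that q] qpos[OF Z0[OF that]] fin by auto
  have croot: "poly (cpoly p) z = 0 \<longleftrightarrow> z \<in> of_real ` Z \<or> poly (cpoly q) z = 0" for z
  proof -
    have "poly (cpoly (\<Prod>a\<in>Z. [:- a, 1:])) z = (\<Prod>a\<in>Z. z - of_real a)"
      using fin by (induction Z rule: finite_induct) (simp_all add: algebra_simps)
    thus ?thesis using fin by (auto simp: q)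
  qed
  have sign: "(-1) ^ (i - 1) * poly q (- \<mu> i) > 0" if i: "i \<in> {1..k}" for i
  proof (cases "\<mu> i = 0")
    case False
    hence pos: "\<mu> i > 0" using \<mu>0[OF i] by simp
    show ?thesis
      using root_pair_sign[OF fin \<mu>Z[OF i] Z0 pos q qpos] neg[OF \<mu>Z[OF i] pos] pos
        enumeration_card[OF mono i, unfolded img] by simp
  next
    case True
    have "i = 1"
    proof (rule ccontr)
      assume "i \<noteq> 1"
      hence "\<mu> 1 < \<mu> i" using i strict_mono_onD[OF mono, of 1 i] by auto
      thus False using \<mu>0[of 1] True i by simp
    qed
    thus ?thesis using qpos[of 0] True by simp
  qed
  hence qnz: "poly q (- \<mu> i) \<noteq> 0" if "i \<in> {1..k}" for i using that by force
  have zeros_eq: "real_zeros_in p S = real_zeros_in q S" if "S \<subseteq> {..<0}" for S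
    by (rule real_zeros_in_factor[OF fin q q0]) (use Z0 that in force)
  have between: "odd (real_zeros_in p {- \<mu> (Suc i)<..<- \<mu> i})" if i: "i \<in> {1..<k}" for i
  proof -
    have i': "i \<in> {1..k}" "Suc i \<in> {1..k}" using i by auto
    have "- \<mu> (Suc i) < - \<mu> i" using strict_mono_onD[OF mono i'] by simp
    moreover obtain j where j: "i = Suc j" using i by (cases i) auto
    define s where "s = ((-1) ^ j :: real)"
    have "s = 1 \<or> s = - 1" unfolding s_def by (cases "even j") auto
    hence "\<not> poly q (- \<mu> (Suc i)) * poly q (- \<mu> i) > 0"
      using sign[OF i'(1)] sign[OF i'(2)] by (auto simp: j s_def[symmetric] zero_less_mult_iff)
    moreover have "real_zeros_in p {- \<mu> (Suc i)<..<- \<mu> i} = real_zeros_in q {- \<mu> (Suc i)<..<- \<mu> i}"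
      using \<mu>0[OF i'(1)] by (intro zeros_eq) auto
    ultimately show ?thesis using even_zeros_interval[OF q0] qnz[OF i'(1)] qnz[OF i'(2)] by metis
  qed
  have below_0: "even (real_zeros_in p {- \<mu> 1<..<0})" if "1 \<le> k"
  proof (cases "\<mu> 1 = 0")
    case True
    thus ?thesis by (simp add: real_zeros_in_def)
  next
    case False
    hence "- \<mu> 1 < 0" using \<mu>0[of 1] that by simp
    moreover have "poly q (- \<mu> 1) * poly q 0 > 0" using sign[of 1] that qpos[of 0] by simp
    moreover have "real_zeros_in p {- \<mu> 1<..<0} = real_zeros_in q {- \<mu> 1<..<0}" by (intro zeros_eq) auto
    ultimately show ?thesis using even_zeros_interval[OF q0, of "- \<mu> 1" 0] qnz[of 1] that qpos[of 0] by simp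
  qed
  have cover: "x \<in> \<mu> ` {1..k} \<or> (\<exists>i\<in>{1..<k}. x \<in> {- \<mu> (Suc i)<..<- \<mu> i}) \<or>
      x \<in> {- \<mu> 1<..<0} \<or> x \<in> {..<- \<mu> k}" if k: "1 \<le> k" and x: "poly p x = 0" for x
  proof -
    consider "x \<ge> 0" | "x < 0" "x > - \<mu> 1" | "x < - \<mu> k" | "x < 0" "x \<le> - \<mu> 1" "x \<ge> - \<mu> k" by linarith
    thus ?thesis
    proof cases
      case 1
      have "poly q x \<noteq> 0" using qpos[OF 1] by simp
      hence "x \<in> Z" using x fin by (auto simp: q poly_prod)
      hence "x \<in> \<mu> ` {1..k}" by (simp only: img)
      thus ?thesis by blast
    next
      case 4
      have nx: "x \<noteq> - \<mu> i" if i: "i \<in> {1..k}" for i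
      proof
        assume "x = - \<mu> i"
        hence "\<mu> i > 0" "poly p (- \<mu> i) = 0" using 4 x by auto
        thus False using neg[OF \<mu>Z[OF i]] by simp
      qed
      define I where "I = {i \<in> {1..k}. x < - \<mu> i}"
      have "1 \<in> I" using 4(2) nx[of 1] k by (auto simp: I_def)
      have "finite I" by (simp add: I_def)
      define i where "i = Max I"
      have iI: "i \<in> I" unfolding i_def using \<open>finite I\<close> \<open>1 \<in> I\<close> by (intro Max_in) auto
      have "i \<noteq> k" using iI 4(3) by (auto simp: I_def)
      hence ik: "i \<in> {1..<k}" using iI by (auto simp: I_def)
      have "Suc i \<notin> I" using Max_ge[OF \<open>finite I\<close>, of "Suc i"] by (auto simp: i_def)
      hence "x \<ge> - \<mu> (Suc i)" using ik by (auto simp: I_def)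
      hence "x \<in> {- \<mu> (Suc i)<..<- \<mu> i}" using nx[of "Suc i"] ik iI by (auto simp: I_def)
      thus ?thesis using ik by blast
    qed auto
  qed
  have ray: "if even (degree p) then odd (real_zeros_in p {..<- \<mu> k}) else even (real_zeros_in p {..<- \<mu> k})" if k: "1 \<le> k"
  proof -
    have kk: "k \<in> {1..k}" using k by simp
    have zq: "real_zeros_in p {..<- \<mu> k} = real_zeros_in q {..<- \<mu> k}" using \<mu>0[OF kk] by (intro zeros_eq) auto
    have deg: "degree p = k + degree q"
      using fin q0 by (simp add: q degree_mult_eq degree_prod_linear k_def)
    have eq: "(-1) ^ degree q * lead_coeff q * poly q (- \<mu> k) = lead_coeff q * ((-1) ^ degree q * poly q (- \<mu> k))"
      by (simp only: mult_ac)
    have ev: "even (real_zeros_in q {..<- \<mu> k}) \<longleftrightarrow> (-1) ^ degree q * poly q (- \<mu> k) > 0"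
      unfolding even_zeros_ray[OF q0 qnz[OF kk]] eq using leadq zero_less_mult_pos mult_pos_pos by blast
    obtain j where j: "k = Suc j" using k by (cases k) auto
    have pos: "(-1) ^ j * poly q (- \<mu> k) > 0" using sign[OF kk] j by simp
    have par: "even (degree p) \<longleftrightarrow> odd (j + degree q)" by (simp add: deg j)
    have "even (real_zeros_in q {..<- \<mu> k}) \<longleftrightarrow> even (j + degree q)"
      unfolding ev using pos by (cases "even j"; cases "even (degree q)") simp_all
    thus ?thesis unfolding zq using par by simp
  qed
  have right: "{z. poly (cpoly p) z = 0 \<and> 0 \<le> Re z} = (\<lambda>i. complex_of_real (\<mu> i)) ` {1..k}"
  proof -
    have "{z. poly (cpoly p) z = 0 \<and> 0 \<le> Re z} = of_real ` Z"
    proof (intro equalityI subsetI)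
      fix z assume "z \<in> {z. poly (cpoly p) z = 0 \<and> 0 \<le> Re z}"
      hence z: "poly (cpoly p) z = 0" "\<not> Re z < 0" by auto
      hence "poly (cpoly q) z \<noteq> 0" using st unfolding stable_def by blast
      thus "z \<in> of_real ` Z" using z(1) unfolding croot by blast
    next
      fix z :: complex assume "z \<in> of_real ` Z"
      moreover from this obtain a where "a \<in> Z" "z = of_real a" by blast
      ultimately show "z \<in> {z. poly (cpoly p) z = 0 \<and> 0 \<le> Re z}" using croot Z0[of a] by simp
    qed
    thus ?thesis by (simp add: img[symmetric] image_image)
  qed
  have order: "order (complex_of_real (\<mu> i)) (cpoly p) = 1" if "i \<in> {1..k}" for i
    using order_cpoly_real_root[OF root[OF \<mu>Z[OF that]] p(1)] simple[OF \<mu>Z[OF that]] by simp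
  have mirror: "poly p (- \<mu> i) \<noteq> 0" if "i \<in> {1..k}" "0 < \<mu> i" for i
    using neg[OF \<mu>Z[OF that(1)] that(2)] by auto
  have left: "Re z < 0" if "poly (cpoly p) z = 0" "z \<notin> \<real>" for z
  proof -
    have "z \<notin> of_real ` Z" using that(2) by auto
    hence "poly (cpoly q) z = 0" using that(1) unfolding croot by blast
    thus ?thesis using st unfolding stable_def by blast
  qed
  show ?thesis
    unfolding generalized_hurwitz_order_def k_def[symmetric]
  proof (intro conjI exI[of _ \<mu>] ballI allI impI)
    show "0 < lead_coeff p" "k \<le> (degree p + 1) div 2" "strict_mono_on {1..k} \<mu>"
      using p(2) card mono by (simp_all add: k_def)
    show "{z. poly (cpoly p) z = 0 \<and> 0 \<le> Re z} = (\<lambda>i. complex_of_real (\<mu> i)) ` {1..k}"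
      by (rule right)
    show "even (real_zeros_in p {- \<mu> 1<..<0})" if "1 \<le> k" by (rule below_0[OF that])
    show "if even (degree p) then odd (real_zeros_in p {..<- \<mu> k}) else even (real_zeros_in p {..<- \<mu> k})"
      if "1 \<le> k" by (rule ray[OF that])
  next
    fix i assume i: "i \<in> {1..k}"
    show "0 \<le> \<mu> i" by (rule \<mu>0[OF i])
    show "order (complex_of_real (\<mu> i)) (cpoly p) = 1" by (rule order[OF i])
    show "poly p (- \<mu> i) \<noteq> 0" if "0 < \<mu> i" by (rule mirror[OF i that])
  next
    fix i assume "i \<in> {1..<k}"
    thus "odd (real_zeros_in p {- \<mu> (Suc i)<..<- \<mu> i})" by (rule between)
  next
    fix x assume "1 \<le> k" "poly p x = 0"
    thus "x \<in> \<mu> ` {1..k} \<or> (\<exists>i\<in>{1..<k}. x \<in> {- \<mu> (Suc i)<..<- \<mu> i}) \<or>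
        x \<in> {- \<mu> 1<..<0} \<or> x \<in> {..<- \<mu> k}" by (rule cover)
  next
    fix z assume "poly (cpoly p) z = 0 \<and> z \<notin> \<real>"
    thus "Re z < 0" using left by blast
  qed
qed

section \<open>Characterisation by Hurwitz determinants\<close>

theorem theorem5p6:
  fixes p :: "real poly" and n :: nat
  assumes "degree p = n" and "n \<ge> 1" and "lead_coeff p > 0"
  shows "(generalized_hurwitz p \<longleftrightarrow>
           (\<forall>j\<in>{1..n - 1}. even (n - 1 - j) \<longrightarrow> hurwitz_det j p > 0)) \<and>
         (\<forall>k. generalized_hurwitz_order p k \<longrightarrow>
           k = (if poly p 0 \<noteq> 0 then frobenius_changes (hurwitz_seq n p)
                else frobenius_changes (hurwitz_seq (n - 2) p) + 1))"
proof -
  have deg: "degree p \<ge> 1" using assms by simp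
  let ?jf = "\<lambda>c xs. c > 0 \<and> J_fraction c (J_num p) (odd_part p) xs \<and> length xs = J_len p"
  have dets: "(\<forall>j\<in>{1..n - 1}. even (n - 1 - j) \<longrightarrow> hurwitz_det j p > 0) \<longleftrightarrow> (\<exists>c xs. ?jf c xs)"
    using hurwitz_dets_pos_iff_J_fraction[OF deg assms(3)] assms(1) by auto
  have gh: "\<exists>Z q c xs. root_form p Z q \<and> card Z = k \<and> ?jf c xs" if k: "generalized_hurwitz_order p k" for k
  proof -
    obtain Z q where Z: "root_form p Z q" "card Z = k"
      using generalized_hurwitz_imp_root_form[OF k deg] by blast
    thus ?thesis using root_form_imp_J_fraction[OF Z(1) assms(3)] by blast
  qed
  have "generalized_hurwitz p" if jf: "?jf c xs" for c xs
  proof -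
    obtain Z q where Z: "root_form p Z q" using J_fraction_imp_root_form[OF deg assms(3)] jf by blast
    have "card Z \<le> J_len p" using root_form_card[OF deg assms(3) _ _ _ Z] jf by blast
    thus ?thesis using root_form_imp_generalized_hurwitz[OF Z deg assms(3)] by (auto simp: generalized_hurwitz_def)
  qed
  hence "generalized_hurwitz p \<longleftrightarrow> (\<exists>c xs. ?jf c xs)"
    using gh unfolding generalized_hurwitz_def by blast
  moreover have "k = (if poly p 0 \<noteq> 0 then frobenius_changes (hurwitz_seq n p)
                else frobenius_changes (hurwitz_seq (n - 2) p) + 1)" if k: "generalized_hurwitz_order p k" for k
  proof -
    obtain Z q c xs where Z: "root_form p Z q" "card Z = k" and jf: "c > 0" "J_fraction c (J_num p) (odd_part p) xs" "length xs = J_len p"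
      using gh[OF k] by blast
    note V = root_form_card[OF deg assms(3) jf Z(1), unfolded Z(2)]
    show ?thesis
    proof (cases "poly p 0 = 0")
      case False
      have "frobenius_changes (hurwitz_seq n p) = frobenius_changes (continuants (map snd xs) (Suc (J_len p)))"
        using frobenius_hurwitz_seq[OF jf(2,1,3) assms(3), of n] assms(1) by simp
      thus ?thesis using V False by simp
    next
      case True
      have "frobenius_changes (hurwitz_seq (n - 2) p) = frobenius_changes (continuants (map snd xs) (J_len p))"
      \<comment> \<open>for \<open>n = 1\<close> the truncated \<open>n - 2 = 0\<close> still denotes the sequence \<open>(1)\<close>\<close>
      proof (cases "n = 1")
        case True
        thus ?thesis using assms(1) by (simp add: hurwitz_seq_def continuants_def)
      next
        case False
        then obtain m where m: "n = Suc (Suc m)" using assms(2) by (metis One_nat_def not0_implies_Suc not_one_le_zero)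
        thus ?thesis
          using frobenius_hurwitz_seq[OF jf(2,1,3) assms(3), of m] assms(1) by simp
      qed
      thus ?thesis using V True by simp
    qed
  qed
  ultimately show ?thesis using dets by blast
qed

end
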